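(* Up to isomorphism, there are exactly $12$ excluded minors for $\mathcal{P}_{U_{2,4}}^3$, and for every integer $k > 3$ there are exactly $k+7$ excluded minors for $\mathcal{P}_{U_{2,4}}^k$. In particular, for every integer $k\ge 3$ the set of excluded minors for $\mathcal{P}_{U_{2,4}}^k$ is finite (up to isomorphism).
   Context: A polymatroid is a pair $(E,\rho)$ where $E$ is a finite set and $\rho:2^E\to\mathbb{Z}$ satisfies $\rho(\emptyset)=0$, monotonicity ($A\subseteq B\subseteq E$ implies $\rho(A)\le\rho(B)$) and submodularity ($\rho(A)+\rho(B)\ge\rho(A\cap B)+\rho(A\cup B)$ for all $A,B\subseteq E$). For an integer $k\ge 1$, a $k$-polymatroid is a polymatroid with $\rho(\{e\})\le k$ for all $e\in E$. Two polymatroids are isomorphic if there is a rank-preserving bijection between their ground sets. For $X\subseteq E$, the deletion $\rho\backslash X$ and contraction $\rho/X$ are the polymatroids on $E-X$ given by $(\rho\backslash X)(Y)=\rho(Y)$ and $(\rho/X)(Y)=\rho(X\cup Y)-\rho(X)$. A minor of $\rho$ is a polymatroid $(\rho\backslash X)/Y$ with $X,Y\subseteq E$ disjoint; it is proper if $X\cup Y\ne\emptyset$. The $k$-natural matroid $M_\rho^k$ of a $k$-polymatroid $(E,\rho)$: for each $e\in E$ let $X_e$ be a set of $k$ elements, with $X_e\cap X_f=\emptyset$ for $e\neq f$; for $A\subseteq E$ let $X_A=\bigcup_{e\in A}X_e$. Then $M_\rho^k$ is the matroid on $X_E$ with rank function $r(X)=\min\{\rho(A)+|X-X_A| : A\subseteq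 E\}$. $\mathcal{P}_{U_{2,4}}^k$ denotes the class of $k$-polymatroids whose $k$-natural matroid is binary (representable over $\mathbb{F}_2$). It is minor-closed. An excluded minor for $\mathcal{P}_{U_{2,4}}^k$ is a $k$-polymatroid that is not in $\mathcal{P}_{U_{2,4}}^k$ but all of whose proper minors are in $\mathcal{P}_{U_{2,4}}^k$. *)

theory Defs
  imports Complex_Main "HOL-Library.Z2" "HOL-Library.Function_Algebras"
begin

section \<open>Polymatroids\<close>

text \<open>
  A set function on the subsets of \<^term>\<open>E\<close> is a pair \<^term>\<open>(E, \<rho>)\<close>; the values of
  \<^term>\<open>\<rho>\<close> on sets that are not contained in \<^term>\<open>E\<close> are irrelevant, and
  \<open>isomorphic\<close> below ignores them.
\<close>

type_synonym 'a set_function = "'a set \<times> ('a set \<Rightarrow> int)"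

definition polymatroid :: "'a set_function \<Rightarrow> bool" where
  "polymatroid P \<longleftrightarrow> (case P of (E, \<rho>) \<Rightarrow>
     finite E \<and>
     \<rho> {} = 0 \<and>
     (\<forall>A B. A \<subseteq> B \<and> B \<subseteq> E \<longrightarrow> \<rho> A \<le> \<rho> B) \<and>
     (\<forall>A B. A \<subseteq> E \<and> B \<subseteq> E \<longrightarrow> \<rho> A + \<rho> B \<ge> \<rho> (A \<inter> B) + \<rho> (A \<union> B)))"

definition k_polymatroid :: "nat \<Rightarrow> 'a set_function \<Rightarrow> bool" where
  "k_polymatroid k P \<longleftrightarrow> polymatroid P \<and> (\<forall>e \<in> fst P. snd P {e} \<le> int k)"

definition isomorphic :: "'a set_function \<Rightarrow> 'b set_function \<Rightarrow> bool" where
  "isomorphic P Q \<longleftrightarrow>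
     (\<exists>f. bij_betw f (fst P) (fst Q) \<and> (\<forall>A \<subseteq> fst P. snd Q (f ` A) = snd P A))"

definition deletion :: "'a set_function \<Rightarrow> 'a set \<Rightarrow> 'a set_function" where
  "deletion P X = (fst P - X, snd P)"

definition contraction :: "'a set_function \<Rightarrow> 'a set \<Rightarrow> 'a set_function" where
  "contraction P X = (fst P - X, \<lambda>Y. snd P (X \<union> Y) - snd P X)"

definition proper_minors :: "'a set_function \<Rightarrow> 'a set_function set" where
  "proper_minors P = {contraction (deletion P X) Y | X Y.
     X \<subseteq> fst P \<and> Y \<subseteq> fst P \<and> X \<inter> Y = {} \<and> X \<union> Y \<noteq> {}}"


section \<open>The natural matroid\<close>

text \<open>
  The set $X_e$ is \<^term>\<open>{e} \<times> {..<k}\<close>, so that $X_A$ is \<^term>\<open>A \<times> {..<k}\<close>.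
\<close>

definition natural_matroid :: "nat \<Rightarrow> 'a set_function \<Rightarrow> ('a \<times> nat) set_function" where
  "natural_matroid k P =
     (fst P \<times> {..<k},
      \<lambda>X. MIN A \<in> Pow (fst P). snd P A + int (card (X - A \<times> {..<k})))"


section \<open>Binary matroids\<close>

text \<open>
  The vectors of a representation are taken in the space of all sequences over the field, which
  contains a copy of every finite-dimensional space; the span of a finite family is
  finite-dimensional, so \<open>vector_space.dim\<close> is the usual dimension there.
\<close>

definition seq_scale :: "'f::field \<Rightarrow> (nat \<Rightarrow> 'f) \<Rightarrow> (nat \<Rightarrow> 'f)" where
  "seq_scale c v = (\<lambda>i. c * v i)"

lemma vector_space_seq_scale: "vector_space seq_scale"
  by unfold_locales (auto simp: seq_scale_def fun_eq_iff algebra_simps)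

definition linear_representation :: "('e \<Rightarrow> nat \<Rightarrow> 'f::field) \<Rightarrow> 'e set_function \<Rightarrow> bool" where
  "linear_representation \<phi> M \<longleftrightarrow>
     (\<forall>X \<subseteq> fst M. snd M X = int (vector_space.dim seq_scale (\<phi> ` X)))"

definition binary :: "'e set_function \<Rightarrow> bool" where
  "binary M \<longleftrightarrow> (\<exists>\<phi> :: 'e \<Rightarrow> nat \<Rightarrow> bit. linear_representation \<phi> M)"


section \<open>Excluded minors\<close>

definition binary_natural :: "nat \<Rightarrow> 'a set_function set" where
  "binary_natural k = {P. k_polymatroid k P \<and> binary (natural_matroid k P)}"

definition excluded_minors :: "nat \<Rightarrow> 'a set_function set" where
  "excluded_minors k =
     {P. k_polymatroid k P \<and> P \<notin> binary_natural k \<and> proper_minors P \<subseteq> binary_natural k}"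

definition iso_on :: "'a set_function set \<Rightarrow> 'a set_function rel" where
  "iso_on C = {(P, Q). P \<in> C \<and> Q \<in> C \<and> isomorphic P Q}"

lemma isomorphic_refl: "isomorphic P P"
  unfolding isomorphic_def by (intro exI[of _ id]) auto

lemma isomorphic_sym:
  assumes "isomorphic P Q"
  shows "isomorphic Q P"
proof -
  obtain f where f: "bij_betw f (fst P) (fst Q)" "\<forall>A \<subseteq> fst P. snd Q (f ` A) = snd P A"
    using assms unfolding isomorphic_def by blast
  let ?g = "inv_into (fst P) f"
  have g: "bij_betw ?g (fst Q) (fst P)"
    using f(1) by (rule bij_betw_inv_into)
  have "snd P (?g ` B) = snd Q B" if "B \<subseteq> fst Q" for B
  proof -
    have "f ` ?g ` B = B"
      using that f(1) by (auto simp: bij_betw_def image_inv_into_cancel)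
    moreover have "?g ` B \<subseteq> fst P"
      using that g by (auto simp: bij_betw_def)
    ultimately show ?thesis
      using f(2) by metis
  qed
  with g show ?thesis
    unfolding isomorphic_def by blast
qed

lemma isomorphic_trans:
  assumes "isomorphic P Q" and "isomorphic Q R"
  shows "isomorphic P R"
proof -
  obtain f where f: "bij_betw f (fst P) (fst Q)" "\<forall>A \<subseteq> fst P. snd Q (f ` A) = snd P A"
    using assms(1) unfolding isomorphic_def by blast
  obtain g where g: "bij_betw g (fst Q) (fst R)" "\<forall>A \<subseteq> fst Q. snd R (g ` A) = snd Q A"
    using assms(2) unfolding isomorphic_def by blast
  have "snd R ((g \<circ> f) ` A) = snd P A" if "A \<subseteq> fst P" for A
  proof -
    have "f ` A \<subseteq> fst Q"
      using that f(1) by (auto simp: bij_betw_def)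
    then show ?thesis
      using that f(2) g(2) by (metis image_comp)
  qed
  with bij_betw_trans[OF f(1) g(1)] show ?thesis
    unfolding isomorphic_def by blast
qed

lemma equiv_iso_on: "equiv C (iso_on C)"
  by (rule equivI)
    (auto simp: iso_on_def refl_on_def sym_def trans_def
      intro: isomorphic_refl isomorphic_sym isomorphic_trans)

text \<open>
  The excluded minors up to isomorphism. When \<^typ>\<open>'a\<close> is infinite, every finite ground set
  has a copy in it, so every isomorphism type of polymatroids occurs.
\<close>

definition excluded_minor_classes :: "nat \<Rightarrow> 'a set_function set set" where
  "excluded_minor_classes k = excluded_minors k // iso_on (excluded_minors k)"

end

theory Submission
  imports Defs "HOL-Library.Countable_Set" "HOL-Library.FuncSet"
begin

text \<open>
  The idea is to replace the natural matroid by a matroid on the ground set itself. The copies of an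
  element are clones in the natural matroid, and clones in a binary matroid are parallel or in series
  unless they are loops or coloops. So, for \<open>k \<ge> 3\<close>, in a binary natural matroid every element has
  rank \<open>0\<close> or \<open>1\<close>, or it is big and its copies form a series class or coloops. Shrinking the copies
  of each element to a single element leaves a binary matroid on the ground set whose rank function is
  the core, \<open>\<sigma> A = \<rho> A - (k - 1) |A \<inter> F|\<close>, where \<open>F\<close> is the set of elements of rank at least two.
  Conversely, parallel and series extension of a representation of the core gives one of the natural
  matroid. This is \<open>binary_natural_matroid_iff\<close>: the natural matroid is binary iff the core is the
  rank function of a binary matroid.
  
  The core is always submodular and commutes with minors as long as no big element becomes small. This
  turns the search for excluded minors into three cases (\<open>excluded_minor_cases\<close>).
  \<^item> A single element whose rank lies strictly between \<open>1\<close> and \<open>k - 1\<close>; there are \<open>k - 3\<close> of these.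
  \<^item> The core is not monotone. A minimal instance has only two elements, because contracting a third
    one would keep the drop. Solving for the three ranks gives five instances, and two more
    for \<open>k = 3\<close>, where contraction may turn a big element of rank \<open>2 = k - 1\<close> into one of
    rank \<open>1 = k - 2\<close>.
  \<^item> The core is monotone. Then it is a matroid that is minimally nonbinary, so it is the four-point
    line by Tutte's theorem (\<open>four_point_line\<close>), and any of its elements may be big. Up to isomorphism
    only the number of big elements matters, which gives five instances.
  
  The total is \<open>(k - 3) + 5 + 5 = k + 7\<close>, and \<open>7 + 5 = 12\<close> for \<open>k = 3\<close>.
  
  Tutte's theorem is proved by comparing a minimally nonbinary matroid with the only binary matroid
  that it could be, read off from the fundamental circuits of a basis. By minimality the two differ on
  at most one set, the complement of the basis, and this is possible only on four elements.
\<close>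

section \<open>Binary rank by counting cycles\<close>

lemma bit_add_eq_0_iff: "a + b = 0 \<longleftrightarrow> a = b" for a b :: bit
  by (cases a; cases b) simp_all

lemma sum_bit_sym_diff:
  fixes f :: "'e \<Rightarrow> bit"
  assumes "finite A" and "finite B"
  shows "sum f (sym_diff A B) = sum f A + sum f B"
proof -
  have "sum f A = sum f (A \<inter> B) + sum f (A - B)"
    by (rule sum.Int_Diff[OF assms(1)])
  moreover have "sum f B = sum f (A \<inter> B) + sum f (B - A)"
    using sum.Int_Diff[OF assms(2), of f A] by (simp add: Int_commute)
  moreover have "sum f (sym_diff A B) = sum f (A - B) + sum f (B - A)"
    by (rule sum.union_disjoint) (use assms in auto)
  ultimately show ?thesis
    by (cases "sum f (A \<inter> B)"; cases "sum f (A - B)"; cases "sum f (B - A)") simp_all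
qed

text \<open>
  Over the two-element field a linear combination is a subset, so the relations between the vectors
  indexed by \<open>X\<close> are the sets \<open>Y \<subseteq> X\<close> whose vectors add up to zero. They form a vector space of
  dimension \<open>|X| - rank X\<close>, which is why counting them determines the rank.
\<close>

definition cycles :: "('e \<Rightarrow> 'i \<Rightarrow> bit) \<Rightarrow> 'e set \<Rightarrow> 'e set set" where
  "cycles \<phi> X = {Y. Y \<subseteq> X \<and> (\<forall>i. (\<Sum>y\<in>Y. \<phi> y i) = 0)}"

definition bin_rank :: "('e \<Rightarrow> 'i \<Rightarrow> bit) \<Rightarrow> 'e set \<Rightarrow> nat" where
  "bin_rank \<phi> X = (THE n. card (cycles \<phi> X) * 2 ^ n = 2 ^ card X)"

lemma cycles_mono: "X \<subseteq> Y \<Longrightarrow> cycles \<phi> X \<subseteq> cycles \<phi> Y"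
  by (auto simp: cycles_def)

lemma cycles_subset: "Y \<in> cycles \<phi> X \<Longrightarrow> Y \<subseteq> X"
  by (simp add: cycles_def)

lemma cycles_sum: "Y \<in> cycles \<phi> X \<Longrightarrow> (\<Sum>y\<in>Y. \<phi> y i) = 0"
  by (simp add: cycles_def)

lemma empty_in_cycles [simp]: "{} \<in> cycles \<phi> X"
  by (simp add: cycles_def)

lemma finite_cycles: "finite X \<Longrightarrow> finite (cycles \<phi> X)"
  by (rule finite_subset[of _ "Pow X"]) (auto simp: cycles_def)

lemma cycles_sym_diff:
  assumes "finite X" and "Y \<in> cycles \<phi> X" and "Z \<in> cycles \<phi> X"
  shows "sym_diff Y Z \<in> cycles \<phi> X"
proof -
  have "Y \<subseteq> X" "Z \<subseteq> X" "finite Y" "finite Z"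
    using assms finite_subset[of _ X] by (auto simp: cycles_def)
  then show ?thesis
    using assms(2,3) by (auto simp: cycles_def sum_bit_sym_diff simp del: sum.insert)
qed

lemma bin_rank_unique:
  assumes "finite X" and "card (cycles \<phi> X) * 2 ^ n = 2 ^ card X"
  shows "bin_rank \<phi> X = n"
proof -
  have "card (cycles \<phi> X) \<noteq> 0"
    using assms(1) finite_cycles[of X \<phi>] empty_in_cycles[of \<phi> X] by (metis card_eq_0_iff empty_iff)
  moreover have "m = n" if "card (cycles \<phi> X) * 2 ^ m = card (cycles \<phi> X) * 2 ^ n" for m
    using that calculation by simp
  ultimately show ?thesis
    unfolding bin_rank_def using assms(2) by (metis (mono_tags, lifting) the_equality)
qed

lemma bin_rank_cong: "cycles \<phi> X = cycles \<psi> X \<Longrightarrow> bin_rank \<phi> X = bin_rank \<psi> X"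
  by (simp add: bin_rank_def)

definition dependent_on :: "('e \<Rightarrow> 'i \<Rightarrow> bit) \<Rightarrow> 'e set \<Rightarrow> 'e \<Rightarrow> bool" where
  "dependent_on \<phi> X x \<longleftrightarrow> (\<exists>Y \<subseteq> X. \<forall>i. \<phi> x i = (\<Sum>y\<in>Y. \<phi> y i))"

lemma dependent_on_mono: "dependent_on \<phi> X x \<Longrightarrow> X \<subseteq> X' \<Longrightarrow> dependent_on \<phi> X' x"
  unfolding dependent_on_def by blast

lemma insert_in_cycles_iff:
  assumes "finite X" and "x \<notin> X" and "Y \<subseteq> X"
  shows "insert x Y \<in> cycles \<phi> (insert x X) \<longleftrightarrow> (\<forall>i. \<phi> x i = (\<Sum>y\<in>Y. \<phi> y i))"
proof -
  have Y: "finite Y" "x \<notin> Y"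
    using assms finite_subset by auto
  have "(\<Sum>y\<in>insert x Y. \<phi> y i) = 0 \<longleftrightarrow> \<phi> x i = (\<Sum>y\<in>Y. \<phi> y i)" for i
    unfolding sum.insert[OF Y] by (rule bit_add_eq_0_iff)
  moreover have "insert x Y \<subseteq> insert x X"
    using assms(3) by blast
  ultimately show ?thesis
    by (simp only: cycles_def mem_Collect_eq simp_thms)
qed

lemma cycles_insert_independent:
  assumes "finite X" and "x \<notin> X" and "\<not> dependent_on \<phi> X x"
  shows "cycles \<phi> (insert x X) = cycles \<phi> X"
proof
  show "cycles \<phi> X \<subseteq> cycles \<phi> (insert x X)"
    by (rule cycles_mono) auto
  show "cycles \<phi> (insert x X) \<subseteq> cycles \<phi> X"
  proof
    fix Y
    assume Y: "Y \<in> cycles \<phi> (insert x X)"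
    have "x \<notin> Y"
    proof
      assume "x \<in> Y"
      then have "insert x (Y - {x}) \<in> cycles \<phi> (insert x X)"
        using Y by (simp add: insert_absorb)
      moreover have "Y - {x} \<subseteq> X"
        using cycles_subset[OF Y] by blast
      ultimately have "\<forall>i. \<phi> x i = (\<Sum>y\<in>Y - {x}. \<phi> y i)"
        by (metis insert_in_cycles_iff[OF assms(1,2)])
      with \<open>Y - {x} \<subseteq> X\<close> show False
        using assms(3) unfolding dependent_on_def by blast
    qed
    then show "Y \<in> cycles \<phi> X"
      using Y by (auto simp: cycles_def)
  qed
qed

text \<open>
  One cycle through \<open>x\<close> translates the cycles that avoid \<open>x\<close> to those that contain \<open>x\<close>.
\<close>

lemma card_cycles_insert_dependent:
  assumes "finite X" and "x \<notin> X" and "dependent_on \<phi> X x"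
  shows "card (cycles \<phi> (insert x X)) = 2 * card (cycles \<phi> X)"
proof -
  obtain Y where Y: "Y \<subseteq> X" "\<forall>i. \<phi> x i = (\<Sum>y\<in>Y. \<phi> y i)"
    using assms(3) unfolding dependent_on_def by blast
  define C where "C = insert x Y"
  have C: "C \<in> cycles \<phi> (insert x X)"
    unfolding C_def using insert_in_cycles_iff[OF assms(1,2) Y(1)] Y(2) by blast
  have fin: "finite (insert x X)"
    using assms(1) by simp
  have XY: "x \<in> C"
    by (simp add: C_def)
  have sub: "cycles \<phi> X \<subseteq> cycles \<phi> (insert x X)"
    by (rule cycles_mono) auto
  let ?S = "(\<lambda>Z. sym_diff Z C) ` cycles \<phi> X"
  have notx: "x \<notin> Z" if "Z \<in> cycles \<phi> X" for Z
    using that assms(2) by (auto simp: cycles_def)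
  have "cycles \<phi> (insert x X) = cycles \<phi> X \<union> ?S"
  proof
    show "cycles \<phi> X \<union> ?S \<subseteq> cycles \<phi> (insert x X)"
      using sub cycles_sym_diff[OF fin _ C] by blast
    show "cycles \<phi> (insert x X) \<subseteq> cycles \<phi> X \<union> ?S"
    proof
      fix Z
      assume Z: "Z \<in> cycles \<phi> (insert x X)"
      show "Z \<in> cycles \<phi> X \<union> ?S"
      proof (cases "x \<in> Z")
        case False
        then show ?thesis
          using Z by (auto simp: cycles_def)
      next
        case True
        let ?W = "sym_diff Z C"
        have "?W \<in> cycles \<phi> (insert x X)" "x \<notin> ?W"
          using cycles_sym_diff[OF fin Z C] True XY by blast+
        then have "?W \<in> cycles \<phi> X"
          by (auto simp: cycles_def)
        moreover have "Z = sym_diff ?W C"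
          by blast
        ultimately show ?thesis
          by blast
      qed
    qed
  qed
  moreover have "cycles \<phi> X \<inter> ?S = {}"
    using notx XY by blast
  moreover have "card ?S = card (cycles \<phi> X)"
  proof (rule card_image, rule inj_onI)
    fix Z Z'
    assume "sym_diff Z C = sym_diff Z' C"
    then show "Z = Z'"
      by blast
  qed
  ultimately show ?thesis
    using finite_cycles[OF assms(1), of \<phi>] by (simp add: card_Un_disjoint)
qed

lemma card_cycles:
  assumes "finite X"
  shows "card (cycles \<phi> X) * 2 ^ bin_rank \<phi> X = 2 ^ card X"
proof -
  have "\<exists>n. card (cycles \<phi> X) * 2 ^ n = 2 ^ card X"
    using assms
  proof (induction X)
    case empty
    have "cycles \<phi> {} = {{}}"
      by (auto simp: cycles_def)
    then show ?case
      by (intro exI[of _ 0]) simp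
  next
    case (insert x X)
    then obtain n where n: "card (cycles \<phi> X) * 2 ^ n = 2 ^ card X"
      by blast
    show ?case
    proof (cases "dependent_on \<phi> X x")
      case True
      then show ?thesis
        using n insert card_cycles_insert_dependent[of X x \<phi>] by (intro exI[of _ n]) simp
    next
      case False
      then show ?thesis
        using n insert cycles_insert_independent[of X x \<phi>] by (intro exI[of _ "Suc n"]) simp
    qed
  qed
  then obtain n where "card (cycles \<phi> X) * 2 ^ n = 2 ^ card X"
    by blast
  then show ?thesis
    using bin_rank_unique[OF assms, of \<phi> n] by simp
qed

lemma cycles_empty [simp]: "cycles \<phi> {} = {{}}"
  by (auto simp: cycles_def)

lemma bin_rank_empty [simp]: "bin_rank \<phi> {} = 0"
  by (rule bin_rank_unique) simp_all

lemma bin_rank_insert: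
  assumes "finite X" and "x \<notin> X"
  shows "bin_rank \<phi> (insert x X) = bin_rank \<phi> X + (if dependent_on \<phi> X x then 0 else 1)"
  by (rule bin_rank_unique)
    (use assms card_cycles[OF assms(1), of \<phi>] in
      \<open>auto simp: cycles_insert_independent card_cycles_insert_dependent\<close>)

lemma bin_rank_insert_le:
  assumes "finite X"
  shows "bin_rank \<phi> X \<le> bin_rank \<phi> (insert x X)" "bin_rank \<phi> (insert x X) \<le> Suc (bin_rank \<phi> X)"
  using bin_rank_insert[OF assms, of x \<phi>] by (cases "x \<in> X"; simp add: insert_absorb)+

lemma bin_rank_Un_le:
  assumes "finite X" and "finite Y"
  shows "bin_rank \<phi> X \<le> bin_rank \<phi> (X \<union> Y)"
  using assms(2)
proof (induction Y)
  case (insert y Y)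
  then show ?case
    using bin_rank_insert_le(1)[of "X \<union> Y" \<phi> y] assms(1) by simp
qed simp

lemma bin_rank_mono:
  assumes "X \<subseteq> Y" and "finite Y"
  shows "bin_rank \<phi> X \<le> bin_rank \<phi> Y"
  using bin_rank_Un_le[of X Y \<phi>] assms finite_subset by (metis Un_absorb1)

lemma cycles_cong:
  assumes "\<And>x i. x \<in> X \<Longrightarrow> \<phi> x i = \<psi> x i"
  shows "cycles \<phi> X = cycles \<psi> X"
proof -
  have "(\<Sum>y\<in>Y. \<phi> y i) = (\<Sum>y\<in>Y. \<psi> y i)" if "Y \<subseteq> X" for Y i
    using that assms by (intro sum.cong) auto
  then show ?thesis
    by (auto simp: cycles_def)
qed

lemma bin_rank_singleton: "bin_rank \<phi> {x} = (if \<forall>i. \<phi> x i = 0 then 0 else 1)"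
  using bin_rank_insert[of "{}" x \<phi>] by (simp add: dependent_on_def)

lemma bin_rank_zero:
  assumes "finite X" and "\<And>x i. \<phi> x i = 0"
  shows "bin_rank \<phi> X = 0"
proof -
  have "cycles \<phi> X = Pow X"
    using assms(2) by (auto simp: cycles_def)
  then show ?thesis
    using assms(1) by (intro bin_rank_unique) (simp_all add: card_Pow)
qed

lemma bin_rank_eq_card_iff:
  assumes "finite X"
  shows "bin_rank \<phi> X = card X \<longleftrightarrow> cycles \<phi> X = {{}}"
proof
  assume "bin_rank \<phi> X = card X"
  then have "card (cycles \<phi> X) = 1"
    using card_cycles[OF assms, of \<phi>] by simp
  then show "cycles \<phi> X = {{}}"
    by (metis card_1_singletonE empty_in_cycles singletonD)
next
  assume "cycles \<phi> X = {{}}"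
  then show "bin_rank \<phi> X = card X"
    using bin_rank_unique[OF assms, of \<phi> "card X"] by simp
qed

lemma exists_independent_subset:
  assumes "finite X"
  shows "\<exists>I \<subseteq> X. cycles \<phi> I = {{}} \<and> card I = bin_rank \<phi> X"
  using assms
proof (induction X)
  case empty
  then show ?case
    using bin_rank_eq_card_iff[of "{}" \<phi>] by auto
next
  case (insert x X)
  then obtain I where I: "I \<subseteq> X" "cycles \<phi> I = {{}}" "card I = bin_rank \<phi> X"
    by blast
  have fI: "finite I" "x \<notin> I"
    using I(1) insert.hyps finite_subset by auto
  show ?case
  proof (cases "dependent_on \<phi> X x")
    case True
    then show ?thesis
      using I bin_rank_insert[OF insert.hyps, of \<phi>] by (intro exI[of _ I]) (simp add: subset_insertI2)
  next
    case False
    then have "\<not> dependent_on \<phi> I x"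
      using dependent_on_mono[OF _ I(1)] by metis
    then have "cycles \<phi> (insert x I) = {{}}"
      using cycles_insert_independent[OF fI, of \<phi>] I(2) by simp
    then show ?thesis
      using I fI False bin_rank_insert[OF insert.hyps, of \<phi>]
      by (intro exI[of _ "insert x I"]) (simp add: subset_insertI2)
  qed
qed

lemma independent_card_le_bin_rank:
  assumes "finite X" and "I \<subseteq> X" and "cycles \<phi> I = {{}}"
  shows "card I \<le> bin_rank \<phi> X"
  using bin_rank_mono[OF assms(2,1), of \<phi>] bin_rank_eq_card_iff[OF finite_subset[OF assms(2,1)], of \<phi>] assms(3)
  by simp

interpretation seq: vector_space "seq_scale :: bit \<Rightarrow> (nat \<Rightarrow> bit) \<Rightarrow> nat \<Rightarrow> bit"
  by (rule vector_space_seq_scale)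

lemma sum_fun_apply: "(\<Sum>y\<in>Y. \<phi> y) i = (\<Sum>y\<in>Y. \<phi> y i)"
  for \<phi> :: "'e \<Rightarrow> 'i \<Rightarrow> 'b::comm_monoid_add"
  by (induction Y rule: infinite_finite_induct) auto

lemma seq_scale_bit: "seq_scale c v = (if c = 0 then 0 else v)" for c :: bit
  by (auto simp: seq_scale_def fun_eq_iff)

lemma in_span_image_iff:
  fixes \<phi> :: "'e \<Rightarrow> nat \<Rightarrow> bit"
  assumes "finite X"
  shows "v \<in> seq.span (\<phi> ` X) \<longleftrightarrow> (\<exists>Y \<subseteq> X. v = (\<Sum>y\<in>Y. \<phi> y))"
proof
  assume "v \<in> seq.span (\<phi> ` X)"
  then have "v \<in> range (\<lambda>c. \<Sum>w\<in>\<phi> ` X. seq_scale (c w) w)"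
    using seq.span_finite[of "\<phi> ` X"] assms by simp
  then obtain c where c: "v = (\<Sum>w\<in>\<phi> ` X. seq_scale (c w) w)"
    by blast
  define W where "W = {w \<in> \<phi> ` X. c w \<noteq> 0}"
  have "v = (\<Sum>w\<in>W. w)"
    unfolding c W_def using assms
    by (intro sum.mono_neutral_cong_right) (auto simp: seq_scale_bit)
  moreover obtain Y where Y: "Y \<subseteq> X" "inj_on \<phi> Y" "W = \<phi> ` Y"
    using subset_image_inj[of W \<phi> X] unfolding W_def by blast
  ultimately have "v = (\<Sum>y\<in>Y. \<phi> y)"
    by (simp add: sum.reindex)
  then show "\<exists>Y \<subseteq> X. v = (\<Sum>y\<in>Y. \<phi> y)"
    using Y(1) by blast
next
  assume "\<exists>Y \<subseteq> X. v = (\<Sum>y\<in>Y. \<phi> y)"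
  then obtain Y where Y: "Y \<subseteq> X" "v = (\<Sum>y\<in>Y. \<phi> y)"
    by blast
  show "v \<in> seq.span (\<phi> ` X)"
    unfolding Y(2) by (rule seq.span_sum, rule seq.span_base) (use Y(1) in blast)
qed

lemma dim_image_eq_bin_rank:
  fixes \<phi> :: "'e \<Rightarrow> nat \<Rightarrow> bit"
  assumes "finite X"
  shows "seq.dim (\<phi> ` X) = bin_rank \<phi> X"
proof -
  have "\<exists>B. finite B \<and> seq.independent B \<and> seq.span B = seq.span (\<phi> ` X) \<and> card B = bin_rank \<phi> X"
    using assms
  proof (induction X)
    case empty
    then show ?case
      by (intro exI[of _ "{}"]) (simp add: seq.independent_empty)
  next
    case (insert x X)
    then obtain B where B: "finite B" "seq.independent B" "seq.span B = seq.span (\<phi> ` X)"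
      "card B = bin_rank \<phi> X"
      by blast
    have dep: "dependent_on \<phi> X x \<longleftrightarrow> \<phi> x \<in> seq.span B"
      unfolding B(3) in_span_image_iff[OF insert.hyps(1)] dependent_on_def
      by (simp add: fun_eq_iff sum_fun_apply)
    show ?case
    proof (cases "dependent_on \<phi> X x")
      case True
      then have "seq.span (\<phi> ` insert x X) = seq.span B"
        using dep B(3) by (simp add: seq.span_redundant)
      then show ?thesis
        using True B bin_rank_insert[OF insert.hyps, of \<phi>] by auto
    next
      case False
      then have "\<phi> x \<notin> seq.span B" "\<phi> x \<notin> B"
        using dep seq.span_base by blast+
      moreover have "seq.span (insert (\<phi> x) B) = seq.span (\<phi> ` insert x X)"
        using B(3) by (simp add: seq.span_insert)
      ultimately show ?thesis
        using False B bin_rank_insert[OF insert.hyps, of \<phi>]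
        by (intro exI[of _ "insert (\<phi> x) B"]) (simp add: seq.independent_insert)
    qed
  qed
  then show ?thesis
    using seq.dim_eq_card by metis
qed

lemma linear_representation_iff:
  fixes \<phi> :: "'e \<Rightarrow> nat \<Rightarrow> bit"
  assumes "finite E"
  shows "linear_representation \<phi> (E, r) \<longleftrightarrow> (\<forall>X \<subseteq> E. r X = int (bin_rank \<phi> X))"
  unfolding linear_representation_def
  using dim_image_eq_bin_rank[of _ \<phi>] finite_subset[OF _ assms] by simp

lemma binary_iff:
  fixes E :: "'e set"
  assumes "finite E"
  shows "binary (E, r) \<longleftrightarrow> (\<exists>\<phi> :: 'e \<Rightarrow> nat \<Rightarrow> bit. \<forall>X \<subseteq> E. r X = int (bin_rank \<phi> X))"
  unfolding binary_def linear_representation_iff[OF assms] ..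

text \<open>
  Only the vanishing of sums matters for the rank, so the coordinates may be renumbered freely.
\<close>

lemma binaryI:
  fixes \<phi> :: "'e \<Rightarrow> 'i \<Rightarrow> bit"
  assumes "finite E" and J: "countable J" "\<And>e i. e \<in> E \<Longrightarrow> i \<notin> J \<Longrightarrow> \<phi> e i = 0"
    and r: "\<And>X. X \<subseteq> E \<Longrightarrow> r X = int (bin_rank \<phi> X)"
  shows "binary (E, r)"
proof -
  obtain h :: "'i \<Rightarrow> nat" where h: "inj_on h J"
    using J(1) by (auto simp: countable_def)
  define \<phi>' where "\<phi>' e n = (if n \<in> h ` J then \<phi> e (inv_into J h n) else 0)" for e n
  have "cycles \<phi>' X = cycles \<phi> X" if "X \<subseteq> E" for X
  proof -
    have "(\<forall>n. (\<Sum>y\<in>Y. \<phi>' y n) = 0) \<longleftrightarrow> (\<forall>i. (\<Sum>y\<in>Y. \<phi> y i) = 0)" if "Y \<subseteq> E" for Y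
    proof safe
      fix i
      assume *: "\<forall>n. (\<Sum>y\<in>Y. \<phi>' y n) = 0"
      show "(\<Sum>y\<in>Y. \<phi> y i) = 0"
      proof (cases "i \<in> J")
        case True
        then have "\<phi>' y (h i) = \<phi> y i" for y
          using h by (simp add: \<phi>'_def)
        then show ?thesis
          using *[rule_format, of "h i"] by simp
      next
        case False
        then show ?thesis
          using J(2) that by (intro sum.neutral) blast
      qed
    next
      fix n
      assume "\<forall>i. (\<Sum>y\<in>Y. \<phi> y i) = 0"
      then show "(\<Sum>y\<in>Y. \<phi>' y n) = 0"
        by (cases "n \<in> h ` J") (simp_all add: \<phi>'_def)
    qed
    with that show ?thesis
      unfolding cycles_def by blast
  qed
  then have "r X = int (bin_rank \<phi>' X)" if "X \<subseteq> E" for X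
    using r[OF that] that bin_rank_cong by metis
  then show ?thesis
    using binary_iff[OF assms(1)] by blast
qed

lemma binary_cong:
  assumes "finite E" and "binary (E, r)" and "\<And>X. X \<subseteq> E \<Longrightarrow> r X = r' X"
  shows "binary (E, r')"
proof -
  obtain \<phi> :: "'a \<Rightarrow> nat \<Rightarrow> bit" where "\<forall>X \<subseteq> E. r X = int (bin_rank \<phi> X)"
    using assms(2) unfolding binary_iff[OF assms(1)] by (rule exE)
  then have "\<forall>X \<subseteq> E. r' X = int (bin_rank \<phi> X)"
    using assms(3) by simp
  then show ?thesis
    unfolding binary_iff[OF assms(1)] by (rule exI[of _ \<phi>])
qed


section \<open>Matroid rank functions\<close>

definition matroid_rank :: "'e set \<Rightarrow> ('e set \<Rightarrow> int) \<Rightarrow> bool" where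
  "matroid_rank E r \<longleftrightarrow> finite E \<and> r {} = 0 \<and>
     (\<forall>A B. A \<subseteq> B \<and> B \<subseteq> E \<longrightarrow> r A \<le> r B) \<and>
     (\<forall>A B. A \<subseteq> E \<and> B \<subseteq> E \<longrightarrow> r (A \<inter> B) + r (A \<union> B) \<le> r A + r B) \<and>
     (\<forall>x \<in> E. r {x} \<le> 1)"

lemma matroid_rank_finite: "matroid_rank E r \<Longrightarrow> A \<subseteq> E \<Longrightarrow> finite A"
  by (auto simp: matroid_rank_def dest: finite_subset)

lemma matroid_rank_mono: "matroid_rank E r \<Longrightarrow> A \<subseteq> B \<Longrightarrow> B \<subseteq> E \<Longrightarrow> r A \<le> r B"
  unfolding matroid_rank_def by blast

lemma matroid_rank_submod:
  "matroid_rank E r \<Longrightarrow> A \<subseteq> E \<Longrightarrow> B \<subseteq> E \<Longrightarrow> r (A \<inter> B) + r (A \<union> B) \<le> r A + r B"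
  unfolding matroid_rank_def by blast

lemma matroid_rank_insert_le:
  assumes "matroid_rank E r" and "A \<subseteq> E" and "x \<in> E"
  shows "r (insert x A) \<le> r A + 1"
proof (cases "x \<in> A")
  case False
  then have "r {} + r (insert x A) \<le> r {x} + r A"
    using matroid_rank_submod[OF assms(1), of "{x}" A] assms(2,3) by simp
  then show ?thesis
    using assms(1,3) unfolding matroid_rank_def by fastforce
qed (simp add: insert_absorb)

lemma matroid_rank_insert_decreasing:
  assumes "matroid_rank E r" and "A \<subseteq> B" and "B \<subseteq> E" and "x \<in> E"
  shows "r (insert x B) - r B \<le> r (insert x A) - r A"
proof (cases "x \<in> B")
  case True
  then show ?thesis
    using matroid_rank_mono[OF assms(1), of A "insert x A"] assms by (auto simp: insert_absorb)
next
  case False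
  then have "insert x A \<inter> B = A" "insert x A \<union> B = insert x B"
    using assms(2) by auto
  then show ?thesis
    using matroid_rank_submod[OF assms(1), of "insert x A" B] assms(3,4)
      subset_trans[OF assms(2,3)] by simp
qed

lemma matroid_rank_le_card:
  assumes "matroid_rank E r" and "A \<union> D \<subseteq> E"
  shows "r (A \<union> D) \<le> r A + int (card D)"
proof -
  have "finite D"
    using matroid_rank_finite[OF assms(1), of D] assms(2) by simp
  then show ?thesis
    using assms(2)
  proof (induction D)
    case (insert x D)
    then show ?case
      using matroid_rank_insert_le[OF assms(1), of "A \<union> D" x] by simp
  qed simp
qed

lemma matroid_rank_span:
  assumes "matroid_rank E r" and "A \<subseteq> E" and "T \<subseteq> E" and "\<And>x. x \<in> T \<Longrightarrow> r (insert x A) = r A"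
  shows "r (A \<union> T) = r A"
proof -
  have "finite T"
    using matroid_rank_finite[OF assms(1,3)] .
  then show ?thesis
    using assms(3,4)
  proof (induction T)
    case (insert x T)
    have "r (insert x (A \<union> T)) - r (A \<union> T) \<le> r (insert x A) - r A"
      using insert.prems(1) assms(1,2) by (intro matroid_rank_insert_decreasing) auto
    moreover have "r (A \<union> T) \<le> r (insert x (A \<union> T))"
      using insert.prems(1) assms(1,2) by (intro matroid_rank_mono) auto
    ultimately show ?case
      using insert by auto
  qed simp
qed

lemma independent_subset:
  assumes "matroid_rank E r" and "I \<subseteq> J" and "J \<subseteq> E" and "r J = int (card J)"
  shows "r I = int (card I)"
proof -
  have fin: "finite J" "finite I"
    using matroid_rank_finite[OF assms(1)] assms(2,3) by (auto dest: finite_subset)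
  have "r J \<le> r I + int (card (J - I))"
    using matroid_rank_le_card[OF assms(1), of I "J - I"] assms(2,3) by (simp add: Un_absorb1)
  moreover have "card J = card I + card (J - I)"
    using card_Diff_subset[OF fin(2) assms(2)] card_mono[OF fin(1) assms(2)] by simp
  moreover have "r I \<le> int (card I)"
    using matroid_rank_le_card[OF assms(1), of "{}" I] assms unfolding matroid_rank_def by auto
  ultimately show ?thesis
    using assms(4) by simp
qed

lemma exists_basis:
  assumes "matroid_rank E r" and "X \<subseteq> E"
  shows "\<exists>I \<subseteq> X. r I = int (card I) \<and> r I = r X"
proof -
  have fin: "finite X"
    using matroid_rank_finite[OF assms] .
  let ?S = "{I. I \<subseteq> X \<and> r I = int (card I)}"
  have "{} \<in> ?S"
    using assms(1) unfolding matroid_rank_def by simp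
  moreover have "\<forall>J. J \<in> ?S \<longrightarrow> card J < Suc (card X)"
    using card_mono[OF fin] by (simp add: le_imp_less_Suc)
  ultimately have "\<exists>I. I \<in> ?S \<and> (\<forall>J. J \<in> ?S \<longrightarrow> card J \<le> card I)"
    by (rule ex_has_greatest_nat)
  then obtain I where I: "I \<in> ?S" and max: "\<And>J. J \<in> ?S \<Longrightarrow> card J \<le> card I"
    by (elim exE conjE) simp
  have "r (insert x I) = r I" if "x \<in> X" for x
  proof (rule antisym)
    show "r I \<le> r (insert x I)"
      using that I assms by (intro matroid_rank_mono) auto
    show "r (insert x I) \<le> r I"
    proof (rule ccontr)
      assume *: "\<not> r (insert x I) \<le> r I"
      then have "x \<notin> I"
        by (auto simp: insert_absorb)
      moreover have "finite I"
        using I fin finite_subset by auto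
      moreover have "r (insert x I) \<le> r I + 1"
        using that I assms by (intro matroid_rank_insert_le[of E]) auto
      ultimately have "insert x I \<in> ?S"
        using * I that by auto
      from max[OF this] \<open>x \<notin> I\<close> \<open>finite I\<close> show False
        by simp
    qed
  qed
  then have "r (I \<union> X) = r I"
    using I assms by (intro matroid_rank_span) auto
  then show ?thesis
    using I by (intro exI[of _ I]) (auto simp: Un_absorb1)
qed

text \<open>
  Dependence on a set passes to larger sets, so adding an element raises the rank of a larger set by no
  more than that of a smaller one. This is submodularity.
\<close>

lemma matroid_rank_bin_rank:
  assumes "finite E"
  shows "matroid_rank E (\<lambda>X. int (bin_rank \<phi> X))"
proof -
  have decr: "bin_rank \<phi> (A \<union> D) + bin_rank \<phi> S \<le> bin_rank \<phi> (S \<union> D) + bin_rank \<phi> A"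
    if "S \<subseteq> A" "finite A" "finite D" "D \<inter> A = {}" for A S D
    using that(3,4)
  proof (induction D)
    case (insert x D)
    have fin: "finite (A \<union> D)" "finite (S \<union> D)"
      using that insert.hyps finite_subset by auto
    have "x \<notin> A \<union> D" "x \<notin> S \<union> D"
      using insert that(1) by auto
    moreover have "dependent_on \<phi> (S \<union> D) x \<Longrightarrow> dependent_on \<phi> (A \<union> D) x"
      by (rule dependent_on_mono) (use that(1) in auto)
    ultimately show ?case
      using insert bin_rank_insert[OF fin(1), of x \<phi>] bin_rank_insert[OF fin(2), of x \<phi>] by auto
  qed simp
  have "bin_rank \<phi> (A \<inter> B) + bin_rank \<phi> (A \<union> B) \<le> bin_rank \<phi> A + bin_rank \<phi> B"
    if "A \<subseteq> E" "B \<subseteq> E" for A B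
  proof -
    have "A \<union> (B - A) = A \<union> B" "A \<inter> B \<union> (B - A) = B"
      by auto
    moreover have "finite A" "finite B"
      using that assms by (auto dest: finite_subset)
    ultimately show ?thesis
      using decr[of "A \<inter> B" A "B - A"] by (simp add: Int_commute)
  qed
  moreover have "bin_rank \<phi> {x} \<le> 1" for x
    using bin_rank_insert_le(2)[of "{}" \<phi> x] by simp
  ultimately show ?thesis
    unfolding matroid_rank_def
    using assms bin_rank_mono[of _ _ \<phi>] finite_subset[OF _ assms]
    by (simp flip: of_nat_add)
qed

lemma binary_imp_matroid_rank:
  assumes "finite E" and "binary (E, r)"
  shows "matroid_rank E r"
proof -
  obtain \<phi> :: "'a \<Rightarrow> nat \<Rightarrow> bit" where \<phi>: "\<forall>X \<subseteq> E. r X = int (bin_rank \<phi> X)"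
    using assms by (auto simp: binary_iff)
  have *: "r A = int (bin_rank \<phi> A)" if "A \<subseteq> E" for A
    using \<phi> that by blast
  show ?thesis
    using matroid_rank_bin_rank[OF assms(1), of \<phi>] unfolding matroid_rank_def
    by (auto simp: * le_infI1)
qed


section \<open>The fundamental representation and Tutte's theorem\<close>

text \<open>
  Over the two-element field a vector is the sum of the basis vectors in its fundamental circuit.
  So the only possible representation over a basis \<open>B\<close> can be read off from the rank function: the
  coordinate of \<open>x\<close> at \<open>b\<close> is \<open>1\<close> iff \<open>x\<close> can be exchanged for \<open>b\<close>.
\<close>

definition fundamental :: "('e set \<Rightarrow> int) \<Rightarrow> 'e set \<Rightarrow> 'e \<Rightarrow> 'e \<Rightarrow> bit" where
  "fundamental r B x b = (if b \<in> B \<and> r (insert x (B - {b})) = int (card B) then 1 else 0)"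

text \<open>
  Expanding each \<open>\<phi> y\<close> in the basis, with coefficients given by \<open>fundamental\<close>, and comparing the
  coefficients of the independent vectors \<open>\<phi> b\<close> shows that the same sums vanish.
\<close>

lemma cycles_fundamental:
  assumes "finite E" and r: "\<And>X. X \<subseteq> E \<Longrightarrow> r X = int (bin_rank \<phi> X)"
    and B: "B \<subseteq> E" "r B = int (card B)" "r E = r B" and "X \<subseteq> E"
  shows "cycles (fundamental r B) X = cycles \<phi> X"
proof -
  have fB: "finite B"
    using B(1) assms(1) finite_subset by blast
  have indB: "cycles \<phi> B = {{}}"
    using bin_rank_eq_card_iff[OF fB, of \<phi>] r[OF B(1)] B(2) by simp
  have uniq: "C = D" if "C \<subseteq> B" "D \<subseteq> B" "\<forall>i. (\<Sum>b\<in>C. \<phi> b i) = (\<Sum>b\<in>D. \<phi> b i)" for C D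
  proof -
    have "finite C" "finite D"
      using that fB finite_subset by blast+
    then have "sym_diff C D \<in> cycles \<phi> B"
      using that by (auto simp: cycles_def sum_bit_sym_diff bit_add_eq_0_iff)
    then have "sym_diff C D = {}"
      unfolding indB by (rule singletonD)
    then show ?thesis
      by blast
  qed
  have "\<exists>C. C \<subseteq> B \<and> (\<forall>i. \<phi> x i = (\<Sum>b\<in>C. \<phi> b i))" if x: "x \<in> E" for x
  proof (cases "x \<in> B")
    case True
    then show ?thesis
      by (intro exI[of _ "{x}"]) auto
  next
    case False
    have "bin_rank \<phi> (insert x B) \<le> bin_rank \<phi> E"
      using x B(1) assms(1) by (intro bin_rank_mono) auto
    then have "bin_rank \<phi> (insert x B) \<le> bin_rank \<phi> B"
      using r[OF B(1)] r[of E] B(3) by simp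
    then have "dependent_on \<phi> B x"
      using bin_rank_insert[OF fB False, of \<phi>] by (auto split: if_splits)
    then show ?thesis
      unfolding dependent_on_def by blast
  qed
  then obtain C where C: "\<And>x. x \<in> E \<Longrightarrow> C x \<subseteq> B" "\<And>x i. x \<in> E \<Longrightarrow> \<phi> x i = (\<Sum>b\<in>C x. \<phi> b i)"
    by metis
  have fund: "fundamental r B x b = (if b \<in> C x then 1 else 0)" if x: "x \<in> E" for x b
  proof (cases "b \<in> B")
    case b: True
    have cB: "card (B - {b}) = card B - 1" "card B > 0"
      using b fB by (auto simp: card_gt_0_iff)
    have "cycles \<phi> (B - {b}) = {{}}"
      using cycles_mono[of "B - {b}" B \<phi>] indB empty_in_cycles[of \<phi> "B - {b}"] by blast
    then have rb: "bin_rank \<phi> (B - {b}) = card B - 1"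
      using bin_rank_eq_card_iff[of "B - {b}" \<phi>] fB cB by simp
    have CxB: "C x = {x}" if "x \<in> B"
      using uniq[of "C x" "{x}"] C[OF x] that by simp
    have rx: "r (insert x (B - {b})) = int (bin_rank \<phi> (insert x (B - {b})))"
      using x B(1) by (intro r) auto
    show ?thesis
    proof (cases "x \<in> B - {b}")
      case True
      then show ?thesis
        using CxB rx rb cB b by (auto simp: fundamental_def insert_absorb)
    next
      case False
      have "r (insert x (B - {b})) = int (card B) \<longleftrightarrow> \<not> dependent_on \<phi> (B - {b}) x"
        using rx bin_rank_insert[of "B - {b}" x \<phi>] fB False rb cB by auto
      also have "\<dots> \<longleftrightarrow> b \<in> C x"
      proof
        assume "\<not> dependent_on \<phi> (B - {b}) x"
        then have "\<not> C x \<subseteq> B - {b}"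
          using C(2)[OF x] unfolding dependent_on_def by blast
        then show "b \<in> C x"
          using C(1)[OF x] by blast
      next
        assume bC: "b \<in> C x"
        show "\<not> dependent_on \<phi> (B - {b}) x"
        proof
          assume "dependent_on \<phi> (B - {b}) x"
          then obtain D where "D \<subseteq> B - {b}" "\<forall>i. \<phi> x i = (\<Sum>b\<in>D. \<phi> b i)"
            unfolding dependent_on_def by blast
          then have "C x = D"
            using C[OF x] by (intro uniq) auto
          then show False
            using bC \<open>D \<subseteq> B - {b}\<close> by blast
        qed
      qed
      finally show ?thesis
        using b by (simp add: fundamental_def)
    qed
  qed (use C(1)[OF x] in \<open>auto simp: fundamental_def\<close>)
  have "(\<forall>i. (\<Sum>y\<in>Y. fundamental r B y i) = 0) \<longleftrightarrow> (\<forall>i. (\<Sum>y\<in>Y. \<phi> y i) = 0)"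
    if Y: "Y \<subseteq> E" for Y
  proof -
    define D where "D = {b \<in> B. (\<Sum>y\<in>Y. fundamental r B y b) \<noteq> 0}"
    have "(\<Sum>y\<in>Y. \<phi> y i) = (\<Sum>b\<in>D. \<phi> b i)" for i
    proof -
      have "(\<Sum>y\<in>Y. \<phi> y i) = (\<Sum>y\<in>Y. \<Sum>b\<in>B. fundamental r B y b * \<phi> b i)"
      proof (rule sum.cong)
        fix y
        assume "y \<in> Y"
        then have y: "y \<in> E"
          using Y by blast
        have "(\<Sum>b\<in>C y. \<phi> b i) = (\<Sum>b\<in>B. fundamental r B y b * \<phi> b i)"
          using C(1)[OF y] fB by (intro sum.mono_neutral_cong_left) (auto simp: fund[OF y])
        then show "\<phi> y i = (\<Sum>b\<in>B. fundamental r B y b * \<phi> b i)"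
          using C(2)[OF y] by simp
      qed simp
      also have "\<dots> = (\<Sum>b\<in>B. (\<Sum>y\<in>Y. fundamental r B y b) * \<phi> b i)"
        by (subst sum.swap) (simp only: sum_distrib_right)
      also have "\<dots> = (\<Sum>b\<in>D. \<phi> b i)"
        unfolding D_def using fB by (intro sum.mono_neutral_cong_right) auto
      finally show ?thesis .
    qed
    then have "(\<forall>i. (\<Sum>y\<in>Y. \<phi> y i) = 0) \<longleftrightarrow> D \<in> cycles \<phi> B"
      by (auto simp: cycles_def D_def)
    also have "\<dots> \<longleftrightarrow> D = {}"
      using indB by simp
    also have "\<dots> \<longleftrightarrow> (\<forall>i. (\<Sum>y\<in>Y. fundamental r B y i) = 0)"
    proof -
      have "(\<Sum>y\<in>Y. fundamental r B y i) = 0" if "i \<notin> B" for i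
        using that by (simp add: fundamental_def)
      then show ?thesis
        unfolding D_def by blast
    qed
    finally show ?thesis ..
  qed
  then show ?thesis
    using \<open>X \<subseteq> E\<close> unfolding cycles_def by blast
qed

lemma bin_rank_fundamental:
  assumes "finite E" and r: "\<And>X. X \<subseteq> E \<Longrightarrow> r X = int (bin_rank \<phi> X)"
    and B: "B \<subseteq> E" "r B = int (card B)" "r E = r B" and "X \<subseteq> E"
  shows "int (bin_rank (fundamental r B) X) = r X"
proof -
  have "cycles (fundamental r B) X = cycles \<phi> X"
    using assms by (rule cycles_fundamental)
  then show ?thesis
    using bin_rank_cong[of "fundamental r B" X \<phi>] r[OF \<open>X \<subseteq> E\<close>] by simp
qed

lemma bin_rank_fundamental_binary:
  assumes "finite E" and "binary (E, r)"
    and B: "B \<subseteq> E" "r B = int (card B)" "r E = r B" and "X \<subseteq> E"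
  shows "int (bin_rank (fundamental r B) X) = r X"
proof -
  obtain \<phi> :: "'a \<Rightarrow> nat \<Rightarrow> bit" where "\<forall>X \<subseteq> E. r X = int (bin_rank \<phi> X)"
    using assms(2) unfolding binary_iff[OF assms(1)] by (rule exE)
  then show ?thesis
    using bin_rank_fundamental[OF assms(1) _ B \<open>X \<subseteq> E\<close>, of \<phi>] by simp
qed

lemma fundamental_contract:
  assumes "finite B" and "b \<in> B" and "r {b} = 1" and "i \<noteq> b"
  shows "fundamental (\<lambda>X. r (insert b X) - r {b}) (B - {b}) x i = fundamental r B x i"
proof (cases "i \<in> B")
  case True
  then have "insert b (insert x (B - {b} - {i})) = insert x (B - {i})"
    using assms(2,4) by blast
  moreover have "card B = Suc (card (B - {b}))"
    using card_Suc_Diff1[OF assms(1,2)] by simp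
  ultimately show ?thesis
    using assms(3,4) True by (auto simp: fundamental_def)
qed (simp add: fundamental_def)

lemma fundamental_basis:
  assumes "finite B" and "b \<in> B" and "i \<in> B" and "r B = int (card B)"
    and "r (B - {i}) < int (card B)"
  shows "fundamental r B b i = (if i = b then 1 else 0)"
  using assms by (auto simp: fundamental_def insert_absorb)

text \<open>
  Contracting a basis element \<open>b\<close> deletes the coordinate \<open>b\<close>; a cycle of the contraction extends
  in exactly one way, adding \<open>b\<close> or not according to the parity of the deleted coordinate.
\<close>

lemma bin_rank_insert_basis:
  assumes "finite X" and "finite B" and "b \<in> B" and "b \<notin> X" and "r {b} = 1"
    and unit: "\<And>i. fundamental r B b i = (if i = b then 1 else 0)"
  shows "bin_rank (fundamental r B) (insert b X) =
    Suc (bin_rank (fundamental (\<lambda>X. r (insert b X) - r {b}) (B - {b})) X)"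
proof -
  let ?f = "fundamental r B" and ?g = "fundamental (\<lambda>X. r (insert b X) - r {b}) (B - {b})"
  have g: "?g x i = (if i = b then 0 else ?f x i)" for x i
    using fundamental_contract[of B b r i x] assms(2,3,5) by (cases "i = b") (simp_all add: fundamental_def)
  let ?h = "\<lambda>Y. if (\<Sum>y\<in>Y. ?f y b) = 0 then Y else insert b Y"
  have "bij_betw ?h (cycles ?g X) (cycles ?f (insert b X))"
  proof (rule bij_betwI[of _ _ _ "\<lambda>Z. Z - {b}"])
    show "?h \<in> cycles ?g X \<rightarrow> cycles ?f (insert b X)"
    proof
      fix Y
      assume Y: "Y \<in> cycles ?g X"
      then have YX: "Y \<subseteq> X" "b \<notin> Y" "finite Y"
        using cycles_subset[OF Y] assms(1,4) by (auto dest: finite_subset)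
      have sumY: "(\<Sum>y\<in>Y. ?f y i) = 0" if "i \<noteq> b" for i
      proof -
        have "(\<Sum>y\<in>Y. ?g y i) = 0"
          using Y by (simp add: cycles_def)
        then show ?thesis
          using that by (simp add: g)
      qed
      have "(\<Sum>y\<in>?h Y. ?f y i) = 0" for i
      proof (cases "i = b")
        case True
        then show ?thesis
          using YX by (simp add: unit)
      next
        case False
        then show ?thesis
          using YX by (simp add: unit sumY[OF False])
      qed
      moreover have "?h Y \<subseteq> insert b X"
        using YX(1) by auto
      ultimately show "?h Y \<in> cycles ?f (insert b X)"
        unfolding cycles_def by simp
    qed
    show "(\<lambda>Z. Z - {b}) \<in> cycles ?f (insert b X) \<rightarrow> cycles ?g X"
    proof
      fix Z
      assume Z: "Z \<in> cycles ?f (insert b X)"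
      then have ZX: "Z \<subseteq> insert b X" "finite Z"
        using cycles_subset[OF Z] assms(1) by (auto dest: finite_subset)
      have "(\<Sum>y\<in>Z - {b}. ?g y i) = 0" for i
      proof (cases "i = b")
        case True
        then show ?thesis
          by (simp add: g)
      next
        case False
        have "(\<Sum>y\<in>Z - {b}. ?f y i) = (\<Sum>y\<in>Z. ?f y i)"
          by (rule sum.mono_neutral_left) (use ZX(2) False in \<open>auto simp: unit\<close>)
        then show ?thesis
          using Z False by (simp add: g cycles_def)
      qed
      moreover have "Z - {b} \<subseteq> X"
        using ZX(1) by blast
      ultimately show "Z - {b} \<in> cycles ?g X"
        unfolding cycles_def by simp
    qed
    show "?h Y - {b} = Y" if "Y \<in> cycles ?g X" for Y
      using cycles_subset[OF that] assms(4) by auto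
    show "?h (Z - {b}) = Z" if Z: "Z \<in> cycles ?f (insert b X)" for Z
    proof -
      have ZX: "finite Z"
        using cycles_subset[OF Z] assms(1) by (auto dest: finite_subset)
      have sumZ: "(\<Sum>y\<in>Z. ?f y b) = 0"
        using Z by (simp add: cycles_def)
      show ?thesis
      proof (cases "b \<in> Z")
        case True
        have "(\<Sum>y\<in>Z. ?f y b) = ?f b b + (\<Sum>y\<in>Z - {b}. ?f y b)"
          by (rule sum.remove[OF ZX True])
        then have "(\<Sum>y\<in>Z - {b}. ?f y b) \<noteq> 0"
          unfolding sumZ unit by auto
        then show ?thesis
          using True by (simp add: insert_absorb)
      next
        case False
        then show ?thesis
          using sumZ by simp
      qed
    qed
  qed
  then have "card (cycles ?f (insert b X)) = card (cycles ?g X)"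
    by (rule bij_betw_same_card[symmetric])
  then show ?thesis
    using card_cycles[OF assms(1), of ?g] assms(1,4)
    by (intro bin_rank_unique) simp_all
qed

locale minimal_nonbinary =
  fixes E :: "'e set" and r :: "'e set \<Rightarrow> int"
  assumes matroid: "matroid_rank E r"
    and nonbinary: "\<not> binary (E, r)"
    and delete: "\<And>y. y \<in> E \<Longrightarrow> binary (E - {y}, r)"
    and contract: "\<And>b. b \<in> E \<Longrightarrow> binary (E - {b}, \<lambda>X. r (insert b X) - r {b})"
begin

lemma finite_ground: "finite E"
  using matroid by (simp add: matroid_rank_def)

text \<open>
  Deleting an element outside the basis \<open>B\<close> and contracting one inside it keep the remaining part
  of the fundamental representation. Minimality therefore makes that representation correct on every
  set that avoids some element outside \<open>B\<close> or contains some element of \<open>B\<close>.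
\<close>

lemma agree:
  assumes B: "B \<subseteq> E" "r B = int (card B)" "r E = r B" and X: "X \<subseteq> E" "X \<noteq> E - B"
  shows "int (bin_rank (fundamental r B) X) = r X"
proof -
  have fB: "finite B"
    using B(1) finite_ground by (rule finite_subset)
  consider y where "y \<in> E - B" "y \<notin> X" | b where "b \<in> B" "b \<in> X"
    using X B(1) by blast
  then show ?thesis
  proof cases
    case 1
    have "r B \<le> r (E - {y})" "r (E - {y}) \<le> r E"
      using 1 B(1) by (auto intro!: matroid_rank_mono[OF matroid])
    then show ?thesis
      using 1 B X finite_ground delete[of y]
      by (intro bin_rank_fundamental_binary[of "E - {y}"]) auto
  next
    case 2
    let ?r = "\<lambda>X. r (insert b X) - r {b}"
    have b: "b \<in> E"
      using 2(1) B(1) by blast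
    have rb: "r {b} = 1"
      using independent_subset[OF matroid _ B(1,2), of "{b}"] 2(1) by simp
    have cB: "int (card (B - {b})) = int (card B) - 1"
      using card_Suc_Diff1[OF fB 2(1)] by linarith
    have unit: "fundamental r B b i = (if i = b then 1 else 0)" for i
    proof (cases "i \<in> B")
      case True
      have "r (B - {i}) = int (card (B - {i}))"
        using independent_subset[OF matroid _ B(1,2), of "B - {i}"] by blast
      then have "r (B - {i}) < int (card B)"
        using card_Diff1_less[OF fB True] by simp
      then show ?thesis
        by (rule fundamental_basis[where r = r, OF fB 2(1) True B(2)])
    next
      case False
      then show ?thesis
        using 2(1) by (auto simp: fundamental_def)
    qed
    have "int (bin_rank (fundamental ?r (B - {b})) (X - {b})) = ?r (X - {b})"
    proof (rule bin_rank_fundamental_binary[where E = "E - {b}" and r = ?r and B = "B - {b}"])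
      show "binary (E - {b}, ?r)"
        by (rule contract[OF b])
      show "?r (B - {b}) = int (card (B - {b}))" "?r (E - {b}) = ?r (B - {b})"
        unfolding cB using b 2(1) B(2,3) rb by (simp_all add: insert_absorb)
    qed (use B(1) X(1) finite_ground in auto)
    moreover have "bin_rank (fundamental r B) (insert b (X - {b})) =
        Suc (bin_rank (fundamental ?r (B - {b})) (X - {b}))"
      using bin_rank_insert_basis[of "X - {b}" B b r] X(1) finite_ground fB 2(1) rb unit
      by (auto dest: finite_subset)
    moreover have "insert b (X - {b}) = X"
      using 2(2) by blast
    ultimately show ?thesis
      using rb by simp
  qed
qed

lemma disagree:
  assumes B: "B \<subseteq> E" "r B = int (card B)" "r E = r B"
  shows "int (bin_rank (fundamental r B) (E - B)) \<noteq> r (E - B)"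
proof
  assume *: "int (bin_rank (fundamental r B) (E - B)) = r (E - B)"
  have "binary (E, r)"
  proof (rule binaryI[of E B "fundamental r B"])
    show "finite E"
      by (rule finite_ground)
    show "countable B"
      using finite_subset[OF B(1) finite_ground] by (rule countable_finite)
    show "fundamental r B e i = 0" if "i \<notin> B" for e i
      using that by (simp add: fundamental_def)
    show "r X = int (bin_rank (fundamental r B) X)" if "X \<subseteq> E" for X
      using agree[OF B that] * by metis
  qed
  then show False
    using nonbinary by simp
qed

end

text \<open>
  Both matroids agree on \<open>C\<close> with one element removed or added. As the rank moves by at most one
  in a step, every removal lowers the larger rank of \<open>C\<close>, and no addition raises it. So \<open>C\<close> is a
  basis of one matroid and a hyperplane of the other.
\<close>

lemma differ_on_one_set:
  assumes m: "matroid_rank E r1" "matroid_rank E r2"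
    and C: "C \<subseteq> E" "C \<noteq> E" "r1 C < r2 C"
    and eq: "\<And>X. X \<subseteq> E \<Longrightarrow> X \<noteq> C \<Longrightarrow> r1 X = r2 X"
  shows "r2 C = int (card C)" "r2 E = r2 C" "r1 C = r2 C - 1"
proof -
  have drop: "r2 (C - {y}) < r2 C" if "y \<in> C" for y
  proof -
    have "r2 (C - {y}) = r1 (C - {y})"
      using that C(1) by (intro eq[symmetric]) auto
    also have "\<dots> \<le> r1 C"
      using C(1) by (intro matroid_rank_mono[OF m(1)]) auto
    finally show ?thesis
      using C(3) by simp
  qed
  obtain I where I: "I \<subseteq> C" "r2 I = int (card I)" "r2 I = r2 C"
    using exists_basis[OF m(2) C(1)] by blast
  have "I = C"
  proof (rule ccontr)
    assume "I \<noteq> C"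
    then obtain y where y: "y \<in> C" "y \<notin> I"
      using I(1) by blast
    have "r2 I \<le> r2 (C - {y})"
      using I(1) y C(1) by (intro matroid_rank_mono[OF m(2)]) auto
    then show False
      using drop[OF y(1)] I(3) by simp
  qed
  then show card: "r2 C = int (card C)"
    using I(2) by simp
  have up: "r2 (insert x C) \<le> r1 C + 1 \<and> r2 C \<le> r2 (insert x C)" if "x \<in> E - C" for x
  proof -
    have "r2 (insert x C) = r1 (insert x C)"
      using that C(1) by (intro eq[symmetric]) auto
    also have "\<dots> \<le> r1 C + 1"
      using that C(1) by (intro matroid_rank_insert_le[OF m(1)]) auto
    finally show ?thesis
      using that C(1) matroid_rank_mono[OF m(2), of C "insert x C"] by auto
  qed
  have "r2 (insert x C) = r2 C" if "x \<in> E" for x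
    using up[of x] C(3) that by (cases "x \<in> C") (auto simp: insert_absorb)
  then have "r2 (C \<union> E) = r2 C"
    using C(1) by (intro matroid_rank_span[OF m(2)]) auto
  then show "r2 E = r2 C"
    using C(1) by (simp add: Un_absorb1)
  obtain x where "x \<in> E - C"
    using C(1,2) by blast
  then show "r1 C = r2 C - 1"
    using up[of x] C(3) by auto
qed

lemma insert_parallel:
  assumes m: "matroid_rank E r" and "D \<subseteq> E" "c \<in> E" "c' \<in> E" and "r {c} = 1" "r {c, c'} = 1"
  shows "r (insert c' D) \<le> r (insert c D)"
proof -
  have "r (insert c' D) \<le> r (insert c' (insert c D))"
    by (rule matroid_rank_mono[OF m]) (use assms in auto)
  moreover have "r (insert c' (insert c D)) - r (insert c D) \<le> r (insert c' {c}) - r {c}"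
    by (rule matroid_rank_insert_decreasing[OF m]) (use assms in auto)
  moreover have "insert c' {c} = {c, c'}"
    by blast
  ultimately show ?thesis
    using assms(5,6) by simp
qed

lemma card_2_pairs:
  assumes "card A \<ge> 2"
  shows "\<exists>x y. x \<in> A \<and> y \<in> A \<and> x \<noteq> y"
proof -
  obtain T where "T \<subseteq> A" "card T = 2"
    using obtain_subset_with_card_n[OF assms] by blast
  then show ?thesis
    by (auto simp: card_2_iff)
qed

lemma exists_not_in:
  assumes "finite D" "card D < card A"
  shows "\<exists>x \<in> A. x \<notin> D"
  using card_mono[OF assms(1), of A] assms(2) by (meson not_le subsetI)

context minimal_nonbinary
begin

text \<open>
  Tutte's excluded-minor theorem. The matroid and its fundamental representation over a basis \<open>B\<close>
  differ exactly on \<open>E - B\<close>, which then has the size of \<open>B\<close>. If \<open>B\<close> had at least three elements, one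
  exchange would give another basis with the same representation, which must be correct on
  \<open>E - B\<close>. So the rank is two, and the two columns outside \<open>B\<close> are equal with full support.
\<close>

theorem four_point_line: "card E = 4 \<and> (\<forall>A \<subseteq> E. r A = int (min (card A) 2))"
proof -
  obtain B where B: "B \<subseteq> E" "r B = int (card B)" "r B = r E"
    using exists_basis[OF matroid, of E] by auto
  define C where "C = E - B"
  define \<phi> where "\<phi> = fundamental r B"
  define N where "N = (\<lambda>X. int (bin_rank \<phi> X))"
  have C: "C \<subseteq> E" "B \<inter> C = {}" "B \<union> C = E"
    using B(1) by (auto simp: C_def)
  have fin: "finite B" "finite C"
    using B(1) C(1) finite_ground by (auto dest: finite_subset)
  have mN: "matroid_rank E N"
    unfolding N_def by (rule matroid_rank_bin_rank[OF finite_ground])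
  have same: "N X = r X" if "X \<subseteq> E" "X \<noteq> C" for X
    using agree[OF B(1,2) B(3)[symmetric]] that unfolding N_def \<phi>_def C_def by simp
  have differ: "N C \<noteq> r C"
    using disagree[OF B(1,2) B(3)[symmetric]] unfolding N_def \<phi>_def C_def .
  have "B \<noteq> {}"
  proof
    assume B0: "B = {}"
    have "N C = 0"
      unfolding N_def \<phi>_def using B0 fin(2) by (simp add: bin_rank_zero fundamental_def)
    moreover have "r C = 0"
      using B0 B(2,3) by (simp add: C_def)
    ultimately show False
      using differ by simp
  qed
  then have CE: "C \<noteq> E"
    using C by blast
  obtain r1 r2 where r12: "r1 = r \<and> r2 = N \<or> r1 = N \<and> r2 = r" and lt: "r1 C < r2 C"
    using differ by (metis linorder_neqE)
  have m12: "matroid_rank E r1" "matroid_rank E r2"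
    using r12 matroid mN by auto
  have eq12: "r1 X = r2 X" if "X \<subseteq> E" "X \<noteq> C" for X
    using r12 same[OF that] by auto
  note C12 = differ_on_one_set[OF m12 C(1) CE lt eq12]
  have "r2 E = r E"
    using r12 same[of E] CE by auto
  then have cardC: "card C = card B"
    using C12(1,2) B(2,3) by simp
  have r2_single: "r2 {c} = 1" if "c \<in> C" for c
    using independent_subset[OF m12(2) _ C(1) C12(1), of "{c}"] that by simp
  have "card B \<noteq> 1"
  proof
    assume "card B = 1"
    then obtain b c where bc: "B = {b}" "C = {c}"
      using cardC by (metis card_1_singletonE)
    have \<phi>: "\<phi> c i = (if i = b \<and> r {c} = 1 then 1 else 0)" for i
      unfolding \<phi>_def fundamental_def bc(1) by auto
    have "N {c} = (if r {c} = 1 then 1 else 0)"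
      unfolding N_def bin_rank_singleton \<phi> by auto
    then show False
      using r12 C12(3) r2_single[of c] bc(2) by (auto split: if_splits)
  qed
  moreover have "card B \<noteq> 0"
    using \<open>B \<noteq> {}\<close> fin(1) by simp
  ultimately have cB2: "card B \<ge> 2"
    by linarith
  have single: "r {c} = 1" "N {c} = 1" if "c \<in> C" for c
  proof -
    have "{c} \<noteq> C"
      using cB2 cardC by auto
    then have "N {c} = r {c}"
      using that C(1) by (intro same) auto
    then show "r {c} = 1" "N {c} = 1"
      using r2_single[OF that] r12 by auto
  qed
  have "card B < 3"
  proof (rule ccontr)
    assume "\<not> card B < 3"
    then have cB3: "card B \<ge> 3"
      by simp
    obtain c where c: "c \<in> C"
      using cB3 cardC fin(2) by fastforce
    obtain b where b: "b \<in> B" "r (insert c (B - {b})) = int (card B)"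
    proof -
      have "\<exists>i. \<phi> c i \<noteq> 0"
        using single(2)[OF c] unfolding N_def bin_rank_singleton by (auto split: if_splits)
      then show ?thesis
        using that unfolding \<phi>_def fundamental_def by (auto split: if_splits)
    qed
    define B' where "B' = insert c (B - {b})"
    have cE: "c \<in> E" "c \<notin> B"
      using c C by auto
    have B': "B' \<subseteq> E" "r B' = int (card B')" "r E = r B'"
    proof -
      have "card B' = card B"
        using cE(2) b(1) fin(1) card_Suc_Diff1[OF fin(1) b(1)] by (simp add: B'_def)
      then show "r B' = int (card B')" "r E = r B'"
        using b(2) B(2,3) by (simp_all add: B'_def)
      show "B' \<subseteq> E"
        using cE(1) B(1) by (auto simp: B'_def)
    qed
    have avoid: "insert x (B' - {b'}) \<noteq> C" for x b'
    proof -
      have "card {b, b'} < card B"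
        using cB3 card_insert_le_m1[of 2 "{b'}" b] by simp
      then obtain b'' where "b'' \<in> B" "b'' \<notin> {b, b'}"
        using exists_not_in[of "{b, b'}" B] by blast
      then have "b'' \<in> insert x (B' - {b'})" "b'' \<notin> C"
        using C(2) by (auto simp: B'_def)
      then show ?thesis
        by blast
    qed
    have B'C: "B' \<noteq> C"
      using avoid[of c b] by (auto simp: B'_def)
    have "int (bin_rank (fundamental r B') C) = r C"
      using agree[OF B' C(1)] c by (auto simp: B'_def)
    moreover have "int (bin_rank (fundamental N B') C) = N C"
      using bin_rank_fundamental[OF finite_ground, of N \<phi> B' C] same[of B'] same[of E] B' B'C CE C(1)
      by (simp add: N_def)
    moreover have "cycles (fundamental r B') C = cycles (fundamental N B') C"
    proof (rule cycles_cong)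
      fix x i
      assume "x \<in> C"
      then have "N (insert x (B' - {i})) = r (insert x (B' - {i}))"
        using B'(1) C(1) avoid by (intro same) auto
      then show "fundamental r B' x i = fundamental N B' x i"
        by (simp add: fundamental_def)
    qed
    ultimately show False
      using differ bin_rank_cong by metis
  qed
  then have cB: "card B = 2"
    using cB2 by simp
  then have "card C = 2"
    using cardC by simp
  then obtain c c' where cc: "C = {c, c'}" "c \<noteq> c'"
    unfolding card_2_iff by blast
  obtain b b' where bb: "B = {b, b'}" "b \<noteq> b'"
    using cB unfolding card_2_iff by blast
  have cE: "c \<in> E" "c' \<in> E" "c \<in> C" "c' \<in> C" "b \<in> E" "b' \<in> E"
    using C bb cc by auto
  have rN: "r1 = N \<and> r2 = r"
  proof (rule ccontr)
    assume "\<not> ?thesis"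
    then have rr: "r1 = r" "r2 = N"
      using r12 by auto
    have rC: "r {c, c'} = 1" "N C = int (card C)"
      using C12 rr cc cB cardC by auto
    have par: "r (insert c D) = r (insert c' D)" if "D \<subseteq> E" for D
      using insert_parallel[OF matroid that cE(1,2)] insert_parallel[OF matroid that cE(2,1)]
        single(1) cE(3,4) rC(1) by (simp add: insert_commute)
    have "\<phi> c i = \<phi> c' i" for i
      unfolding \<phi>_def fundamental_def using par[of "B - {i}", OF subset_trans[OF Diff_subset B(1)]] by simp
    then have "C \<in> cycles \<phi> C"
      using cc by (simp add: cycles_def bit_add_eq_0_iff)
    moreover have "cycles \<phi> C = {{}}"
      using rC(2) bin_rank_eq_card_iff[OF fin(2), of \<phi>] unfolding N_def by simp
    ultimately show False
      using cc by simp
  qed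
  have rC: "r C = 2" "N C = 1"
    using C12 rN cB cardC by auto
  have eqcol: "\<phi> c i = \<phi> c' i" for i
  proof -
    have "cycles \<phi> C \<noteq> {{}}"
      using rC(2) bin_rank_eq_card_iff[OF fin(2), of \<phi>] cardC cB unfolding N_def by simp
    then obtain Y where Y: "Y \<in> cycles \<phi> C" "Y \<noteq> {}"
      using empty_in_cycles[of \<phi> C] by blast
    have ne: "\<exists>i. \<phi> x i \<noteq> 0" if "x \<in> C" for x
      using single(2)[OF that] unfolding N_def bin_rank_singleton by (auto split: if_splits)
    have Y0: "(\<Sum>y\<in>Y. \<phi> y j) = 0" for j
      using Y(1) by (simp add: cycles_def)
    have "Y \<noteq> {c}" "Y \<noteq> {c'}"
      using Y0 ne[OF cE(3)] ne[OF cE(4)] by auto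
    then have "Y = {c, c'}"
      using cycles_subset[OF Y(1)] Y(2) cc(1) by auto
    then show ?thesis
      using Y0[of i] cc(2) by (cases "\<phi> c i"; cases "\<phi> c' i") simp_all
  qed
  have single_B: "r {x} = 1" if "x \<in> B" for x
    using independent_subset[OF matroid _ B(1,2), of "{x}"] that by simp
  have mixed: "r {x, y} = 2" if x: "x \<in> B" and y: "y \<in> C" for x y
  proof (rule ccontr)
    assume ne: "r {x, y} \<noteq> 2"
    obtain x' where x': "B = {x, x'}" "x \<noteq> x'"
      using bb x by blast
    obtain y' where y': "C = {y, y'}"
      using cc y by blast
    have xy: "x \<in> E" "y \<in> E" "y' \<in> E"
      using x y y' C by auto
    have B_x': "insert z (B - {x'}) = {x, z}" for z
      using x' by blast
    have "\<phi> y' x' = \<phi> y x'"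
      using eqcol[of x'] cc y y' by (metis (full_types) doubleton_eq_iff)
    then have "r {x, y} = 2 \<longleftrightarrow> r {x, y'} = 2"
      unfolding \<phi>_def fundamental_def B_x' cB using x' by (auto split: if_splits)
    moreover have "r {x, z} \<le> 2" if "z \<in> E" for z
      using matroid_rank_insert_le[OF matroid, of "{x}" z] single_B[OF x] xy(1) that
      by (simp add: insert_commute)
    ultimately have le: "r {x, y} \<le> 1" "r {x, y'} \<le> 1"
      using ne xy by (metis le_less zle_add1_eq_le one_add_one)+
    have "r (insert y' {x, y}) - r {x, y} \<le> r (insert y' {x}) - r {x}"
      by (rule matroid_rank_insert_decreasing[OF matroid]) (use xy in auto)
    then have "r (insert y' {x, y}) \<le> 1"
      using le single_B[OF x] by (simp add: insert_commute)
    moreover have "r C \<le> r (insert y' {x, y})"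
      by (rule matroid_rank_mono[OF matroid]) (use xy y' in auto)
    ultimately show False
      using rC(1) by simp
  qed
  have pair: "r {x, y} = 2" if "x \<in> E" "y \<in> E" "x \<noteq> y" for x y
  proof -
    consider "x \<in> B" "y \<in> B" | "x \<in> C" "y \<in> C" | "x \<in> B" "y \<in> C" | "y \<in> B" "x \<in> C"
      using \<open>x \<in> E\<close> \<open>y \<in> E\<close> C(3) by blast
    then show ?thesis
    proof cases
      case 1
      then have "{x, y} = B"
        using bb \<open>x \<noteq> y\<close> by auto
      then show ?thesis
        using B(2) cB by simp
    next
      case 2
      then have "{x, y} = C"
        using cc \<open>x \<noteq> y\<close> by auto
      then show ?thesis
        using rC(1) by simp
    next
      case 3
      then show ?thesis
        by (rule mixed)
    next
      case 4
      then show ?thesis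
        using mixed[of y x] by (simp add: insert_commute)
    qed
  qed
  have "r A = int (min (card A) 2)" if A: "A \<subseteq> E" for A
  proof -
    have fA: "finite A"
      using A finite_ground by (rule finite_subset)
    consider "card A = 0" | "card A = 1" | "card A \<ge> 2"
      by linarith
    then show ?thesis
    proof cases
      case 1
      then show ?thesis
        using fA matroid by (simp add: matroid_rank_def)
    next
      case 2
      then obtain x where x: "A = {x}"
        by (rule card_1_singletonE)
      then have "x \<in> B \<or> x \<in> C"
        using A C(3) by blast
      then show ?thesis
        using x single_B single(1) by auto
    next
      case 3
      then obtain x y where xy: "x \<in> A" "y \<in> A" "x \<noteq> y"
        using card_2_pairs by blast
      have "r {x, y} \<le> r A"
        by (rule matroid_rank_mono[OF matroid]) (use xy A in auto)
      moreover have "r A \<le> r E"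
        by (rule matroid_rank_mono[OF matroid]) (use A in auto)
      moreover have "x \<in> E" "y \<in> E"
        using xy A by auto
      ultimately have "r A = 2"
        using pair[of x y] xy(3) B(2,3) cB by simp
      then show ?thesis
        using 3 by simp
    qed
  qed
  moreover have "card E = 4"
    using card_Un_disjoint[OF fin C(2)] C(3) cB cardC by simp
  ultimately show ?thesis
    by blast
qed

end


section \<open>When the natural matroid is binary\<close>

text \<open>
  These are the elements whose copies form a series class or coloops when the natural matroid is
  binary. Shrinking such a class of \<open>k\<close> elements to one element lowers the rank by \<open>k - 1\<close>.
\<close>

definition big :: "'a set_function \<Rightarrow> 'a set" where
  "big P = {e \<in> fst P. snd P {e} \<ge> 2}"

definition core :: "nat \<Rightarrow> 'a set_function \<Rightarrow> 'a set \<Rightarrow> int" where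
  "core k P A = snd P A - int ((k - 1) * card (A \<inter> big P))"

lemma sum_of_indicator: "finite A \<Longrightarrow> (\<Sum>e\<in>A. if e \<in> B then 1 else 0) = card (A \<inter> B)"
  by (simp add: sum.If_cases)

locale k_poly =
  fixes k :: nat and E :: "'a set" and \<rho> :: "'a set \<Rightarrow> int"
  assumes k3: "k \<ge> 3" and poly: "k_polymatroid k (E, \<rho>)"
begin

lemma finite_ground: "finite E"
  using poly by (simp add: k_polymatroid_def polymatroid_def)

lemma rho_empty: "\<rho> {} = 0"
  using poly by (simp add: k_polymatroid_def polymatroid_def)

lemma rho_mono: "A \<subseteq> B \<Longrightarrow> B \<subseteq> E \<Longrightarrow> \<rho> A \<le> \<rho> B"
  using poly by (simp add: k_polymatroid_def polymatroid_def)

lemma rho_submod: "A \<subseteq> E \<Longrightarrow> B \<subseteq> E \<Longrightarrow> \<rho> (A \<inter> B) + \<rho> (A \<union> B) \<le> \<rho> A + \<rho> B"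
  using poly by (simp add: k_polymatroid_def polymatroid_def)

lemma rho_single: "e \<in> E \<Longrightarrow> \<rho> {e} \<le> int k"
  using poly by (simp add: k_polymatroid_def)

lemma rho_insert: "A \<subseteq> E \<Longrightarrow> e \<in> E \<Longrightarrow> \<rho> (insert e A) \<le> \<rho> A + \<rho> {e}"
proof (cases "e \<in> A")
  case True
  then show "A \<subseteq> E \<Longrightarrow> e \<in> E \<Longrightarrow> ?thesis"
    using rho_mono[of "{}" "{e}"] rho_empty by (simp add: insert_absorb)
next
  case False
  then show "A \<subseteq> E \<Longrightarrow> e \<in> E \<Longrightarrow> ?thesis"
    using rho_submod[of "{e}" A] rho_empty by simp
qed

lemma rho_Un:
  assumes "A \<subseteq> E" and "D \<subseteq> E"
  shows "\<rho> (A \<union> D) \<le> \<rho> A + int (k * card D)"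
proof -
  have "finite D"
    using assms(2) finite_ground by (rule finite_subset)
  then show ?thesis
    using assms(2)
  proof (induction D)
    case (insert e D)
    then show ?case
      using rho_insert[of "A \<union> D" e] rho_single[of e] assms(1) by (simp add: algebra_simps)
  qed simp
qed

abbreviation copies :: "'a set \<Rightarrow> ('a \<times> nat) set" where
  "copies A \<equiv> A \<times> {..<k}"

definition nrank :: "('a \<times> nat) set \<Rightarrow> int" where
  "nrank X = (MIN A \<in> Pow E. \<rho> A + int (card (X - copies A)))"

lemma natural_matroid_eq: "natural_matroid k (E, \<rho>) = (copies E, nrank)"
  by (simp add: natural_matroid_def nrank_def fun_eq_iff)

lemma finite_copies: "X \<subseteq> copies E \<Longrightarrow> finite X"
  using finite_ground by (auto dest: finite_subset)

lemma nrank_le: "A \<subseteq> E \<Longrightarrow> nrank X \<le> \<rho> A + int (card (X - copies A))"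
  unfolding nrank_def using finite_ground by (intro Min_le) auto

lemma nrank_attained: "\<exists>A \<subseteq> E. nrank X = \<rho> A + int (card (X - copies A))"
proof -
  have "nrank X \<in> (\<lambda>A. \<rho> A + int (card (X - copies A))) ` Pow E"
    unfolding nrank_def using finite_ground by (intro Min_in) auto
  then show ?thesis
    by auto
qed

text \<open>
  Leaving an element out of \<open>A'\<close> costs its \<open>k\<close> copies, which is at least its rank. So the minimum is
  attained at \<open>A\<close>.
\<close>

lemma nrank_copies:
  assumes "A \<subseteq> E"
  shows "nrank (copies A) = \<rho> A"
proof (rule antisym)
  show "nrank (copies A) \<le> \<rho> A"
    using nrank_le[OF assms, of "copies A"] by simp
  obtain A' where A': "A' \<subseteq> E" "nrank (copies A) = \<rho> A' + int (card (copies A - copies A'))"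
    using nrank_attained by blast
  have "copies A - copies A' = copies (A - A')"
    by auto
  then have "nrank (copies A) = \<rho> A' + int (k * card (A - A'))"
    using A'(2) by (simp add: card_cartesian_product mult.commute)
  moreover have "\<rho> A \<le> \<rho> (A' \<union> (A - A'))"
    using assms A'(1) by (intro rho_mono) auto
  moreover have "\<rho> (A' \<union> (A - A')) \<le> \<rho> A' + int (k * card (A - A'))"
    using assms A'(1) by (intro rho_Un) auto
  ultimately show "\<rho> A \<le> nrank (copies A)"
    by linarith
qed

lemma nrank_clone:
  assumes "X \<subseteq> copies E" and "(e, i) \<notin> X" and "(e, j) \<notin> X" and "i < k" and "j < k"
  shows "nrank (insert (e, i) X) = nrank (insert (e, j) X)"
proof -
  have "card (insert (e, i) X - copies A) = card (insert (e, j) X - copies A)" for A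
  proof -
    have "finite (X - copies A)"
      using finite_copies[OF assms(1)] by simp
    then show ?thesis
      using assms(2-5) by (simp add: insert_Diff_if)
  qed
  then show ?thesis
    by (simp add: nrank_def)
qed

abbreviation F :: "'a set" where
  "F \<equiv> big (E, \<rho>)"

lemma F_subset: "F \<subseteq> E"
  by (auto simp: big_def)

end

locale binary_natural_rep = k_poly +
  fixes \<psi> :: "'a \<times> nat \<Rightarrow> nat \<Rightarrow> bit"
  assumes rep: "\<And>X. X \<subseteq> copies E \<Longrightarrow> nrank X = int (bin_rank \<psi> X)"
begin

lemma dependent_on_clone:
  assumes "X \<subseteq> copies E" and "e \<in> E" and "(e, i) \<notin> X" and "(e, j) \<notin> X" and "i < k" and "j < k"
    and "dependent_on \<psi> X (e, i)"
  shows "dependent_on \<psi> X (e, j)"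
proof -
  have "insert (e, i) X \<subseteq> copies E" "insert (e, j) X \<subseteq> copies E"
    using assms by auto
  then have "bin_rank \<psi> (insert (e, i) X) = bin_rank \<psi> (insert (e, j) X)"
    using nrank_clone[OF assms(1,3,4,5,6)] rep by simp
  then show ?thesis
    using bin_rank_insert[OF finite_copies[OF assms(1)] assms(3), of \<psi>]
      bin_rank_insert[OF finite_copies[OF assms(1)] assms(4), of \<psi>] assms(7)
    by (auto split: if_splits)
qed

text \<open>
  A shortest way to write one clone in terms of elements other than the two clones uses the same
  elements for both, so the two vectors are equal.
\<close>

lemma clones_parallel:
  assumes "X \<subseteq> copies E" and "e \<in> E" and "(e, i) \<notin> X" and "(e, j) \<notin> X" and "i < k" and "j < k"
    and "dependent_on \<psi> X (e, i)"
  shows "\<psi> (e, i) = \<psi> (e, j)"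
proof -
  let ?P = "\<lambda>Y. Y \<subseteq> X \<and> (\<forall>n. \<psi> (e, i) n = (\<Sum>y\<in>Y. \<psi> y n))"
  obtain Y0 where "?P Y0"
    using assms(7) unfolding dependent_on_def by blast
  then have "\<exists>Y. ?P Y \<and> (\<forall>Z. ?P Z \<longrightarrow> card Y \<le> card Z)"
    by (rule ex_has_least_nat)
  then obtain Y where Y: "Y \<subseteq> X" "\<forall>n. \<psi> (e, i) n = (\<Sum>y\<in>Y. \<psi> y n)"
    and least: "\<And>Z. ?P Z \<Longrightarrow> card Y \<le> card Z"
    by (elim exE conjE) simp
  have sub: "Y \<subseteq> copies E" "(e, i) \<notin> Y" "(e, j) \<notin> Y" "finite Y"
    using Y(1) assms(1,3,4) finite_copies[of Y] by auto
  have "dependent_on \<psi> Y (e, i)"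
    unfolding dependent_on_def by (rule exI[of _ Y]) (simp add: Y(2))
  then have "dependent_on \<psi> Y (e, j)"
    by (rule dependent_on_clone[OF sub(1) assms(2) sub(2,3) assms(5,6)])
  then obtain W where W: "W \<subseteq> Y" "\<forall>n. \<psi> (e, j) n = (\<Sum>y\<in>W. \<psi> y n)"
    unfolding dependent_on_def by (elim exE conjE) simp
  have subW: "W \<subseteq> copies E" "(e, i) \<notin> W" "(e, j) \<notin> W"
    using W(1) sub by auto
  have "dependent_on \<psi> W (e, j)"
    unfolding dependent_on_def by (rule exI[of _ W]) (simp add: W(2))
  then have "dependent_on \<psi> W (e, i)"
    by (rule dependent_on_clone[OF subW(1) assms(2) subW(3,2) assms(6,5)])
  then obtain V where V: "V \<subseteq> W" "\<forall>n. \<psi> (e, i) n = (\<Sum>y\<in>V. \<psi> y n)"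
    unfolding dependent_on_def by (elim exE conjE) simp
  have "V \<subseteq> X"
    using V(1) W(1) Y(1) by simp
  then have "card Y \<le> card V"
    using least[of V] V(2) by simp
  then have "V = Y"
    using card_seteq[OF sub(4), of V] V(1) W(1) by simp
  then have "W = Y"
    using V(1) W(1) by simp
  then show ?thesis
    using W(2) Y(2) by (simp add: fun_eq_iff)
qed

text \<open>
  If a cycle separated two copies of a big element, the two copies would be parallel. But a pair of
  copies has rank two.
\<close>

lemma clones_series:
  assumes "Y \<in> cycles \<psi> (copies E)" and "f \<in> F" and "(f, i) \<in> Y" and "i < k" and "j < k"
  shows "(f, j) \<in> Y"
proof (rule ccontr)
  assume j: "(f, j) \<notin> Y"
  then have ij: "i \<noteq> j"
    using assms(3) by blast
  have f: "f \<in> E" "\<rho> {f} \<ge> 2"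
    using assms(2) by (auto simp: big_def)
  have Y: "Y \<subseteq> copies E" "finite Y" "\<And>n. (\<Sum>y\<in>Y. \<psi> y n) = 0"
    using cycles_subset[OF assms(1)] finite_copies assms(1) by (auto simp: cycles_def)
  have "\<psi> (f, i) n = (\<Sum>y\<in>Y - {(f, i)}. \<psi> y n)" for n
    using sum.remove[OF Y(2) assms(3), of "\<lambda>y. \<psi> y n"] Y(3)[of n] bit_add_eq_0_iff by metis
  then have "dependent_on \<psi> (Y - {(f, i)}) (f, i)"
    unfolding dependent_on_def by (intro exI[of _ "Y - {(f, i)}"]) simp
  then have eq: "\<psi> (f, i) = \<psi> (f, j)"
    using Y(1) f(1) j assms(4,5) by (intro clones_parallel[of "Y - {(f, i)}" f i j]) auto
  let ?X = "{(f, i), (f, j)}"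
  have X: "?X \<subseteq> copies E"
    using f(1) assms(4,5) by auto
  have "dependent_on \<psi> {(f, i)} (f, j)"
    unfolding dependent_on_def by (rule exI[of _ "{(f, i)}"]) (simp add: eq)
  then have "bin_rank \<psi> (insert (f, j) {(f, i)}) = bin_rank \<psi> {(f, i)}"
    using bin_rank_insert[of "{(f, i)}" "(f, j)" \<psi>] ij by simp
  then have "bin_rank \<psi> ?X \<le> 1"
    using bin_rank_singleton[of \<psi> "(f, i)"] by (simp add: insert_commute split: if_splits)
  moreover obtain A where A: "A \<subseteq> E" "nrank ?X = \<rho> A + int (card (?X - copies A))"
    using nrank_attained by blast
  moreover have "nrank ?X = int (bin_rank \<psi> ?X)"
    by (rule rep[OF X])
  moreover have "\<rho> A + int (card (?X - copies A)) \<ge> 2"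
  proof (cases "f \<in> A")
    case True
    then have "\<rho> {f} \<le> \<rho> A"
      using A(1) by (intro rho_mono) auto
    then show ?thesis
      using f(2) by simp
  next
    case False
    then have "?X - copies A = ?X"
      by auto
    moreover have "\<rho> {} \<le> \<rho> A"
      using A(1) by (intro rho_mono) auto
    ultimately show ?thesis
      using ij rho_empty by simp
  qed
  ultimately show False
    by linarith
qed

lemma small_copies_equal:
  assumes "e \<in> E - F" and "i < k" and "j < k"
  shows "\<psi> (e, i) = \<psi> (e, j)"
proof (cases "i = j")
  case ij: False
  have e: "e \<in> E" "\<rho> {e} \<le> 1"
    using assms(1) by (auto simp: big_def)
  let ?X = "{(e, j), (e, i)}"
  have X: "?X \<subseteq> copies E"
    using e(1) assms(2,3) by auto
  have "nrank ?X \<le> \<rho> {e} + int (card (?X - copies {e}))"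
    using e(1) by (intro nrank_le) auto
  moreover have "?X - copies {e} = {}"
    using assms(2,3) by auto
  ultimately have le1: "bin_rank \<psi> ?X \<le> 1"
    using rep[OF X] e(2) by simp
  show ?thesis
  proof (cases "dependent_on \<psi> {} (e, i)")
    case True
    then show ?thesis
      using e(1) assms(2,3) by (intro clones_parallel[of "{}"]) auto
  next
    case False
    then have "\<not> dependent_on \<psi> {} (e, j)"
      using dependent_on_clone[of "{}" e j i] e(1) assms(2,3) by auto
    then have "bin_rank \<psi> {(e, i)} = 1"
      using bin_rank_insert[of "{}" "(e, i)" \<psi>] False by simp
    then have "dependent_on \<psi> {(e, i)} (e, j)"
      using le1 bin_rank_insert[of "{(e, i)}" "(e, j)" \<psi>] ij by (simp split: if_splits)
    then obtain Y where Y: "Y \<subseteq> {(e, i)}" "\<forall>n. \<psi> (e, j) n = (\<Sum>y\<in>Y. \<psi> y n)"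
      unfolding dependent_on_def by (elim exE conjE) simp
    have "Y \<noteq> {}"
    proof
      assume "Y = {}"
      then have "dependent_on \<psi> {} (e, j)"
        unfolding dependent_on_def using Y(2) by (intro exI[of _ "{}"]) simp
      then show False
        using \<open>\<not> dependent_on \<psi> {} (e, j)\<close> by simp
    qed
    then have "Y = {(e, i)}"
      using Y(1) by (simp add: subset_singleton_iff)
    then show ?thesis
      using Y(2) by (simp add: fun_eq_iff)
  qed
qed simp

text \<open>
  A series class contributes the sum of its vectors, a parallel class one of its vectors. A cycle
  contains a series class completely or avoids it, so \<open>expand\<close> maps the cycles of the compressed
  representation onto those of the original one.
\<close>

definition compressed :: "'a \<Rightarrow> nat \<Rightarrow> bit" where
  "compressed e n = (if e \<in> F then \<Sum>i<k. \<psi> (e, i) n else \<psi> (e, 0) n)"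

definition expand :: "'a set \<Rightarrow> ('a \<times> nat) set" where
  "expand A = Sigma A (\<lambda>e. if e \<in> F then {..<k} else {0})"

lemma sum_expand:
  assumes "Y \<subseteq> E"
  shows "(\<Sum>y\<in>expand Y. \<psi> y n) = (\<Sum>e\<in>Y. compressed e n)"
proof -
  have "finite Y"
    using assms finite_ground by (rule finite_subset)
  then have "(\<Sum>e\<in>Y. \<Sum>i\<in>(if e \<in> F then {..<k} else {0}). \<psi> (e, i) n) = (\<Sum>y\<in>expand Y. \<psi> y n)"
    unfolding expand_def by (subst sum.Sigma) auto
  moreover have "(\<Sum>i\<in>(if e \<in> F then {..<k} else {0}). \<psi> (e, i) n) = compressed e n" for e
    by (simp add: compressed_def)
  ultimately show ?thesis
    by simp
qed

lemma expand_subset: "A \<subseteq> E \<Longrightarrow> expand A \<subseteq> copies E"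
  using k3 by (auto simp: expand_def split: if_splits)

lemma bij_betw_cycles_expand:
  assumes "A \<subseteq> E"
  shows "bij_betw expand (cycles compressed A) (cycles \<psi> (expand A))"
proof (rule bij_betwI[of _ _ _ "\<lambda>Z. fst ` Z"])
  have k0: "0 < k"
    using k3 by simp
  have fst_expand: "fst ` expand Y = Y" for Y
    using k0 by (force simp: expand_def)
  show "expand \<in> cycles compressed A \<rightarrow> cycles \<psi> (expand A)"
  proof
    fix Y
    assume Y: "Y \<in> cycles compressed A"
    have "Y \<subseteq> E"
      using cycles_subset[OF Y] assms by simp
    then have "(\<Sum>y\<in>expand Y. \<psi> y n) = 0" for n
      using Y sum_expand[of Y n] by (simp add: cycles_def)
    moreover have "expand Y \<subseteq> expand A"
      using cycles_subset[OF Y] by (auto simp: expand_def)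
    ultimately show "expand Y \<in> cycles \<psi> (expand A)"
      by (simp add: cycles_def)
  qed
  have expand_fst: "expand (fst ` Z) = Z" if Z: "Z \<in> cycles \<psi> (expand A)" for Z
  proof -
    have sub: "Z \<subseteq> expand A"
      by (rule cycles_subset[OF Z])
    have "Z \<in> cycles \<psi> (copies E)"
      using Z cycles_mono[OF expand_subset[OF assms], of \<psi>] by blast
    note series = clones_series[OF this]
    show ?thesis
    proof
      show "Z \<subseteq> expand (fst ` Z)"
        using sub by (force simp: expand_def)
      show "expand (fst ` Z) \<subseteq> Z"
      proof
        fix p
        assume "p \<in> expand (fst ` Z)"
        then obtain e i i' where p: "p = (e, i)" "(e, i') \<in> Z" "i \<in> (if e \<in> F then {..<k} else {0})"
          by (auto simp: expand_def)
        have "(e, i') \<in> expand A"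
          using p(2) sub by blast
        then have i': "i' \<in> (if e \<in> F then {..<k} else {0})"
          by (simp add: expand_def)
        show "p \<in> Z"
          using p i' series[of e i' i] by (cases "e \<in> F") auto
      qed
    qed
  qed
  show "(\<lambda>Z. fst ` Z) \<in> cycles \<psi> (expand A) \<rightarrow> cycles compressed A"
  proof
    fix Z
    assume Z: "Z \<in> cycles \<psi> (expand A)"
    have sub: "fst ` Z \<subseteq> A"
      using cycles_subset[OF Z] by (auto simp: expand_def)
    then have "(\<Sum>e\<in>fst ` Z. compressed e n) = 0" for n
      using sum_expand[of "fst ` Z" n] assms expand_fst[OF Z] Z by (simp add: cycles_def)
    then show "fst ` Z \<in> cycles compressed A"
      using sub by (simp add: cycles_def)
  qed
  show "fst ` expand Y = Y" for Y
    by (rule fst_expand)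
  show "expand (fst ` Z) = Z" if "Z \<in> cycles \<psi> (expand A)" for Z
    by (rule expand_fst[OF that])
qed

text \<open>
  The expansion of \<open>A\<close> spans the same space as all copies, so its rank is \<open>\<rho> A\<close>. It has as many cycles
  as \<open>A\<close> in the compressed representation but \<open>k - 1\<close> additional elements for each big element, and
  counting cycles turns these into additional rank.
\<close>

lemma core_eq_bin_rank_compressed:
  assumes A: "A \<subseteq> E"
  shows "core k (E, \<rho>) A = int (bin_rank compressed A)"
proof -
  have fA: "finite A"
    using A finite_ground by (rule finite_subset)
  have "\<psi> ` expand A = \<psi> ` copies A"
  proof
    show "\<psi> ` expand A \<subseteq> \<psi> ` copies A"
      using k3 by (auto simp: expand_def split: if_splits)
    show "\<psi> ` copies A \<subseteq> \<psi> ` expand A"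
    proof
      fix v
      assume "v \<in> \<psi> ` copies A"
      then obtain e i where ei: "e \<in> A" "i < k" "v = \<psi> (e, i)"
        by auto
      show "v \<in> \<psi> ` expand A"
      proof (cases "e \<in> F")
        case True
        then show ?thesis
          using ei by (auto simp: expand_def)
      next
        case False
        then have "v = \<psi> (e, 0)"
          using small_copies_equal[of e i 0] ei A k3 by auto
        then show ?thesis
          using False ei(1) by (auto simp: expand_def)
      qed
    qed
  qed
  then have "bin_rank \<psi> (expand A) = bin_rank \<psi> (copies A)"
    using dim_image_eq_bin_rank[of "expand A" \<psi>] dim_image_eq_bin_rank[of "copies A" \<psi>]
      finite_copies[OF expand_subset[OF A]] fA by simp
  also have "int \<dots> = \<rho> A"
    using rep[OF Sigma_mono[OF A subset_refl]] nrank_copies[OF A] by simp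
  finally have rank: "int (bin_rank \<psi> (expand A)) = \<rho> A" .
  have "card (expand A) = (\<Sum>e\<in>A. card (if e \<in> F then {..<k} else {0}))"
    unfolding expand_def using fA by (intro card_SigmaI) auto
  also have "\<dots> = (\<Sum>e\<in>A. 1 + (k - 1) * (if e \<in> F then 1 else 0))"
    using k3 by (intro sum.cong) auto
  also have "\<dots> = card A + (k - 1) * card (A \<inter> F)"
    unfolding sum.distrib sum_distrib_left[symmetric] sum_of_indicator[OF fA] by simp
  finally have card: "card (expand A) = card A + (k - 1) * card (A \<inter> F)" .
  have "card (cycles compressed A) = card (cycles \<psi> (expand A))"
    by (rule bij_betw_same_card[OF bij_betw_cycles_expand[OF A]])
  then have "card (cycles compressed A) * 2 ^ bin_rank \<psi> (expand A) =
      card (cycles compressed A) * 2 ^ (bin_rank compressed A + (k - 1) * card (A \<inter> F))"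
    using card_cycles[OF finite_copies[OF expand_subset[OF A]], of \<psi>]
      card_cycles[OF fA, of compressed] card by (simp add: power_add flip: mult.assoc)
  moreover have "card (cycles compressed A) \<noteq> 0"
    using finite_cycles[OF fA, of compressed] empty_in_cycles[of compressed A] by (metis card_eq_0_iff empty_iff)
  ultimately have "bin_rank \<psi> (expand A) = bin_rank compressed A + (k - 1) * card (A \<inter> F)"
    by simp
  then show ?thesis
    using rank by (simp add: core_def)
qed

end

locale core_rep = k_poly +
  fixes \<phi> :: "'a \<Rightarrow> nat \<Rightarrow> bit"
  assumes core: "\<And>A. A \<subseteq> E \<Longrightarrow> core k (E, \<rho>) A = int (bin_rank \<phi> A)"
begin

text \<open>
  This is a parallel extension at each small element and a series extension at each big one. The
  copies \<open>1, \<dots>, k - 1\<close> of a big element are new unit vectors, and copy \<open>0\<close> is the sum of these and of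
  the old vector. The sum of all copies is then the old vector again.
\<close>

definition spread :: "'a \<times> nat \<Rightarrow> nat + 'a \<times> nat \<Rightarrow> bit" where
  "spread p j = (case j of
      Inl n \<Rightarrow> if fst p \<notin> F \<or> snd p = 0 then \<phi> (fst p) n else 0
    | Inr (f, m) \<Rightarrow>
        if f \<in> F \<and> fst p = f \<and> 0 < m \<and> m < k \<and> (snd p = 0 \<or> snd p = m) then 1 else 0)"

text \<open>
  The marked copies are those on which the old vectors have a component. The other copies matter only
  through the requirement that a cycle contains all copies of a big element or none.
\<close>

definition marked :: "('a \<times> nat) set \<Rightarrow> ('a \<times> nat) set" where
  "marked Y = {p \<in> Y. fst p \<notin> F \<or> snd p = 0}"

lemma sum_spread_Inl:
  assumes "finite Y" and "inj_on fst (marked Y)"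
  shows "(\<Sum>y\<in>Y. spread y (Inl n)) = (\<Sum>e\<in>fst ` marked Y. \<phi> e n)"
proof -
  have "(\<Sum>y\<in>Y. spread y (Inl n)) = (\<Sum>y\<in>marked Y. \<phi> (fst y) n)"
    using assms(1) by (intro sum.mono_neutral_cong_right) (auto simp: spread_def marked_def)
  then show ?thesis
    using assms(2) by (simp add: sum.reindex)
qed

lemma sum_spread_Inr:
  assumes "finite Y"
  shows "(\<Sum>y\<in>Y. spread y (Inr (f, m))) = 0 \<longleftrightarrow>
    (f \<in> F \<and> 0 < m \<and> m < k \<longrightarrow> ((f, m) \<in> Y \<longleftrightarrow> (f, 0) \<in> Y))"
proof (cases "f \<in> F \<and> 0 < m \<and> m < k")
  case True
  then have s: "spread y (Inr (f, m)) = (if y \<in> {(f, 0), (f, m)} then 1 else 0)" for y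
    by (cases y) (auto simp: spread_def)
  have "(\<Sum>y\<in>Y. spread y (Inr (f, m))) = (\<Sum>y\<in>Y \<inter> {(f, 0), (f, m)}. 1)"
    unfolding s using assms by (intro sum.mono_neutral_cong_right) auto
  moreover have "(f, 0) \<noteq> (f, m)"
    using True by simp
  ultimately show ?thesis
    using True by (cases "(f, 0) \<in> Y"; cases "(f, m) \<in> Y") (simp_all add: Int_insert_right)
next
  case False
  then have "spread y (Inr (f, m)) = 0" for y
    by (auto simp: spread_def)
  then show ?thesis
    using False by auto
qed

lemma cycles_spread_iff:
  assumes "finite X"
  shows "Y \<in> cycles spread X \<longleftrightarrow> Y \<subseteq> X \<and> (\<forall>n. (\<Sum>y\<in>Y. spread y (Inl n)) = 0) \<and>
    (\<forall>f\<in>F. \<forall>m\<in>{1..<k}. (f, m) \<in> Y \<longleftrightarrow> (f, 0) \<in> Y)"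
proof (cases "Y \<subseteq> X")
  case True
  then have fY: "finite Y"
    using assms by (rule finite_subset)
  have "(\<forall>j. (\<Sum>y\<in>Y. spread y j) = 0) \<longleftrightarrow> (\<forall>n. (\<Sum>y\<in>Y. spread y (Inl n)) = 0) \<and>
    (\<forall>f m. (\<Sum>y\<in>Y. spread y (Inr (f, m))) = 0)"
    by (metis (no_types) old.sum.exhaust surj_pair)
  also have "(\<forall>f m. (\<Sum>y\<in>Y. spread y (Inr (f, m))) = 0) \<longleftrightarrow>
    (\<forall>f\<in>F. \<forall>m\<in>{1..<k}. (f, m) \<in> Y \<longleftrightarrow> (f, 0) \<in> Y)"
    unfolding sum_spread_Inr[OF fY] by auto
  finally show ?thesis
    using True by (simp add: cycles_def)
qed (simp add: cycles_def)

text \<open>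
  An independent set has at most \<open>k - 1\<close> copies of a big element, and one more only if it has all of
  them; it has at most one copy of a small element. The elements where this extra copy occurs form the
  set \<open>D\<close> below, which is independent in the core, since a cycle inside \<open>D\<close> would expand to a cycle
  inside \<open>I\<close>.
\<close>

lemma independent_spread_le:
  assumes I: "I \<subseteq> copies E" "cycles spread I = {{}}" and A: "A \<subseteq> E"
  shows "int (card (I \<inter> copies A)) \<le> \<rho> A"
proof -
  have fA: "finite A"
    using A finite_ground by (rule finite_subset)
  have fI: "finite I"
    by (rule finite_copies[OF I(1)])
  define S where "S e = {i. (e, i) \<in> I}" for e
  have Sk: "S e \<subseteq> {..<k}" for e
    using I(1) by (auto simp: S_def)
  then have fS: "finite (S e)" for e
    using finite_subset by blast
  define D where "D = {e \<in> A. if e \<in> F then S e = {..<k} else S e \<noteq> {}}"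
  have DA: "D \<subseteq> A"
    by (auto simp: D_def)
  have single: "i = j" if "e \<in> A - F" "i \<in> S e" "j \<in> S e" for e i j
  proof (rule ccontr)
    assume "i \<noteq> j"
    then have "(\<Sum>y\<in>{(e, i), (e, j)}. spread y (Inl n)) = 0" for n
      using that(1) by (simp add: spread_def bit_add_eq_0_iff)
    moreover have "\<forall>f\<in>F. \<forall>m\<in>{1..<k}. (f, m) \<in> {(e, i), (e, j)} \<longleftrightarrow> (f, 0) \<in> {(e, i), (e, j)}"
      using that(1) by auto
    moreover have "{(e, i), (e, j)} \<subseteq> I"
      using that(2,3) by (simp add: S_def)
    ultimately have "{(e, i), (e, j)} \<in> cycles spread I"
      using cycles_spread_iff[OF fI] by simp
    then show False
      using I(2) by simp
  qed
  have "cycles \<phi> D = {{}}"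
  proof -
    have "Y = {}" if Y: "Y \<in> cycles \<phi> D" for Y
    proof -
      have YD: "Y \<subseteq> D"
        by (rule cycles_subset[OF Y])
      define Z where "Z = Sigma Y S"
      have ZI: "Z \<subseteq> I"
        by (auto simp: Z_def S_def)
      then have fZ: "finite Z"
        using fI by (rule finite_subset)
      have mZ: "marked Z = Sigma Y (\<lambda>e. if e \<in> F then {0} else S e)"
        using YD k3 by (auto simp: marked_def Z_def D_def split: if_splits)
      have inj: "inj_on fst (marked Z)"
        unfolding mZ using single YD DA by (auto simp: inj_on_def split: if_splits)
      have img: "fst ` marked Z = Y"
      proof
        show "fst ` marked Z \<subseteq> Y"
          unfolding mZ by auto
        show "Y \<subseteq> fst ` marked Z"
        proof
          fix e
          assume e: "e \<in> Y"
          then have "(if e \<in> F then {0} else S e) \<noteq> {}"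
            using YD by (auto simp: D_def)
          then obtain i where "i \<in> (if e \<in> F then {0} else S e)"
            by blast
          then have "(e, i) \<in> marked Z"
            using e unfolding mZ by blast
          then show "e \<in> fst ` marked Z"
            by (metis fst_conv imageI)
        qed
      qed
      have "(\<Sum>y\<in>Z. spread y (Inl n)) = 0" for n
        unfolding sum_spread_Inl[OF fZ inj] img using Y by (simp add: cycles_def)
      moreover have "(f, m) \<in> Z \<longleftrightarrow> (f, 0) \<in> Z" if "f \<in> F" "m \<in> {1..<k}" for f m
      proof -
        have "S f = {..<k}" if "f \<in> Y"
          using that YD \<open>f \<in> F\<close> by (auto simp: D_def)
        then show ?thesis
          using that(2) unfolding Z_def mem_Sigma_iff by (cases "f \<in> Y") simp_all
      qed
      ultimately have "Z \<in> cycles spread I"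
        using cycles_spread_iff[OF fI, of Z] ZI by simp
      then have "Z = {}"
        unfolding I(2) by (rule singletonD)
      then show "Y = {}"
        using img by (simp add: marked_def)
    qed
    then show ?thesis
      using empty_in_cycles[of \<phi> D] by auto
  qed
  then have "card D \<le> bin_rank \<phi> A"
    by (rule independent_card_le_bin_rank[OF fA DA])
  have "I \<inter> copies A = Sigma A S"
    using I(1) by (auto simp: S_def)
  then have "card (I \<inter> copies A) = (\<Sum>e\<in>A. card (S e))"
    using card_SigmaI[of A S] fA fS by simp
  also have "\<dots> \<le> (\<Sum>e\<in>A. (k - 1) * (if e \<in> F then 1 else 0) + (if e \<in> D then 1 else 0))"
  proof (rule sum_mono)
    fix e
    assume e: "e \<in> A"
    show "card (S e) \<le> (k - 1) * (if e \<in> F then 1 else 0) + (if e \<in> D then 1 else 0)"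
    proof (cases "e \<in> F")
      case True
      have "card (S e) \<le> k"
        using card_mono[OF _ Sk[of e]] by simp
      moreover have "card (S e) < k" if "S e \<noteq> {..<k}"
        using psubset_card_mono[of "{..<k}" "S e"] Sk[of e] that by auto
      ultimately show ?thesis
        using True e k3 by (cases "S e = {..<k}") (simp_all add: D_def)
    next
      case False
      then have "card (S e) \<le> 1"
        using single[of e] e card_le_Suc0_iff_eq[OF fS[of e]] by auto
      then show ?thesis
        using False e by (auto simp: D_def)
    qed
  qed
  also have "\<dots> = (k - 1) * card (A \<inter> F) + card (A \<inter> D)"
    unfolding sum.distrib sum_distrib_left[symmetric] sum_of_indicator[OF fA] ..
  also have "\<dots> \<le> (k - 1) * card (A \<inter> F) + bin_rank \<phi> A"
    using \<open>card D \<le> bin_rank \<phi> A\<close> DA by (simp add: Int_absorb1)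
  finally have "int (card (I \<inter> copies A)) \<le> int ((k - 1) * card (A \<inter> F)) + int (bin_rank \<phi> A)"
    by linarith
  then show ?thesis
    using core[OF A] unfolding core_def snd_conv by linarith
qed

text \<open>
  The minimum in the rank formula is attained at the set \<open>A\<close> of the big elements with all copies in \<open>X\<close>
  and the small elements with some copy in \<open>X\<close>. An independent set of that size keeps all of \<open>X\<close>
  outside \<open>A\<close>, the new unit vectors inside \<open>A\<close>, and one extra copy for each element of a core basis
  \<open>B\<close> of \<open>A\<close>.
\<close>

lemma independent_spread_exists:
  assumes X: "X \<subseteq> copies E"
  shows "\<exists>I \<subseteq> X. cycles spread I = {{}} \<and>
    (\<exists>A \<subseteq> E. int (card I) = \<rho> A + int (card (X - copies A)))"
proof -
  define S where "S e = {i. (e, i) \<in> X}" for e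
  have Sk: "S e \<subseteq> {..<k}" for e
    using X by (auto simp: S_def)
  define A where "A = {e \<in> E. if e \<in> F then S e = {..<k} else S e \<noteq> {}}"
  have A: "A \<subseteq> E" "finite A"
    using finite_ground by (auto simp: A_def)
  obtain B where B: "B \<subseteq> A" "cycles \<phi> B = {{}}" "card B = bin_rank \<phi> A"
    using exists_independent_subset[OF A(2), of \<phi>] by (elim exE conjE) simp
  define \<iota> where "\<iota> e = (SOME i. i \<in> S e)" for e
  have \<iota>: "\<iota> e \<in> S e" if "e \<in> A - F" for e
  proof -
    have "\<exists>i. i \<in> S e"
      using that by (auto simp: A_def)
    then show ?thesis
      unfolding \<iota>_def by (rule someI_ex)
  qed
  define T where "T e = (if e \<in> F then if e \<in> B then {..<k} else {1..<k}
    else if e \<in> B then {\<iota> e} else {})" for e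
  define I where "I = (X - copies A) \<union> Sigma A T"
  have TS: "T e \<subseteq> S e" if "e \<in> A" for e
  proof (cases "e \<in> F")
    case True
    then have "S e = {..<k}"
      using that by (simp add: A_def)
    moreover have "{1..<k} \<subseteq> {..<k}"
      by auto
    ultimately show ?thesis
      using True by (simp add: T_def)
  next
    case False
    then show ?thesis
      using that \<iota>[of e] by (simp add: T_def)
  qed
  have IX: "I \<subseteq> X"
    using TS by (auto simp: I_def S_def)
  have fI: "finite I"
    using finite_copies[of I] IX X by simp
  have outside: "e \<in> F" if "(e, i) \<in> X" "e \<notin> A" for e i
  proof -
    have "e \<in> E" "S e \<noteq> {}"
      using that(1) X by (auto simp: S_def)
    then show ?thesis
      using that(2) by (cases "e \<in> F") (simp_all add: A_def)
  qed
  have "cycles spread I = {{}}"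
  proof -
    have "Y = {}" if Y: "Y \<in> cycles spread I" for Y
    proof -
      have YI: "Y \<subseteq> I"
        and Y0: "\<And>n. (\<Sum>y\<in>Y. spread y (Inl n)) = 0"
        and Ys: "\<And>f m. f \<in> F \<Longrightarrow> m \<in> {1..<k} \<Longrightarrow> (f, m) \<in> Y \<longleftrightarrow> (f, 0) \<in> Y"
        using Y cycles_spread_iff[OF fI, of Y] by simp_all
      have fY: "finite Y"
        using YI fI by (rule finite_subset)
      have full: "f \<in> A" if "f \<in> F" "(f, 0) \<in> Y" for f
      proof -
        have "(f, m) \<in> X" if "m < k" for m
          using Ys[OF \<open>f \<in> F\<close>, of m] \<open>(f, 0) \<in> Y\<close> that YI IX by (cases "m = 0") auto
        then have "S f = {..<k}"
          using Sk[of f] by (auto simp: S_def)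
        then show ?thesis
          using \<open>f \<in> F\<close> F_subset by (auto simp: A_def)
      qed
      have marked: "e \<in> B \<and> (e \<notin> F \<longrightarrow> i = \<iota> e) \<and> (e \<in> F \<longrightarrow> i = 0)" if p: "(e, i) \<in> marked Y" for e i
      proof -
        have ei: "(e, i) \<in> I" "e \<notin> F \<or> i = 0" "(e, i) \<in> Y"
          using p YI by (auto simp: marked_def)
        have eA: "e \<in> A"
          using ei full[of e] outside[of e i] IX by blast
        then have "i \<in> T e"
          using ei(1) X IX by (auto simp: I_def)
        then show ?thesis
          using ei(2) by (auto simp: T_def split: if_splits)
      qed
      have inj: "inj_on fst (marked Y)"
      proof (rule inj_onI)
        fix p q
        assume pq: "p \<in> marked Y" "q \<in> marked Y" "fst p = fst q"
        then obtain e i j where "p = (e, i)" "q = (e, j)"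
          by (cases p; cases q) simp
        then show "p = q"
          using pq marked[of e i] marked[of e j] by (cases "e \<in> F") simp_all
      qed
      have "fst ` marked Y \<subseteq> B"
      proof
        fix e
        assume "e \<in> fst ` marked Y"
        then obtain i where "(e, i) \<in> marked Y"
          by auto
        then show "e \<in> B"
          using marked[of e i] by simp
      qed
      moreover have "(\<Sum>e\<in>fst ` marked Y. \<phi> e n) = 0" for n
        using Y0[of n] sum_spread_Inl[OF fY inj, of n] by simp
      ultimately have "fst ` marked Y \<in> cycles \<phi> B"
        by (simp add: cycles_def)
      then have m0: "marked Y = {}"
        unfolding B(2) by simp
      show "Y = {}"
      proof (rule ccontr)
        assume "Y \<noteq> {}"
        then obtain e i where p: "(e, i) \<in> Y"
          by auto
        have "i < k"
          using p YI IX X by auto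
        then have "(e, 0) \<in> marked Y \<or> (e, i) \<in> marked Y"
          using p Ys[of e i] by (cases "i = 0") (auto simp: marked_def)
        then show False
          using m0 by simp
      qed
    qed
    then show ?thesis
      using empty_in_cycles[of spread I] by auto
  qed
  moreover have "int (card I) = \<rho> A + int (card (X - copies A))"
  proof -
    have fT: "finite (T e)" for e
      by (simp add: T_def)
    have "card (Sigma A T) = (\<Sum>e\<in>A. card (T e))"
      using A(2) fT by simp
    also have "\<dots> = (\<Sum>e\<in>A. (k - 1) * (if e \<in> F then 1 else 0) + (if e \<in> B then 1 else 0))"
      using k3 by (intro sum.cong) (auto simp: T_def)
    also have "\<dots> = (k - 1) * card (A \<inter> F) + card (A \<inter> B)"
      unfolding sum.distrib sum_distrib_left[symmetric] sum_of_indicator[OF A(2)] ..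
    finally have "int (card (Sigma A T)) = \<rho> A"
      using core[OF A(1)] B(1,3) by (simp add: core_def Int_absorb1)
    moreover have "(X - copies A) \<inter> Sigma A T = {}"
      using TS X by (auto simp: S_def)
    then have "card I = card (X - copies A) + card (Sigma A T)"
      unfolding I_def using finite_copies[OF X] A(2) fT by (intro card_Un_disjoint) auto
    ultimately show ?thesis
      by simp
  qed
  ultimately show ?thesis
    using IX A(1) by (intro exI[of _ I]) auto
qed

lemma nrank_eq_bin_rank_spread:
  assumes X: "X \<subseteq> copies E"
  shows "nrank X = int (bin_rank spread X)"
proof (rule antisym)
  obtain I A where I: "I \<subseteq> X" "cycles spread I = {{}}"
    and A: "A \<subseteq> E" "int (card I) = \<rho> A + int (card (X - copies A))"
    using independent_spread_exists[OF X] by (elim exE conjE) simp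
  have "nrank X \<le> int (card I)"
    unfolding A(2) by (rule nrank_le[OF A(1)])
  also have "\<dots> \<le> int (bin_rank spread X)"
    using independent_card_le_bin_rank[OF finite_copies[OF X] I] by simp
  finally show "nrank X \<le> int (bin_rank spread X)" .
next
  obtain I where I: "I \<subseteq> X" "cycles spread I = {{}}" "card I = bin_rank spread X"
    using exists_independent_subset[OF finite_copies[OF X], of spread] by (elim exE conjE) simp
  obtain A where A: "A \<subseteq> E" "nrank X = \<rho> A + int (card (X - copies A))"
    using nrank_attained by blast
  have fI: "finite I"
    using I(1) X finite_copies[of I] by simp
  have "card I = card (I \<inter> copies A) + card (I - copies A)"
    using fI by (rule card_Int_Diff)
  moreover have "card (I - copies A) \<le> card (X - copies A)"
    using I(1) finite_copies[OF X] by (intro card_mono) auto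
  moreover have "int (card (I \<inter> copies A)) \<le> \<rho> A"
    using I X A(1) by (intro independent_spread_le) auto
  ultimately show "int (bin_rank spread X) \<le> nrank X"
    using I(3) A(2) by simp
qed

lemma binary_nrank: "binary (copies E, nrank)"
proof (rule binaryI[of _ "range Inl \<union> Inr ` (E \<times> UNIV)" spread])
  show "finite (copies E)"
    using finite_ground by simp
  show "countable (range Inl \<union> Inr ` (E \<times> (UNIV :: nat set)) :: (nat + 'a \<times> nat) set)"
    using countable_finite[OF finite_ground] by (intro countable_Un countable_image countable_SIGMA) auto
  show "spread p j = 0" if "p \<in> copies E" "j \<notin> range Inl \<union> Inr ` (E \<times> UNIV)" for p j
  proof (cases j)
    case (Inl n)
    then show ?thesis
      using that by simp
  next
    case (Inr q)
    then have "fst q \<notin> E"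
      using that(2) by (cases q) auto
    then show ?thesis
      using Inr F_subset by (cases q) (auto simp: spread_def)
  qed
  show "nrank X = int (bin_rank spread X)" if "X \<subseteq> copies E" for X
    by (rule nrank_eq_bin_rank_spread[OF that])
qed

end

theorem binary_natural_matroid_iff:
  assumes "k \<ge> 3" and "k_polymatroid k P"
  shows "binary (natural_matroid k P) \<longleftrightarrow> binary (fst P, core k P)"
proof -
  obtain E \<rho> where P: "P = (E, \<rho>)"
    by (cases P)
  interpret k_poly k E \<rho>
    using assms P by unfold_locales auto
  show ?thesis
    unfolding P natural_matroid_eq fst_conv
  proof
    assume "binary (copies E, nrank)"
    then obtain \<psi> :: "'a \<times> nat \<Rightarrow> nat \<Rightarrow> bit" where \<psi>: "\<forall>X \<subseteq> copies E. nrank X = int (bin_rank \<psi> X)"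
      unfolding binary_iff[OF finite_copies[OF subset_refl]] by (rule exE)
    interpret binary_natural_rep k E \<rho> \<psi>
      using \<psi> by unfold_locales simp
    show "binary (E, core k (E, \<rho>))"
      unfolding binary_iff[OF finite_ground]
      by (rule exI[of _ compressed]) (simp add: core_eq_bin_rank_compressed)
  next
    assume "binary (E, core k (E, \<rho>))"
    then obtain \<phi> :: "'a \<Rightarrow> nat \<Rightarrow> bit" where \<phi>: "\<forall>A \<subseteq> E. core k (E, \<rho>) A = int (bin_rank \<phi> A)"
      unfolding binary_iff[OF finite_ground] by (rule exE)
    interpret core_rep k E \<rho> \<phi>
      using \<phi> by unfold_locales simp
    show "binary (copies E, nrank)"
      by (rule binary_nrank)
  qed
qed


section \<open>Minors and the core\<close>

abbreviation minor :: "'a set_function \<Rightarrow> 'a set \<Rightarrow> 'a set \<Rightarrow> 'a set_function" where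
  "minor P X Y \<equiv> contraction (deletion P X) Y"

lemma minor_eq: "minor (E, \<rho>) X Y = (E - X - Y, \<lambda>Z. \<rho> (Y \<union> Z) - \<rho> Y)"
  by (simp add: contraction_def deletion_def)

text \<open>
  For \<open>k \<ge> 3\<close> these are the ranks \<open>a\<close> for which the uniform matroid of rank \<open>a\<close> on \<open>k\<close> elements, the
  natural matroid of a single element of rank \<open>a\<close>, is binary.
\<close>

definition attainable :: "nat \<Rightarrow> int set" where
  "attainable k = {0, 1, int k - 1, int k}"

lemma binary_empty: "r {} = 0 \<Longrightarrow> binary ({}, r)"
  by (rule binaryI[of "{}" "{}" "\<lambda>_ _. 0 :: bit"]) auto

lemma core_single: "e \<in> fst P \<Longrightarrow> core k P {e} = snd P {e} - (if snd P {e} \<ge> 2 then int (k - 1) else 0)"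
  by (simp add: core_def big_def)

context k_poly
begin

abbreviation \<sigma> :: "'a set \<Rightarrow> int" where
  "\<sigma> \<equiv> core k (E, \<rho>)"

lemma k_polymatroid_minor:
  assumes Y: "Y \<subseteq> E"
  shows "k_polymatroid k (minor (E, \<rho>) X Y)"
proof -
  have "\<rho> (Y \<union> A) - \<rho> Y \<le> \<rho> (Y \<union> B) - \<rho> Y" if "A \<subseteq> B" "B \<subseteq> E - X - Y" for A B
  proof -
    have "\<rho> (Y \<union> A) \<le> \<rho> (Y \<union> B)"
      using that Y by (intro rho_mono) auto
    then show ?thesis
      by simp
  qed
  moreover have "(\<rho> (Y \<union> (A \<inter> B)) - \<rho> Y) + (\<rho> (Y \<union> (A \<union> B)) - \<rho> Y)
      \<le> (\<rho> (Y \<union> A) - \<rho> Y) + (\<rho> (Y \<union> B) - \<rho> Y)" if "A \<subseteq> E - X - Y" "B \<subseteq> E - X - Y" for A B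
  proof -
    have "Y \<union> A \<subseteq> E" "Y \<union> B \<subseteq> E"
      using that Y by auto
    then have "\<rho> ((Y \<union> A) \<inter> (Y \<union> B)) + \<rho> ((Y \<union> A) \<union> (Y \<union> B)) \<le> \<rho> (Y \<union> A) + \<rho> (Y \<union> B)"
      by (rule rho_submod)
    moreover have "(Y \<union> A) \<inter> (Y \<union> B) = Y \<union> (A \<inter> B)" "(Y \<union> A) \<union> (Y \<union> B) = Y \<union> (A \<union> B)"
      by auto
    ultimately show ?thesis
      by simp
  qed
  moreover have "\<rho> (Y \<union> {e}) - \<rho> Y \<le> int k" if "e \<in> E - X - Y" for e
    using rho_insert[OF Y, of e] rho_single[of e] that by simp
  ultimately show ?thesis
    unfolding minor_eq k_polymatroid_def polymatroid_def using finite_ground by simp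
qed

lemma core_empty: "\<sigma> {} = 0"
  by (simp add: core_def rho_empty)

lemma core_insert:
  assumes "A \<subseteq> E" and "e \<notin> A"
  shows "\<sigma> (insert e A) = \<sigma> A + \<rho> (insert e A) - \<rho> A - (if e \<in> F then int (k - 1) else 0)"
proof -
  have fin: "finite (A \<inter> F)"
    using assms(1) finite_ground by (auto dest: finite_subset)
  show ?thesis
  proof (cases "e \<in> F")
    case True
    then have "card (insert e A \<inter> F) = Suc (card (A \<inter> F))"
      using fin assms(2) by simp
    then show ?thesis
      using True unfolding core_def snd_conv by (simp add: algebra_simps)
  qed (simp add: core_def)
qed

lemma core_submod:
  assumes "A \<subseteq> E" and "B \<subseteq> E"
  shows "\<sigma> (A \<inter> B) + \<sigma> (A \<union> B) \<le> \<sigma> A + \<sigma> B"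
proof -
  have "finite (A \<inter> F)" "finite (B \<inter> F)"
    using assms finite_ground by (auto dest: finite_subset)
  then have "card (A \<inter> F) + card (B \<inter> F) = card ((A \<inter> F) \<union> (B \<inter> F)) + card ((A \<inter> F) \<inter> (B \<inter> F))"
    by (rule card_Un_Int)
  moreover have "(A \<inter> F) \<union> (B \<inter> F) = (A \<union> B) \<inter> F" "(A \<inter> F) \<inter> (B \<inter> F) = (A \<inter> B) \<inter> F"
    by auto
  ultimately have "(k - 1) * card (A \<inter> F) + (k - 1) * card (B \<inter> F) =
      (k - 1) * card ((A \<union> B) \<inter> F) + (k - 1) * card ((A \<inter> B) \<inter> F)"
    by (simp flip: distrib_left)
  then show ?thesis
    using rho_submod[OF assms] unfolding core_def snd_conv by linarith
qed

text \<open>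
  If no single element lowers the core after contracting \<open>Y\<close>, then a big element keeps rank at
  least \<open>k - 1\<close>. So the contraction has the same big elements, and its core is the contraction of
  the core.
\<close>

lemma core_minor:
  assumes Y: "Y \<subseteq> E" and mono: "\<And>h. h \<in> E - X - Y \<Longrightarrow> \<sigma> Y \<le> \<sigma> (insert h Y)"
    and Z: "Z \<subseteq> E - X - Y"
  shows "core k (minor (E, \<rho>) X Y) Z = \<sigma> (Y \<union> Z) - \<sigma> Y"
proof -
  have "\<rho> (insert h Y) - \<rho> Y \<ge> 2 \<longleftrightarrow> h \<in> F" if h: "h \<in> E - X - Y" for h
  proof (cases "h \<in> F")
    case True
    then show ?thesis
      using core_insert[OF Y, of h] mono[OF h] h k3 by simp
  next
    case False
    then show ?thesis
      using rho_insert[OF Y, of h] h by (simp add: big_def)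
  qed
  then have big: "big (minor (E, \<rho>) X Y) = F \<inter> (E - X - Y)"
    unfolding minor_eq by (auto simp: big_def)
  have "finite (Y \<inter> F)" "finite (Z \<inter> F)"
    using Y Z finite_ground by (auto dest: finite_subset)
  moreover have "(Y \<inter> F) \<inter> (Z \<inter> F) = {}" "(Y \<union> Z) \<inter> F = (Y \<inter> F) \<union> (Z \<inter> F)"
    using Z by auto
  ultimately have "card ((Y \<union> Z) \<inter> F) = card (Y \<inter> F) + card (Z \<inter> F)"
    by (simp add: card_Un_disjoint)
  moreover have "Z \<inter> (F \<inter> (E - X - Y)) = Z \<inter> F"
    using Z by auto
  ultimately show ?thesis
    unfolding core_def big unfolding minor_eq by (simp add: algebra_simps)
qed

lemma single_binary_iff:
  assumes E: "E = {e}"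
  shows "binary (E, \<sigma>) \<longleftrightarrow> \<rho> {e} \<in> attainable k"
proof -
  have \<sigma>: "\<sigma> {e} = \<rho> {e} - (if \<rho> {e} \<ge> 2 then int (k - 1) else 0)"
    using core_single[of e "(E, \<rho>)" k] E by simp
  have \<rho>: "0 \<le> \<rho> {e}" "\<rho> {e} \<le> int k"
    using rho_mono[of "{}" "{e}"] rho_single[of e] rho_empty E by auto
  have "\<rho> {e} \<in> attainable k \<longleftrightarrow> \<sigma> {e} = 0 \<or> \<sigma> {e} = 1"
    using \<rho> k3 unfolding \<sigma> attainable_def by auto
  also have "\<dots> \<longleftrightarrow> binary (E, \<sigma>)"
  proof
    assume *: "\<sigma> {e} = 0 \<or> \<sigma> {e} = 1"
    show "binary (E, \<sigma>)"
    proof (rule binaryI[of _ "UNIV :: unit set" "\<lambda>_ _. if \<sigma> {e} = 1 then 1 else 0"])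
      show "\<sigma> X = int (bin_rank (\<lambda>_ (_ :: unit). if \<sigma> {e} = 1 then 1 else 0) X)" if "X \<subseteq> E" for X
      proof -
        have "X = {} \<or> X = {e}"
          using that E by auto
        then show ?thesis
          using * core_empty by (auto simp: bin_rank_singleton)
      qed
    qed (use finite_ground in auto)
  next
    assume "binary (E, \<sigma>)"
    then have m: "matroid_rank E \<sigma>"
      by (rule binary_imp_matroid_rank[OF finite_ground])
    then have "\<sigma> {} \<le> \<sigma> {e}" "\<sigma> {e} \<le> 1"
      using matroid_rank_mono[OF m, of "{}" "{e}"] E by (auto simp: matroid_rank_def)
    then show "\<sigma> {e} = 0 \<or> \<sigma> {e} = 1"
      using core_empty by auto
  qed
  finally show ?thesis ..
qed

end

lemma binary_natural_iff:
  assumes "k \<ge> 3"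
  shows "P \<in> binary_natural k \<longleftrightarrow> k_polymatroid k P \<and> binary (fst P, core k P)"
  using binary_natural_matroid_iff[OF assms, of P] by (auto simp: binary_natural_def)

lemma excluded_minors_iff:
  assumes "k \<ge> 3"
  shows "(E, \<rho>) \<in> excluded_minors k \<longleftrightarrow>
    k_polymatroid k (E, \<rho>) \<and> \<not> binary (E, core k (E, \<rho>)) \<and>
    (\<forall>X Y. X \<subseteq> E \<and> Y \<subseteq> E \<and> X \<inter> Y = {} \<and> X \<union> Y \<noteq> {} \<longrightarrow>
      binary (E - X - Y, core k (minor (E, \<rho>) X Y)))"
proof (cases "k_polymatroid k (E, \<rho>)")
  case True
  interpret k_poly k E \<rho>
    using True assms by unfold_locales
  have minors: "minor (E, \<rho>) X Y \<in> binary_natural k \<longleftrightarrow> binary (E - X - Y, core k (minor (E, \<rho>) X Y))"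
    if "Y \<subseteq> E" for X Y
    using k_polymatroid_minor[OF that, of X] binary_natural_iff[OF assms, of "minor (E, \<rho>) X Y"]
    by (simp add: minor_eq)
  have "proper_minors (E, \<rho>) \<subseteq> binary_natural k \<longleftrightarrow>
      (\<forall>X Y. X \<subseteq> E \<and> Y \<subseteq> E \<and> X \<inter> Y = {} \<and> X \<union> Y \<noteq> {} \<longrightarrow> minor (E, \<rho>) X Y \<in> binary_natural k)"
    unfolding proper_minors_def fst_conv by blast
  also have "\<dots> \<longleftrightarrow> (\<forall>X Y. X \<subseteq> E \<and> Y \<subseteq> E \<and> X \<inter> Y = {} \<and> X \<union> Y \<noteq> {} \<longrightarrow>
      binary (E - X - Y, core k (minor (E, \<rho>) X Y)))"
    by (simp add: minors cong: imp_cong)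
  finally show ?thesis
    using True binary_natural_iff[OF assms, of "(E, \<rho>)"] by (simp add: excluded_minors_def)
qed (simp add: excluded_minors_def)


section \<open>The three families of excluded minors\<close>

lemma binary_free:
  assumes "finite G" and "\<And>Z. Z \<subseteq> G \<Longrightarrow> r Z = int (card Z)"
  shows "binary (G, r)"
proof (rule binaryI[of _ G "\<lambda>e i. if i \<in> G \<and> e = i then 1 else 0"])
  fix X
  assume X: "X \<subseteq> G"
  have fX: "finite X"
    using X assms(1) by (rule finite_subset)
  have "Y = {}" if Y: "Y \<in> cycles (\<lambda>e i. if i \<in> G \<and> e = i then 1 else 0) X" for Y
  proof (rule ccontr)
    assume "Y \<noteq> {}"
    then obtain y where y: "y \<in> Y"
      by blast
    have "y \<in> G" "finite Y"
      using y cycles_subset[OF Y] X fX by (auto dest: finite_subset)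
    then have "(\<Sum>e\<in>Y. if y \<in> G \<and> e = y then 1 else 0 :: bit) = 1"
      using y by simp
    then show False
      using Y by (simp add: cycles_def)
  qed
  then have "cycles (\<lambda>e i. if i \<in> G \<and> e = i then 1 else 0 :: bit) X = {{}}"
    using empty_in_cycles[of _ X] by auto
  then show "r X = int (bin_rank (\<lambda>e i. if i \<in> G \<and> e = i then 1 else 0) X)"
    using bin_rank_eq_card_iff[OF fX, of "\<lambda>e i. if i \<in> G \<and> e = i then 1 else 0"] assms(2)[OF X]
    by simp
qed (use assms(1) countable_finite in auto)

lemma binary_rank_one:
  assumes "finite G" and "\<And>Z. Z \<subseteq> G \<Longrightarrow> r Z = (if Z = {} then 0 else 1)"
  shows "binary (G, r)"
proof (rule binaryI[of _ "UNIV :: unit set" "\<lambda>_ _. 1"])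
  fix X
  assume X: "X \<subseteq> G"
  have "finite X"
    using X assms(1) by (rule finite_subset)
  then have "bin_rank (\<lambda>_ (_ :: unit). 1) X = (if X = {} then 0 else 1)"
  proof (induction X)
    case (insert x X)
    have "dependent_on (\<lambda>_ (_ :: unit). 1) X x \<longleftrightarrow> X \<noteq> {}"
    proof
      assume "X \<noteq> {}"
      then obtain y where "y \<in> X"
        by blast
      then show "dependent_on (\<lambda>_ (_ :: unit). 1) X x"
        unfolding dependent_on_def by (intro exI[of _ "{y}"]) simp
    qed (auto simp: dependent_on_def)
    then show ?case
      using insert bin_rank_insert[of X x "\<lambda>_ (_ :: unit). 1"] by simp
  qed simp
  then show "r X = int (bin_rank (\<lambda>_ (_ :: unit). 1) X)"
    using assms(2)[OF X] by simp
qed (use assms(1) in auto)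

text \<open>
  A circuit is represented by unit vectors together with their sum, which is put on \<open>z\<close>.
\<close>

lemma binary_circuit:
  assumes "finite G" and z: "z \<in> G"
    and r: "\<And>Z. Z \<subseteq> G \<Longrightarrow> r Z = int (if Z = G then card G - 1 else card Z)"
  shows "binary (G, r)"
proof (rule binaryI[of _ G "\<lambda>e i. if i \<in> G - {z} \<and> (e = z \<or> e = i) then 1 else 0"])
  let ?\<phi> = "\<lambda>e i. if i \<in> G - {z} \<and> (e = z \<or> e = i) then 1 else 0 :: bit"
  fix X
  assume X: "X \<subseteq> G"
  have fX: "finite X"
    using X assms(1) by (rule finite_subset)
  have sum: "(\<Sum>e\<in>Y. ?\<phi> e i) = 0 \<longleftrightarrow> (i \<in> Y \<longleftrightarrow> z \<in> Y)" if "finite Y" "i \<in> G - {z}" for Y i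
  proof -
    have "(\<Sum>e\<in>Y. ?\<phi> e i) = (\<Sum>e\<in>Y \<inter> {z, i}. 1)"
      using that by (intro sum.mono_neutral_cong_right) auto
    then show ?thesis
      using that(2) by (cases "i \<in> Y"; cases "z \<in> Y") (auto simp: Int_insert_right)
  qed
  have cyc: "Y \<in> cycles ?\<phi> X \<longleftrightarrow> Y \<subseteq> X \<and> (Y = {} \<or> Y = G)" for Y
  proof
    assume Y: "Y \<in> cycles ?\<phi> X"
    have YX: "Y \<subseteq> X"
      by (rule cycles_subset[OF Y])
    then have "finite Y"
      using fX by (rule finite_subset)
    then have "i \<in> Y \<longleftrightarrow> z \<in> Y" if "i \<in> G - {z}" for i
      by (rule iffD1[OF sum[OF _ that] cycles_sum[OF Y]])
    then have "Y = {} \<or> Y = G"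
      using YX X z by blast
    then show "Y \<subseteq> X \<and> (Y = {} \<or> Y = G)"
      using YX by simp
  next
    assume Y: "Y \<subseteq> X \<and> (Y = {} \<or> Y = G)"
    have "(\<Sum>e\<in>Y. ?\<phi> e i) = 0" for i
    proof (cases "i \<in> G - {z}")
      case True
      have "i \<in> Y \<longleftrightarrow> z \<in> Y"
        using Y True z by auto
      moreover have "finite Y"
        using Y fX by (auto dest: finite_subset)
      ultimately show ?thesis
        by (intro iffD2[OF sum[OF _ True]])
    qed (intro sum.neutral, auto)
    then show "Y \<in> cycles ?\<phi> X"
      using Y by (simp add: cycles_def)
  qed
  have "bin_rank ?\<phi> X = (if X = G then card G - 1 else card X)"
  proof (cases "X = G")
    case True
    have "cycles ?\<phi> X = {{}, G}"
      using cyc True by auto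
    moreover have "G \<noteq> {}"
      using z by auto
    moreover obtain m where "card G = Suc m"
      using card_Suc_Diff1[OF assms(1) z] by metis
    ultimately have "card (cycles ?\<phi> X) * 2 ^ (card G - 1) = 2 ^ card X"
      using True by simp
    then show ?thesis
      using bin_rank_unique[OF fX, of ?\<phi> "card G - 1"] True by simp
  next
    case False
    then have "cycles ?\<phi> X = {{}}"
      using cyc X by auto
    then show ?thesis
      using bin_rank_eq_card_iff[OF fX, of ?\<phi>] False by simp
  qed
  then show "r X = int (bin_rank ?\<phi> X)"
    using r[OF X] by simp
qed (use assms(1) countable_finite in auto)

text \<open>
  Three elements of rank two without a smaller cycle form a cycle. The difference of two such triples
  is a pair, which is independent.
\<close>

lemma four_point_line_not_binary:
  assumes "card E = 4" and r: "\<And>A. A \<subseteq> E \<Longrightarrow> r A = int (min (card A) 2)"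
  shows "\<not> binary (E, r)"
proof
  assume "binary (E, r)"
  have finE: "finite E"
    using assms(1) by (simp add: card_ge_0_finite)
  obtain \<phi> :: "'a \<Rightarrow> nat \<Rightarrow> bit" where "\<forall>X \<subseteq> E. r X = int (bin_rank \<phi> X)"
    using \<open>binary (E, r)\<close> unfolding binary_iff[OF finE] by (rule exE)
  then have rank: "bin_rank \<phi> X = min (card X) 2" if "X \<subseteq> E" for X
    using r[OF that] that by simp
  have small: "Y = {}" if "Y \<in> cycles \<phi> E" "card Y \<le> 2" for Y
  proof -
    have Y: "Y \<subseteq> E" "finite Y"
      using cycles_subset[OF that(1)] finE by (auto dest: finite_subset)
    then have "cycles \<phi> Y = {{}}"
      using bin_rank_eq_card_iff[OF Y(2), of \<phi>] rank[OF Y(1)] that(2) by simp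
    moreover have "Y \<in> cycles \<phi> Y"
      using that(1) by (simp add: cycles_def)
    ultimately show ?thesis
      by simp
  qed
  have triple: "T \<in> cycles \<phi> E" if T: "T \<subseteq> E" "card T = 3" for T
  proof -
    have fT: "finite T"
      using T(1) finE by (rule finite_subset)
    have "cycles \<phi> T \<noteq> {{}}"
      using bin_rank_eq_card_iff[OF fT, of \<phi>] rank[OF T(1)] T(2) by simp
    then obtain Y where Y: "Y \<in> cycles \<phi> T" "Y \<noteq> {}"
      using empty_in_cycles[of \<phi> T] by blast
    have YE: "Y \<in> cycles \<phi> E"
      using Y(1) cycles_mono[OF T(1), of \<phi>] by blast
    have "card Y \<ge> 3"
      using small[OF YE] Y(2) by linarith
    then have "Y = T"
      using card_seteq[OF fT cycles_subset[OF Y(1)]] T(2) by simp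
    then show ?thesis
      using YE by simp
  qed
  obtain T where T: "T \<subseteq> E" "card T = 3"
    using obtain_subset_with_card_n[of 3 E] assms(1) by auto
  then obtain a b c where abc: "T = {a, b, c}" "a \<noteq> b" "a \<noteq> c" "b \<noteq> c"
    by (auto simp: card_3_iff)
  obtain d where d: "d \<in> E" "d \<notin> T"
    using exists_not_in[of T E] T assms(1) finE by (auto dest: finite_subset)
  have abd: "{a, b, d} \<in> cycles \<phi> E"
    using abc d T by (intro triple) auto
  have "{a, b, c} \<in> cycles \<phi> E"
    using triple[OF T] abc(1) by simp
  from cycles_sym_diff[OF finE this abd] have "sym_diff {a, b, c} {a, b, d} \<in> cycles \<phi> E" .
  moreover have "sym_diff {a, b, c} {a, b, d} = {c, d}"
    using abc d by auto
  moreover have "card {c, d} \<le> 2"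
    by (simp add: card_insert_le_m1)
  ultimately show False
    using small[of "{c, d}"] by simp
qed

text \<open>
  A pair of elements is an excluded minor iff all its single-element minors are attainable but one
  element lowers the core of the other. The triples are the two single ranks, in increasing order,
  and the rank of the pair. The extra pairs for \<open>k = 3\<close> have a contraction of rank \<open>k - 2\<close>, which is
  attainable only there.
\<close>

definition pair_ranks :: "nat \<Rightarrow> (int \<times> int \<times> int) set" where
  "pair_ranks k = (let K = int k in
     {(K - 1, K - 1, K - 1), (K - 1, K - 1, K), (K - 1, K, K), (K, K, K), (K, K, K + 1)} \<union>
     (if k = 3 then {(1, 2, 2), (2, 3, 4)} else {}))"

lemma pair_ranks_iff:
  fixes a b c :: int
  assumes "k \<ge> 3" and "a \<le> b"
  shows "(a, b, c) \<in> pair_ranks k \<longleftrightarrow>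
    a \<in> attainable k \<and> b \<in> attainable k \<and> c - a \<in> attainable k \<and> c - b \<in> attainable k \<and>
    (c - a < (if b \<ge> 2 then int k - 1 else 0) \<or> c - b < (if a \<ge> 2 then int k - 1 else 0))"
proof -
  define K where "K = int k"
  have K: "K \<ge> 3" "k = 3 \<longleftrightarrow> K = 3"
    using assms(1) by (auto simp: K_def)
  show ?thesis
  proof
    assume "(a, b, c) \<in> pair_ranks k"
    then consider "a = K - 1" "b = K - 1" "c = K - 1" | "a = K - 1" "b = K - 1" "c = K"
      | "a = K - 1" "b = K" "c = K" | "a = K" "b = K" "c = K" | "a = K" "b = K" "c = K + 1"
      | "K = 3" "a = 1" "b = 2" "c = 2" | "K = 3" "a = 2" "b = 3" "c = 4"
      unfolding pair_ranks_def Let_def K_def[symmetric] K(2) by (auto split: if_splits)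
    then show "a \<in> attainable k \<and> b \<in> attainable k \<and> c - a \<in> attainable k \<and> c - b \<in> attainable k \<and>
      (c - a < (if b \<ge> 2 then int k - 1 else 0) \<or> c - b < (if a \<ge> 2 then int k - 1 else 0))"
      unfolding attainable_def K_def[symmetric] using K(1) by cases simp_all
  next
    assume *: "a \<in> attainable k \<and> b \<in> attainable k \<and> c - a \<in> attainable k \<and> c - b \<in> attainable k \<and>
      (c - a < (if b \<ge> 2 then int k - 1 else 0) \<or> c - b < (if a \<ge> 2 then int k - 1 else 0))"
    have att: "x = 0 \<or> x = 1 \<or> x = K - 1 \<or> x = K" "0 \<le> x" if "x \<in> attainable k" for x
      using that K(1) by (auto simp: attainable_def K_def)
    have mem: "a \<in> attainable k" "b \<in> attainable k" "c - a \<in> attainable k" "c - b \<in> attainable k"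
      using * by simp_all
    note nonneg = att(2)[OF mem(3)] att(2)[OF mem(4)]
    have drop: "c - a < (if b \<ge> 2 then K - 1 else 0) \<or> c - b < (if a \<ge> 2 then K - 1 else 0)"
      using * unfolding K_def by (elim conjE)
    have "b \<ge> 2"
      using drop nonneg assms(2) by (auto split: if_splits)
    then have b: "b = K - 1 \<or> b = K"
      using att(1)[OF mem(2)] by auto
    show "(a, b, c) \<in> pair_ranks k"
    proof (cases "a \<ge> 2")
      case False
      then have "c - a < K - 1" "a \<le> 1"
        using drop nonneg \<open>b \<ge> 2\<close> by simp_all
      moreover have "c - a = 0 \<or> c - a = 1"
        using att(1)[OF mem(3)] calculation(1) by auto
      ultimately have "K = 3" "a = 1" "b = 2" "c = 2"
        using b nonneg K(1) by linarith+
      then show ?thesis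
        unfolding pair_ranks_def Let_def K_def[symmetric] K(2) by simp
    next
      case True
      then have a: "a = K - 1 \<or> a = K"
        using att(1)[OF mem(1)] by auto
      have "c - b < K - 1"
        using drop True \<open>b \<ge> 2\<close> assms(2) by auto
      then have c: "c = b \<or> c = b + 1"
        using att(1)[OF mem(4)] by auto
      show ?thesis
      proof (cases "c - a = 2")
        case True
        then have "K = 3"
          using att(1)[OF mem(3)] K(1) by auto
        moreover have "a = 2" "b = 3" "c = 4"
          using True a b c \<open>K = 3\<close> assms(2) by linarith+
        ultimately show ?thesis
          unfolding pair_ranks_def Let_def K_def[symmetric] K(2) by simp
      next
        case False
        then show ?thesis
          using a b c assms(2) unfolding pair_ranks_def Let_def K_def[symmetric]
          by (elim disjE) simp_all
      qed
    qed
  qed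
qed

definition one_element_family :: "nat \<Rightarrow> 'a set_function \<Rightarrow> bool" where
  "one_element_family k P \<longleftrightarrow> (\<exists>e. fst P = {e} \<and> 2 \<le> snd P {e} \<and> snd P {e} \<le> int k - 2)"

definition two_element_family :: "nat \<Rightarrow> 'a set_function \<Rightarrow> bool" where
  "two_element_family k P \<longleftrightarrow>
     (\<exists>e f. e \<noteq> f \<and> fst P = {e, f} \<and> (snd P {e}, snd P {f}, snd P {e, f}) \<in> pair_ranks k)"

text \<open>
  The core is the four-point line and \<open>G\<close> is the set of its big elements.
\<close>

definition four_element_family :: "nat \<Rightarrow> 'a set_function \<Rightarrow> bool" where
  "four_element_family k P \<longleftrightarrow> card (fst P) = 4 \<and>
     (\<exists>G \<subseteq> fst P. \<forall>A \<subseteq> fst P. snd P A = int (min (card A) 2) + int ((k - 1) * card (A \<inter> G)))"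

context k_poly
begin

lemma one_element_excluded:
  assumes "one_element_family k (E, \<rho>)"
  shows "(E, \<rho>) \<in> excluded_minors k"
proof -
  obtain e where e: "E = {e}" "2 \<le> \<rho> {e}" "\<rho> {e} \<le> int k - 2"
    using assms by (auto simp: one_element_family_def)
  have "\<not> binary (E, \<sigma>)"
    using single_binary_iff[OF e(1)] e(2,3) k3 by (auto simp: attainable_def)
  moreover have "binary (E - X - Y, core k (minor (E, \<rho>) X Y))"
    if "X \<subseteq> E" "Y \<subseteq> E" "X \<union> Y \<noteq> {}" for X Y
  proof -
    have empty: "E - X - Y = {}"
      using that e(1) by auto
    show ?thesis
      unfolding empty by (rule binary_empty) (simp add: core_def minor_eq)
  qed
  ultimately show ?thesis
    using excluded_minors_iff[OF k3, of E \<rho>] poly by simp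
qed

lemma core_pair:
  assumes "e \<noteq> f" and "E = {e, f}"
  shows "\<sigma> {e, f} < \<sigma> {f} \<longleftrightarrow> \<rho> {e, f} - \<rho> {f} < (if \<rho> {e} \<ge> 2 then int k - 1 else 0)"
  using core_insert[of "{f}" e] assms k3 by (auto simp: big_def)

lemma two_element_excluded:
  assumes "two_element_family k (E, \<rho>)"
  shows "(E, \<rho>) \<in> excluded_minors k"
proof -
  obtain e f where ef: "e \<noteq> f" "E = {e, f}" and "(\<rho> {e}, \<rho> {f}, \<rho> {e, f}) \<in> pair_ranks k"
    using assms by (auto simp: two_element_family_def)
  moreover have "\<rho> {e} \<le> \<rho> {f}"
    using calculation(3) k3 by (auto simp: pair_ranks_def Let_def split: if_splits)
  ultimately have att: "\<rho> {e} \<in> attainable k" "\<rho> {f} \<in> attainable k"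
      "\<rho> {e, f} - \<rho> {e} \<in> attainable k" "\<rho> {e, f} - \<rho> {f} \<in> attainable k"
    and down: "\<rho> {f, e} - \<rho> {e} < (if \<rho> {f} \<ge> 2 then int k - 1 else 0) \<or>
      \<rho> {e, f} - \<rho> {f} < (if \<rho> {e} \<ge> 2 then int k - 1 else 0)"
    using pair_ranks_iff[OF k3, of "\<rho> {e}" "\<rho> {f}" "\<rho> {e, f}"] by (simp_all add: insert_commute)
  have fe: "f \<noteq> e" "E = {f, e}"
    using ef by auto
  have "\<not> binary (E, \<sigma>)"
  proof
    assume "binary (E, \<sigma>)"
    then have m: "matroid_rank E \<sigma>"
      by (rule binary_imp_matroid_rank[OF finite_ground])
    have "\<sigma> {f} \<le> \<sigma> {e, f}" "\<sigma> {e} \<le> \<sigma> {f, e}"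
      using matroid_rank_mono[OF m] ef(2) by auto
    then show False
      using down core_pair[OF ef] core_pair[OF fe] by linarith
  qed
  moreover have "binary (E - X - Y, core k (minor (E, \<rho>) X Y))"
    if XY: "X \<subseteq> E" "Y \<subseteq> E" "X \<inter> Y = {}" "X \<union> Y \<noteq> {}" for X Y
  proof -
    have single: "binary (E - X - Y, core k (minor (E, \<rho>) X Y))"
      if h: "E - X - Y = {h}" and v: "\<rho> (insert h Y) - \<rho> Y \<in> attainable k" for h
    proof -
      interpret Q: k_poly k "{h}" "\<lambda>Z. \<rho> (Y \<union> Z) - \<rho> Y"
        using k_polymatroid_minor[OF XY(2), of X] k3 h by unfold_locales (simp_all add: minor_eq)
      show ?thesis
        using Q.single_binary_iff[of h] v h by (simp add: minor_eq)
    qed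
    consider "E - X - Y = {}" | h g where "E = {h, g}" "h \<noteq> g" "E - X - Y = {h}" "Y = {} \<or> Y = {g}"
    proof -
      have "E - X - Y = {} \<or> E - X - Y = {e} \<or> E - X - Y = {f}"
        using ef XY by blast
      then show ?thesis
      proof (elim disjE)
        assume D: "E - X - Y = {e}"
        then have "Y = {} \<or> Y = {f}"
          using XY(2) ef(2) by blast
        then show ?thesis
          using that(2)[of e f] D ef by blast
      next
        assume D: "E - X - Y = {f}"
        then have "Y = {} \<or> Y = {e}"
          using XY(2) ef(2) by blast
        then show ?thesis
          using that(2)[of f e] D fe by blast
      qed (rule that(1))
    qed
    then show ?thesis
    proof cases
      case 1
      show ?thesis
        unfolding 1 by (rule binary_empty) (simp add: core_def minor_eq)
    next
      case 2
      then have "h = e \<and> g = f \<or> h = f \<and> g = e"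
        using ef by (auto simp: doubleton_eq_iff)
      then have "\<rho> (insert h Y) - \<rho> Y \<in> attainable k"
        using 2(4) att rho_empty by (auto simp: insert_commute)
      then show ?thesis
        by (rule single[OF 2(3)])
    qed
  qed
  ultimately show ?thesis
    using excluded_minors_iff[OF k3, of E \<rho>] poly by simp
qed

lemma four_element_core:
  assumes G: "G \<subseteq> E" and \<rho>: "\<And>A. A \<subseteq> E \<Longrightarrow> \<rho> A = int (min (card A) 2) + int ((k - 1) * card (A \<inter> G))"
    and "A \<subseteq> E"
  shows "\<sigma> A = int (min (card A) 2)"
proof -
  have "\<rho> {e} = 1 + (if e \<in> G then int (k - 1) else 0)" if "e \<in> E" for e
    using \<rho>[of "{e}"] that by simp
  then have "F = G"
    using G k3 unfolding big_def by (auto split: if_splits)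
  then show ?thesis
    using \<rho>[OF \<open>A \<subseteq> E\<close>] unfolding core_def snd_conv by simp
qed

text \<open>
  The core of a proper minor is a minor of the four-point line: it has rank zero, or it is a parallel
  class, or it is free, or it is a three-element circuit. All of these are binary.
\<close>

lemma four_element_excluded:
  assumes "four_element_family k (E, \<rho>)"
  shows "(E, \<rho>) \<in> excluded_minors k"
proof -
  obtain G where G: "card E = 4" "G \<subseteq> E"
    "\<And>A. A \<subseteq> E \<Longrightarrow> \<rho> A = int (min (card A) 2) + int ((k - 1) * card (A \<inter> G))"
    using assms unfolding four_element_family_def fst_conv snd_conv by (elim exE conjE) simp
  have core: "\<sigma> A = int (min (card A) 2)" if "A \<subseteq> E" for A
    using four_element_core[OF G(2,3) that] by simp
  have "\<not> binary (E, \<sigma>)"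
    using G(1) core by (rule four_point_line_not_binary)
  moreover have "binary (E - X - Y, core k (minor (E, \<rho>) X Y))"
    if XY: "X \<subseteq> E" "Y \<subseteq> E" "X \<inter> Y = {}" "X \<union> Y \<noteq> {}" for X Y
  proof -
    let ?D = "E - X - Y"
    have fin: "finite Y" "finite ?D"
      using XY finite_ground by (auto dest: finite_subset)
    have r: "core k (minor (E, \<rho>) X Y) Z = int (min (card Y + card Z) 2) - int (min (card Y) 2)"
      if Z: "Z \<subseteq> ?D" for Z
    proof -
      have "\<sigma> Y \<le> \<sigma> (insert h Y)" if "h \<in> ?D" for h
        using core[of Y] core[of "insert h Y"] XY(2) fin(1) that by (simp add: card_insert_if)
      moreover have "card (Y \<union> Z) = card Y + card Z"
        using Z fin by (intro card_Un_disjoint) (auto dest: finite_subset)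
      moreover have "Y \<union> Z \<subseteq> E"
        using XY(2) Z by auto
      ultimately show ?thesis
        using core_minor[OF XY(2) _ Z] core[of Y] core[of "Y \<union> Z"] XY(2) by simp
    qed
    have card0: "card Z = 0 \<longleftrightarrow> Z = {}" if "Z \<subseteq> ?D" for Z
      using that fin(2) by (auto dest: finite_subset)
    consider "card Y \<ge> 2" | "card Y = 1" | "card Y = 0" "card ?D \<le> 2" | "card Y = 0" "card ?D = 3"
    proof -
      have U: "X \<union> Y \<subseteq> E" "finite (X \<union> Y)"
        using XY finite_ground by (auto dest: finite_subset)
      have "?D = E - (X \<union> Y)"
        by auto
      then have "card ?D = 4 - card (X \<union> Y)"
        using card_Diff_subset[OF U(2,1)] G(1) by simp
      moreover have "card (X \<union> Y) > 0"
        using XY(4) U(2) by (simp only: card_gt_0_iff simp_thms)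
      ultimately show ?thesis
        using that by linarith
    qed
    then show ?thesis
    proof cases
      case 1
      have "core k (minor (E, \<rho>) X Y) Z = int (bin_rank (\<lambda>_ (_ :: unit). 0) Z)" if "Z \<subseteq> ?D" for Z
        using r[OF that] 1 bin_rank_zero[of Z "\<lambda>_ (_ :: unit). 0"] finite_subset[OF that fin(2)] by simp
      then show ?thesis
        using fin(2) by (intro binaryI[of _ "UNIV :: unit set" "\<lambda>_ _. 0"]) auto
    next
      case 2
      have *: "core k (minor (E, \<rho>) X Y) Z = (if Z = {} then 0 else 1)" if "Z \<subseteq> ?D" for Z
        using r[OF that] 2 card0[OF that] by auto
      show ?thesis
        by (rule binary_rank_one[OF fin(2)]) (rule *)
    next
      case 3
      have *: "core k (minor (E, \<rho>) X Y) Z = int (card Z)" if "Z \<subseteq> ?D" for Z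
        using r[OF that] 3 card_mono[OF fin(2) that] by simp
      show ?thesis
        by (rule binary_free[OF fin(2)]) (rule *)
    next
      case 4
      then obtain z where z: "z \<in> ?D"
        by (metis card.empty equals0I zero_neq_numeral)
      have *: "core k (minor (E, \<rho>) X Y) Z = int (if Z = ?D then card ?D - 1 else card Z)"
        if Z: "Z \<subseteq> ?D" for Z
      proof (cases "Z = ?D")
        case False
        then have "card Z < 3"
          using psubset_card_mono[OF fin(2), of Z] Z 4(2) by auto
        then show ?thesis
          using r[OF Z] 4 False by simp
      qed (use r[OF Z] 4 in simp)
      show ?thesis
        by (rule binary_circuit[OF fin(2) z]) (rule *)
    qed
  qed
  ultimately show ?thesis
    using excluded_minors_iff[OF k3, of E \<rho>] poly by simp
qed

text \<open>
  Conversely, let the polymatroid be an excluded minor. If the core is monotone, it is the rank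
  function of a matroid all of whose proper minors are binary, and Tutte's theorem applies. If some
  element \<open>e\<close> lowers the core of some set, minimality makes that set the complement of \<open>e\<close>, and
  contracting any third element \<open>g\<close> would keep the drop; so there are at most two elements.
\<close>

lemma excluded_minor_cases:
  assumes "(E, \<rho>) \<in> excluded_minors k"
  shows "one_element_family k (E, \<rho>) \<or> two_element_family k (E, \<rho>) \<or> four_element_family k (E, \<rho>)"
proof -
  have nonbinary: "\<not> binary (E, \<sigma>)"
    and minors: "\<And>X Y. X \<subseteq> E \<Longrightarrow> Y \<subseteq> E \<Longrightarrow> X \<inter> Y = {} \<Longrightarrow> X \<union> Y \<noteq> {} \<Longrightarrow>
      binary (E - X - Y, core k (minor (E, \<rho>) X Y))"
    using assms excluded_minors_iff[OF k3, of E \<rho>] by simp_all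
  have "E \<noteq> {}"
    using nonbinary core_empty binary_empty[of \<sigma>] by auto
  show ?thesis
  proof (cases "\<exists>e. E = {e}")
    case True
    then obtain e where e: "E = {e}"
      by blast
    have "0 \<le> \<rho> {e}" "\<rho> {e} \<le> int k"
      using rho_mono[of "{}" "{e}"] rho_single[of e] rho_empty e by auto
    moreover have "\<rho> {e} \<notin> attainable k"
      using nonbinary single_binary_iff[OF e] by simp
    ultimately have "one_element_family k (E, \<rho>)"
      using e unfolding one_element_family_def attainable_def by auto
    then show ?thesis
      by simp
  next
    case several: False
    have att: "\<rho> (insert e Y) - \<rho> Y \<in> attainable k" if e: "e \<in> E" "e \<notin> Y" and Y: "Y \<subseteq> E" for e Y
    proof -
      let ?X = "E - Y - {e}"
      have D: "E - ?X - Y = {e}"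
        using e by auto
      have "E \<noteq> {e}"
        using several by blast
      then have "?X \<union> Y \<noteq> {}"
        using e(1) by blast
      then have b: "binary (E - ?X - Y, core k (minor (E, \<rho>) ?X Y))"
        using Y by (intro minors) auto
      interpret Q: k_poly k "{e}" "\<lambda>Z. \<rho> (Y \<union> Z) - \<rho> Y"
        using k_polymatroid_minor[OF Y, of ?X] k3 D by unfold_locales (simp_all add: minor_eq)
      show ?thesis
        using Q.single_binary_iff[of e] b D by (simp add: minor_eq)
    qed
    have att_single: "\<rho> {e} \<in> attainable k" if "e \<in> E" for e
      using att[of e "{}"] that rho_empty by simp
    have single: "0 \<le> \<sigma> {e} \<and> \<sigma> {e} \<le> 1" if "e \<in> E" for e
      using att_single[OF that] core_single[of e "(E, \<rho>)" k] that k3 by (auto simp: attainable_def)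
    have restrict: "binary (D, \<sigma>)" if D: "D \<subset> E" for D
    proof -
      have eq: "E - (E - D) - {} = D"
        using D by auto
      have b: "binary (D, core k (minor (E, \<rho>) (E - D) {}))"
        using minors[of "E - D" "{}"] D eq by auto
      show ?thesis
      proof (rule binary_cong[OF _ b])
        show "finite D"
          using D finite_ground by (auto dest: finite_subset)
        show "core k (minor (E, \<rho>) (E - D) {}) Z = \<sigma> Z" if "Z \<subseteq> D" for Z
          using core_minor[of "{}" "E - D" Z] that D single core_empty by auto
      qed
    qed
    have contract: "binary (E - {g}, \<lambda>Z. \<sigma> (insert g Z) - \<sigma> {g})"
      if g: "g \<in> E" and up: "\<And>h. h \<in> E - {g} \<Longrightarrow> \<sigma> {g} \<le> \<sigma> {h, g}" for g
    proof -
      have b: "binary (E - {g}, core k (minor (E, \<rho>) {} {g}))"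
        using minors[of "{}" "{g}"] g by simp
      show ?thesis
      proof (rule binary_cong[OF _ b])
        show "core k (minor (E, \<rho>) {} {g}) Z = \<sigma> (insert g Z) - \<sigma> {g}" if "Z \<subseteq> E - {g}" for Z
          using core_minor[of "{g}" "{}" Z] that g up by simp
      qed (use finite_ground in simp)
    qed
    show ?thesis
    proof (cases "\<forall>A e. A \<subseteq> E \<and> e \<in> E - A \<longrightarrow> \<sigma> A \<le> \<sigma> (insert e A)")
      case up: True
      have mono: "\<sigma> A \<le> \<sigma> B" if AB: "A \<subseteq> B" "B \<subseteq> E" for A B
      proof -
        have "\<sigma> A \<le> \<sigma> (A \<union> D)" if "finite D" "A \<union> D \<subseteq> E" for D
          using that
        proof (induction D)
          case (insert d D)
          have "\<sigma> (A \<union> D) \<le> \<sigma> (insert d (A \<union> D))"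
            using up[rule_format, of "A \<union> D" d] insert.prems by (cases "d \<in> A \<union> D") (auto simp: insert_absorb)
          then show ?case
            using insert by simp
        qed simp
        moreover have "finite B" "A \<union> B = B"
          using AB finite_ground by (auto dest: finite_subset)
        ultimately show ?thesis
          using AB(2) by metis
      qed
      have "minimal_nonbinary E \<sigma>"
      proof
        show "matroid_rank E \<sigma>"
          unfolding matroid_rank_def
          using finite_ground core_empty mono core_submod single by simp
        show "\<not> binary (E, \<sigma>)"
          by (rule nonbinary)
        show "binary (E - {y}, \<sigma>)" if "y \<in> E" for y
          using that by (intro restrict) auto
        show "binary (E - {b}, \<lambda>X. \<sigma> (insert b X) - \<sigma> {b})" if "b \<in> E" for b
          using that by (intro contract mono) auto
      qed
      then have four: "card E = 4" "\<And>A. A \<subseteq> E \<Longrightarrow> \<sigma> A = int (min (card A) 2)"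
        using minimal_nonbinary.four_point_line[of E \<sigma>] by simp_all
      have "four_element_family k (E, \<rho>)"
        unfolding four_element_family_def fst_conv snd_conv
      proof (intro conjI exI[of _ F] allI impI)
        show "card E = 4" "F \<subseteq> E"
          by (rule four(1), rule F_subset)
        show "\<rho> A = int (min (card A) 2) + int ((k - 1) * card (A \<inter> F))" if "A \<subseteq> E" for A
          using four(2)[OF that] unfolding core_def snd_conv by linarith
      qed
      then show ?thesis
        by simp
    next
      case False
      then obtain A e where Ae: "A \<subseteq> E" "e \<in> E - A" and drop: "\<sigma> (insert e A) < \<sigma> A"
        by (auto simp: not_le)
      have full: "insert e A = E"
      proof (rule ccontr)
        assume "insert e A \<noteq> E"
        then have "insert e A \<subset> E"
          using Ae by auto
        moreover have "finite (insert e A)"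
          using Ae(1) finite_ground by (auto dest: finite_subset)
        ultimately have "matroid_rank (insert e A) \<sigma>"
          using restrict binary_imp_matroid_rank by blast
        then have "\<sigma> A \<le> \<sigma> (insert e A)"
          by (rule matroid_rank_mono) auto
        then show False
          using drop by simp
      qed
      have "A \<noteq> {}"
        using several full by auto
      then obtain g where g: "g \<in> A"
        by blast
      have "A = {g}"
      proof (rule ccontr)
        assume "A \<noteq> {g}"
        have up: "\<sigma> {g} \<le> \<sigma> {h, g}" if h: "h \<in> E - {g}" for h
        proof -
          have "{h, g} \<subset> E"
            using h g Ae full \<open>A \<noteq> {g}\<close> by blast
          then have "matroid_rank {h, g} \<sigma>"
            using restrict[of "{h, g}"] binary_imp_matroid_rank[of "{h, g}" \<sigma>] by simp
          then show ?thesis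
            by (rule matroid_rank_mono) auto
        qed
        have gE: "g \<in> E"
          using g Ae(1) by blast
        have "matroid_rank (E - {g}) (\<lambda>Z. \<sigma> (insert g Z) - \<sigma> {g})"
          using contract[OF gE up] finite_ground by (intro binary_imp_matroid_rank) auto
        then have "\<sigma> (insert g (A - {g})) - \<sigma> {g} \<le> \<sigma> (insert g (E - {g})) - \<sigma> {g}"
          by (rule matroid_rank_mono) (use Ae(1) in auto)
        then show False
          using drop full g gE by (simp add: insert_absorb)
      qed
      then have E: "E = {e, g}" "E = {g, e}" "e \<noteq> g" "g \<noteq> e"
        using full Ae by auto
      have drop': "\<rho> {e, g} - \<rho> {g} < (if \<rho> {e} \<ge> 2 then int k - 1 else 0)"
        using drop \<open>A = {g}\<close> core_pair[OF E(3,1)] by simp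
      have "\<rho> {e} \<in> attainable k" "\<rho> {g} \<in> attainable k"
        "\<rho> {e, g} - \<rho> {e} \<in> attainable k" "\<rho> {e, g} - \<rho> {g} \<in> attainable k"
        using att_single att[of e "{g}"] att[of g "{e}"] E by (auto simp: insert_commute)
      then have "(\<rho> {e}, \<rho> {g}, \<rho> {e, g}) \<in> pair_ranks k \<or> (\<rho> {g}, \<rho> {e}, \<rho> {g, e}) \<in> pair_ranks k"
        using pair_ranks_iff[OF k3, of "\<rho> {e}" "\<rho> {g}" "\<rho> {e, g}"]
          pair_ranks_iff[OF k3, of "\<rho> {g}" "\<rho> {e}" "\<rho> {e, g}"] drop'
        by (simp add: insert_commute) linarith
      then have "two_element_family k (E, \<rho>)"
        unfolding two_element_family_def fst_conv snd_conv using E by blast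
      then show ?thesis
        by simp
    qed
  qed
qed

end

lemma excluded_minors_families:
  assumes "k \<ge> 3"
  shows "P \<in> excluded_minors k \<longleftrightarrow> k_polymatroid k P \<and>
    (one_element_family k P \<or> two_element_family k P \<or> four_element_family k P)"
proof (cases "k_polymatroid k P")
  case True
  obtain E \<rho> where P: "P = (E, \<rho>)"
    by (cases P)
  interpret k_poly k E \<rho>
    using True assms P by unfold_locales auto
  show ?thesis
    using True P excluded_minor_cases one_element_excluded two_element_excluded four_element_excluded
    by blast
qed (simp add: excluded_minors_def)


section \<open>Counting isomorphism classes\<close>

text \<open>
  The size of the ground set, the sum of the single ranks and the total rank already separate the
  excluded minors, so counting the classes amounts to counting these triples.
\<close>

definition profile :: "'a set_function \<Rightarrow> nat \<times> int \<times> int" where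
  "profile P = (card (fst P), \<Sum>e\<in>fst P. snd P {e}, snd P (fst P))"

lemma profile_isomorphic:
  assumes "isomorphic P Q"
  shows "profile P = profile Q"
proof -
  obtain f where f: "bij_betw f (fst P) (fst Q)" "\<forall>A \<subseteq> fst P. snd Q (f ` A) = snd P A"
    using assms unfolding isomorphic_def by (elim exE conjE) simp
  have "(\<Sum>e\<in>fst Q. snd Q {e}) = (\<Sum>e\<in>fst P. snd Q {f e})"
    using sum.reindex_bij_betw[OF f(1), of "\<lambda>e. snd Q {e}"] by simp
  also have "\<dots> = (\<Sum>e\<in>fst P. snd P {e})"
  proof (rule sum.cong)
    fix e
    assume "e \<in> fst P"
    then show "snd Q {f e} = snd P {e}"
      using f(2)[rule_format, of "{e}"] by simp
  qed simp
  finally show ?thesis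
    using bij_betw_same_card[OF f(1)] f(2)[rule_format, of "fst P"] bij_betw_imp_surj_on[OF f(1)]
    by (simp add: profile_def)
qed

lemma profile_one_element: "fst P = {e} \<Longrightarrow> profile P = (1, snd P {e}, snd P {e})"
  by (simp add: profile_def)

lemma profile_two_element:
  "e \<noteq> f \<Longrightarrow> fst P = {e, f} \<Longrightarrow> profile P = (2, snd P {e} + snd P {f}, snd P {e, f})"
  by (simp add: profile_def)

lemma profile_four_element:
  assumes "card (fst P) = 4" and "G \<subseteq> fst P"
    and \<rho>: "\<And>A. A \<subseteq> fst P \<Longrightarrow> snd P A = int (min (card A) 2) + int ((k - 1) * card (A \<inter> G))"
  shows "profile P = (4, 4 + int ((k - 1) * card G), 2 + int ((k - 1) * card G))"
proof -
  have fin: "finite (fst P)"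
    using assms(1) by (simp add: card_ge_0_finite)
  have "(\<Sum>e\<in>fst P. snd P {e}) = (\<Sum>e\<in>fst P. int (1 + (k - 1) * (if e \<in> G then 1 else 0)))"
    using \<rho> by (intro sum.cong) auto
  also have "\<dots> = int (\<Sum>e\<in>fst P. 1 + (k - 1) * (if e \<in> G then 1 else 0))"
    by simp
  also have "\<dots> = int (4 + (k - 1) * card (fst P \<inter> G))"
    unfolding sum.distrib sum_distrib_left[symmetric] sum_of_indicator[OF fin] using assms(1) by simp
  finally show ?thesis
    using assms(1,2) \<rho>[of "fst P"] by (simp add: profile_def Int_absorb1)
qed

lemma pair_ranks_inj:
  assumes "k \<ge> 3" and "(a, b, c) \<in> pair_ranks k" and "(a', b', c') \<in> pair_ranks k"
    and "a + b = a' + b'" and "c = c'"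
  shows "a = a'" "b = b'"
proof -
  define K where "K = int k"
  have K: "K \<ge> 3" "k = 3 \<longleftrightarrow> K = 3"
    using assms(1) by (auto simp: K_def)
  have *: "a = K - 1 \<and> b = K - 1 \<or> a = K - 1 \<and> b = K \<or> a = K \<and> b = K \<or> K = 3 \<and> a = 1 \<and> b = 2"
    if "(a, b, c) \<in> pair_ranks k" for a b c
    using that unfolding pair_ranks_def Let_def K_def[symmetric] K(2) by (auto split: if_splits)
  have "a = a' \<and> b = b'"
    using *[OF assms(2)] *[OF assms(3)] assms(4) by (elim disjE) auto
  then show "a = a'" "b = b'"
    by simp_all
qed

lemma isomorphic_one_element:
  assumes "fst P = {e}" and "fst Q = {e'}" and "snd P {} = 0" and "snd Q {} = 0"
    and "snd P {e} = snd Q {e'}"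
  shows "isomorphic P Q"
proof -
  have "snd Q ((\<lambda>_. e') ` A) = snd P A" if "A \<subseteq> {e}" for A
  proof -
    have "A = {} \<or> A = {e}"
      using that by auto
    then show ?thesis
      using assms by auto
  qed
  moreover have "bij_betw (\<lambda>_. e') {e} {e'}"
    by (simp add: bij_betw_def)
  ultimately show ?thesis
    unfolding isomorphic_def using assms(1,2) by (intro exI[of _ "\<lambda>_. e'"]) simp
qed

lemma isomorphic_two_element:
  assumes "e \<noteq> f" "fst P = {e, f}" and "e' \<noteq> f'" "fst Q = {e', f'}"
    and "snd P {} = 0" and "snd Q {} = 0"
    and "snd P {e} = snd Q {e'}" "snd P {f} = snd Q {f'}" "snd P {e, f} = snd Q {e', f'}"
  shows "isomorphic P Q"
proof -
  let ?g = "\<lambda>x. if x = e then e' else f'"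
  have "snd Q (?g ` A) = snd P A" if "A \<subseteq> {e, f}" for A
  proof -
    have "A = {} \<or> A = {e} \<or> A = {f} \<or> A = {e, f}"
      using that by blast
    then show ?thesis
      using assms(1,5-9) by (elim disjE) (simp_all add: insert_commute)
  qed
  moreover have "bij_betw ?g {e, f} {e', f'}"
    using assms(1,3) by (auto simp: bij_betw_def)
  ultimately show ?thesis
    unfolding isomorphic_def using assms(2,4) by (intro exI[of _ ?g]) simp
qed

lemma isomorphic_four_element:
  assumes P: "card (fst P) = 4" "G \<subseteq> fst P"
      "\<And>A. A \<subseteq> fst P \<Longrightarrow> snd P A = int (min (card A) 2) + int ((k - 1) * card (A \<inter> G))"
    and Q: "card (fst Q) = 4" "G' \<subseteq> fst Q"
      "\<And>A. A \<subseteq> fst Q \<Longrightarrow> snd Q A = int (min (card A) 2) + int ((k - 1) * card (A \<inter> G'))"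
    and "card G = card G'"
  shows "isomorphic P Q"
proof -
  have fin: "finite (fst P)" "finite (fst Q)" "finite G" "finite G'"
    using P(1,2) Q(1,2) by (auto simp: card_ge_0_finite intro: finite_subset)
  obtain g where g: "bij_betw g G G'"
    using finite_same_card_bij[OF fin(3,4) \<open>card G = card G'\<close>] by (rule exE)
  have "card (fst P - G) = card (fst Q - G')"
    using P(1,2) Q(1,2) fin \<open>card G = card G'\<close> by (simp add: card_Diff_subset)
  then obtain h where h: "bij_betw h (fst P - G) (fst Q - G')"
    using finite_same_card_bij[of "fst P - G" "fst Q - G'"] fin by auto
  define f where "f x = (if x \<in> G then g x else h x)" for x
  have f1: "bij_betw f G G'"
    using g bij_betw_cong[of G f g G'] by (simp add: f_def)
  have f2: "bij_betw f (fst P - G) (fst Q - G')"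
    using h bij_betw_cong[of "fst P - G" f h "fst Q - G'"] by (simp add: f_def)
  have bij: "bij_betw f (fst P) (fst Q)"
    using bij_betw_combine[OF f1 f2] P(2) Q(2) by (simp add: Un_absorb1)
  have inj: "inj_on f (fst P)"
    using bij by (rule bij_betw_imp_inj_on)
  have "snd Q (f ` A) = snd P A" if A: "A \<subseteq> fst P" for A
  proof -
    have "f x \<in> G' \<longleftrightarrow> x \<in> G" if "x \<in> fst P" for x
      using bij_betwE[OF f1] bij_betwE[OF f2] that by (cases "x \<in> G") auto
    then have "f ` A \<inter> G' = f ` (A \<inter> G)"
      using A by blast
    moreover have "card (f ` A) = card A" "card (f ` (A \<inter> G)) = card (A \<inter> G)"
      using inj A by (auto intro!: card_image elim: inj_on_subset)
    moreover have "f ` A \<subseteq> fst Q"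
      using bij_betwE[OF bij] A by blast
    ultimately show ?thesis
      using P(3)[OF A] Q(3)[of "f ` A"] by simp
  qed
  then show ?thesis
    unfolding isomorphic_def using bij by (intro exI[of _ f]) simp
qed

lemma k_polymatroid_empty: "k_polymatroid k P \<Longrightarrow> snd P {} = 0"
  by (cases P) (simp add: k_polymatroid_def polymatroid_def)

lemma card_families:
  "one_element_family k P \<Longrightarrow> card (fst P) = 1"
  "two_element_family k P \<Longrightarrow> card (fst P) = 2"
  "four_element_family k P \<Longrightarrow> card (fst P) = 4"
  by (auto simp: one_element_family_def two_element_family_def four_element_family_def)

lemma isomorphic_if_same_profile:
  assumes "k \<ge> 3" and P: "P \<in> excluded_minors k" and Q: "Q \<in> excluded_minors k"
    and same: "profile P = profile Q"
  shows "isomorphic P Q"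
proof -
  have P0: "snd P {} = 0" and Q0: "snd Q {} = 0"
    using P Q k_polymatroid_empty[of k P] k_polymatroid_empty[of k Q] by (simp_all add: excluded_minors_def)
  have "one_element_family k P \<or> two_element_family k P \<or> four_element_family k P"
    using P excluded_minors_families[OF assms(1), of P] by simp
  moreover have Qfam: "one_element_family k Q \<or> two_element_family k Q \<or> four_element_family k Q"
    using Q excluded_minors_families[OF assms(1), of Q] by simp
  have same_card: "card (fst P) = card (fst Q)"
    using same by (simp add: profile_def)
  ultimately show ?thesis
  proof (elim disjE)
    assume P1: "one_element_family k P"
    then have "one_element_family k Q"
      using Qfam same_card card_families(1)[OF P1] card_families(2,3)[of k Q] by auto
    then obtain e e' where e: "fst P = {e}" "fst Q = {e'}"
      using P1 by (auto simp: one_element_family_def)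
    then have "snd P {e} = snd Q {e'}"
      using same profile_one_element[OF e(1)] profile_one_element[OF e(2)] by simp
    then show ?thesis
      by (rule isomorphic_one_element[OF e P0 Q0])
  next
    assume P2: "two_element_family k P"
    then have Q2: "two_element_family k Q"
      using Qfam same_card card_families(2)[OF P2] card_families(1,3)[of k Q] by auto
    obtain e f where ef: "e \<noteq> f" "fst P = {e, f}" "(snd P {e}, snd P {f}, snd P {e, f}) \<in> pair_ranks k"
      using P2 unfolding two_element_family_def by (elim exE conjE) simp
    obtain e' f' where ef': "e' \<noteq> f'" "fst Q = {e', f'}"
      "(snd Q {e'}, snd Q {f'}, snd Q {e', f'}) \<in> pair_ranks k"
      using Q2 unfolding two_element_family_def by (elim exE conjE) simp
    have eq: "snd P {e} + snd P {f} = snd Q {e'} + snd Q {f'}" "snd P {e, f} = snd Q {e', f'}"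
      using same profile_two_element[OF ef(1,2)] profile_two_element[OF ef'(1,2)] by simp_all
    show ?thesis
      by (rule isomorphic_two_element[OF ef(1,2) ef'(1,2) P0 Q0
          pair_ranks_inj[OF assms(1) ef(3) ef'(3) eq] eq(2)])
  next
    assume P4: "four_element_family k P"
    then have Q4: "four_element_family k Q"
      using Qfam same_card card_families(3)[OF P4] card_families(1,2)[of k Q] by auto
    obtain G where G: "card (fst P) = 4" "G \<subseteq> fst P"
      "\<And>A. A \<subseteq> fst P \<Longrightarrow> snd P A = int (min (card A) 2) + int ((k - 1) * card (A \<inter> G))"
      using P4 unfolding four_element_family_def by (elim exE conjE) simp
    obtain G' where G': "card (fst Q) = 4" "G' \<subseteq> fst Q"
      "\<And>A. A \<subseteq> fst Q \<Longrightarrow> snd Q A = int (min (card A) 2) + int ((k - 1) * card (A \<inter> G'))"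
      using Q4 unfolding four_element_family_def by (elim exE conjE) simp
    have "int ((k - 1) * card G) = int ((k - 1) * card G')"
      using same profile_four_element[OF G] profile_four_element[OF G'] by simp
    then have "card G = card G'"
      using assms(1) by (simp only: of_nat_eq_iff mult_cancel1) simp
    with G G' show ?thesis
      by (rule isomorphic_four_element)
  qed
qed

definition profiles :: "nat \<Rightarrow> (nat \<times> int \<times> int) set" where
  "profiles k = (\<lambda>a. (1, a, a)) ` {2..int k - 2} \<union> (\<lambda>(a, b, c). (2, a + b, c)) ` pair_ranks k \<union>
     (\<lambda>j. (4, 4 + int ((k - 1) * j), 2 + int ((k - 1) * j))) ` {..4}"

lemma card_pair_ranks:
  assumes "k \<ge> 3"
  shows "finite (pair_ranks k)" "card (pair_ranks k) = (if k = 3 then 7 else 5)"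
  by (auto simp: pair_ranks_def Let_def)

lemma card_profiles:
  assumes "k \<ge> 3"
  shows "card (profiles k) = (if k = 3 then 12 else k + 7)"
proof -
  let ?A = "(\<lambda>a. (1, a, a)) ` {2..int k - 2} :: (nat \<times> int \<times> int) set"
  let ?B = "(\<lambda>(a, b, c). (2, a + b, c)) ` pair_ranks k :: (nat \<times> int \<times> int) set"
  let ?C = "(\<lambda>j. (4, 4 + int ((k - 1) * j), 2 + int ((k - 1) * j))) ` {..4} :: (nat \<times> int \<times> int) set"
  have "card ?A = k - 3"
    by (subst card_image) (auto simp: inj_on_def)
  moreover have "card ?B = card (pair_ranks k)"
  proof (rule card_image, rule inj_onI)
    fix p q
    assume pq: "p \<in> pair_ranks k" "q \<in> pair_ranks k"
      and eq: "(case p of (a, b, c) \<Rightarrow> (2 :: nat, a + b, c)) = (case q of (a, b, c) \<Rightarrow> (2, a + b, c))"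
    obtain a b c a' b' c' where "p = (a, b, c)" "q = (a', b', c')"
      by (cases p; cases q) simp
    then show "p = q"
      using pq eq pair_ranks_inj[OF assms, of a b c a' b' c'] by simp
  qed
  moreover have "card ?C = 5"
  proof -
    have "inj_on (\<lambda>j. (4 :: nat, 4 + int ((k - 1) * j), 2 + int ((k - 1) * j))) {..4}"
    proof (rule inj_onI)
      fix i j
      assume "(4 :: nat, 4 + int ((k - 1) * i), 2 + int ((k - 1) * i)) =
        (4, 4 + int ((k - 1) * j), 2 + int ((k - 1) * j))"
      then have "(k - 1) * i = (k - 1) * j"
        by (simp only: prod.inject add_left_cancel of_nat_eq_iff)
      then show "i = j"
        using assms by simp
    qed
    then show ?thesis
      by (simp only: card_image) simp
  qed
  moreover have "card (profiles k) = card ?A + card ?B + card ?C"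
  proof -
    have fin: "finite ?A" "finite ?B" "finite ?C"
      using card_pair_ranks(1)[OF assms] by simp_all
    moreover have "?A \<inter> ?B = {}" "(?A \<union> ?B) \<inter> ?C = {}"
      by auto
    ultimately show ?thesis
      unfolding profiles_def by (simp only: card_Un_disjoint finite_Un simp_thms)
  qed
  ultimately show ?thesis
    using card_pair_ranks(2)[OF assms] assms by simp
qed

lemma pair_polymatroid:
  assumes xy: "x \<noteq> y" and "0 \<le> a" "0 \<le> b" "a \<le> c" "b \<le> c" "c \<le> a + b" "a \<le> int k" "b \<le> int k"
  shows "k_polymatroid k ({x, y}, \<lambda>A. if x \<in> A \<and> y \<in> A then c else if x \<in> A then a else if y \<in> A then b else 0)"
  using assms unfolding k_polymatroid_def polymatroid_def by auto

lemma four_element_polymatroid: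
  assumes "finite E" and "k \<ge> 1" and "G \<subseteq> E"
  shows "k_polymatroid k (E, \<lambda>A. int (min (card A) 2) + int ((k - 1) * card (A \<inter> G)))"
proof -
  let ?r = "\<lambda>A. int (min (card A) 2) + int ((k - 1) * card (A \<inter> G))"
  have mono: "?r A \<le> ?r B" if "A \<subseteq> B" "B \<subseteq> E" for A B
  proof -
    have "finite B"
      using that(2) assms(1) by (rule finite_subset)
    then have "card A \<le> card B" "card (A \<inter> G) \<le> card (B \<inter> G)"
      using that(1) by (auto intro!: card_mono)
    then show ?thesis
      by (intro add_mono) (auto intro!: mult_le_mono2 simp del: of_nat_mult)
  qed
  have sub: "?r (A \<inter> B) + ?r (A \<union> B) \<le> ?r A + ?r B" if "A \<subseteq> E" "B \<subseteq> E" for A B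
  proof -
    have fin: "finite A" "finite B"
      using that assms(1) by (auto dest: finite_subset)
    have "card (A \<inter> B) \<le> card A" "card (A \<inter> B) \<le> card B" "card A + card B = card (A \<union> B) + card (A \<inter> B)"
      using fin by (auto intro: card_mono card_Un_Int)
    then have "min (card (A \<inter> B)) 2 + min (card (A \<union> B)) 2 \<le> min (card A) 2 + min (card B) 2"
      by (simp add: min_def)
    moreover have "(A \<inter> G) \<union> (B \<inter> G) = (A \<union> B) \<inter> G" "(A \<inter> G) \<inter> (B \<inter> G) = (A \<inter> B) \<inter> G"
      by auto
    then have "card (A \<inter> G) + card (B \<inter> G) = card ((A \<union> B) \<inter> G) + card ((A \<inter> B) \<inter> G)"
      using card_Un_Int[of "A \<inter> G" "B \<inter> G"] fin by simp
    then have "(k - 1) * card (A \<inter> G) + (k - 1) * card (B \<inter> G) =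
        (k - 1) * card ((A \<union> B) \<inter> G) + (k - 1) * card ((A \<inter> B) \<inter> G)"
      by (simp flip: distrib_left)
    ultimately show ?thesis
      by linarith
  qed
  have "?r {e} \<le> int k" for e
    using assms(2) by (cases "e \<in> G") auto
  then show ?thesis
    unfolding k_polymatroid_def polymatroid_def using assms(1) mono sub by simp
qed

lemma profile_image:
  assumes "infinite (UNIV :: 'a set)" and k: "k \<ge> 3"
  shows "profile ` (excluded_minors k :: 'a set_function set) = profiles k"
proof
  show "profile ` (excluded_minors k :: 'a set_function set) \<subseteq> profiles k"
  proof
    fix p
    assume "p \<in> profile ` (excluded_minors k :: 'a set_function set)"
    then obtain P :: "'a set_function" where P: "P \<in> excluded_minors k" "p = profile P"
      by auto
    have "one_element_family k P \<or> two_element_family k P \<or> four_element_family k P"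
      using P(1) excluded_minors_families[OF k, of P] by simp
    then show "p \<in> profiles k"
    proof (elim disjE)
      assume "one_element_family k P"
      then obtain e where "fst P = {e}" "2 \<le> snd P {e}" "snd P {e} \<le> int k - 2"
        unfolding one_element_family_def by (elim exE conjE) simp
      then show ?thesis
        using profile_one_element[of P e] P(2) by (simp add: profiles_def)
    next
      assume "two_element_family k P"
      then obtain e f where ef: "e \<noteq> f" "fst P = {e, f}"
        "(snd P {e}, snd P {f}, snd P {e, f}) \<in> pair_ranks k"
        unfolding two_element_family_def by (elim exE conjE) simp
      have "p = (\<lambda>(a, b, c). (2, a + b, c)) (snd P {e}, snd P {f}, snd P {e, f})"
        using profile_two_element[OF ef(1,2)] P(2) by simp
      then show ?thesis
        using ef(3) unfolding profiles_def by blast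
    next
      assume "four_element_family k P"
      then obtain G where G: "card (fst P) = 4" "G \<subseteq> fst P"
        "\<And>A. A \<subseteq> fst P \<Longrightarrow> snd P A = int (min (card A) 2) + int ((k - 1) * card (A \<inter> G))"
        unfolding four_element_family_def by (elim exE conjE) simp
      have "card G \<le> 4"
        using card_mono[OF _ G(2)] G(1) by (simp add: card_ge_0_finite)
      then show ?thesis
        using profile_four_element[OF G] P(2) unfolding profiles_def by auto
    qed
  qed
  show "profiles k \<subseteq> profile ` (excluded_minors k :: 'a set_function set)"
  proof
    fix p
    assume "p \<in> profiles k"
    then consider a where "a \<in> {2..int k - 2}" "p = (1, a, a)"
      | a b c where "(a, b, c) \<in> pair_ranks k" "p = (2, a + b, c)"
      | j where "j \<le> 4" "p = (4, 4 + int ((k - 1) * j), 2 + int ((k - 1) * j))"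
      unfolding profiles_def by auto
    then show "p \<in> profile ` (excluded_minors k :: 'a set_function set)"
    proof cases
      case 1
      obtain x :: 'a where "x \<in> UNIV"
        by blast
      let ?P = "({x}, \<lambda>A. if x \<in> A then a else 0)"
      have "k_polymatroid k ?P"
        using 1(1) unfolding k_polymatroid_def polymatroid_def by auto
      moreover have "one_element_family k ?P"
        using 1(1) by (simp add: one_element_family_def)
      ultimately have mem: "?P \<in> excluded_minors k"
        using excluded_minors_families[OF k, of ?P] by simp
      have prof: "profile ?P = p"
        using 1(2) profile_one_element[of ?P x] by simp
      show ?thesis
        unfolding prof[symmetric] using mem by (rule imageI)
    next
      case 2
      obtain T :: "'a set" where "card T = 2"
        using infinite_arbitrarily_large[OF assms(1), of 2] by (elim exE conjE)
      then obtain x y :: 'a where xy: "x \<noteq> y"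
        by (auto simp: card_2_iff)
      let ?P = "({x, y}, \<lambda>A. if x \<in> A \<and> y \<in> A then c else if x \<in> A then a else if y \<in> A then b else 0)"
      have "0 \<le> a" "0 \<le> b" "a \<le> c" "b \<le> c" "c \<le> a + b" "a \<le> int k" "b \<le> int k"
        using 2(1) k by (auto simp: pair_ranks_def Let_def split: if_splits)
      then have "k_polymatroid k ?P"
        by (rule pair_polymatroid[OF xy])
      moreover have "two_element_family k ?P"
        unfolding two_element_family_def
        by (rule exI[of _ x], rule exI[of _ y]) (use xy 2(1) in auto)
      ultimately have mem: "?P \<in> excluded_minors k"
        using excluded_minors_families[OF k, of ?P] by simp
      have prof: "profile ?P = p"
        using profile_two_element[OF xy, of ?P] xy 2(2) by auto
      show ?thesis
        unfolding prof[symmetric] using mem by (rule imageI)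
    next
      case 3
      obtain E :: "'a set" where E: "finite E" "card E = 4"
        using infinite_arbitrarily_large[OF assms(1), of 4] by (elim exE conjE)
      obtain G where G: "G \<subseteq> E" "card G = j"
        using obtain_subset_with_card_n[of j E] E 3(1) by auto
      let ?P = "(E, \<lambda>A. int (min (card A) 2) + int ((k - 1) * card (A \<inter> G)))"
      have "k_polymatroid k ?P"
        using E(1) k G(1) by (intro four_element_polymatroid) auto
      moreover have "four_element_family k ?P"
        unfolding four_element_family_def using E(2) G(1) by auto
      ultimately have mem: "?P \<in> excluded_minors k"
        using excluded_minors_families[OF k, of ?P] by simp
      have prof: "profile ?P = p"
        using profile_four_element[of ?P G k] E(2) G 3(2) by simp
      show ?thesis
        unfolding prof[symmetric] using mem by (rule imageI)
    qed
  qed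
qed

lemma card_image_eq_if_same_fibres:
  assumes "\<And>x y. x \<in> A \<Longrightarrow> y \<in> A \<Longrightarrow> f x = f y \<longleftrightarrow> g x = g y"
  shows "card (f ` A) = card (g ` A)"
proof -
  let ?h = "\<lambda>z. g (inv_into A f z)"
  have h: "?h (f x) = g x" if "x \<in> A" for x
    using assms[of "inv_into A f (f x)" x] that by (simp add: inv_into_into f_inv_into_f)
  have "g ` A = ?h ` f ` A"
    using h by (force simp: image_image)
  moreover have "inj_on ?h (f ` A)"
    using h assms by (auto simp: inj_on_def)
  ultimately show ?thesis
    by (simp add: card_image)
qed

lemma card_excluded_minor_classes:
  assumes "infinite (UNIV :: 'a set)" and k: "k \<ge> 3"
  shows "card (excluded_minor_classes k :: 'a set_function set set) = (if k = 3 then 12 else k + 7)"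
proof -
  let ?EM = "excluded_minors k :: 'a set_function set"
  have "excluded_minor_classes k = (\<lambda>P. iso_on ?EM `` {P}) ` ?EM"
    by (auto simp: excluded_minor_classes_def quotient_def)
  moreover have "card ((\<lambda>P. iso_on ?EM `` {P}) ` ?EM) = card (profile ` ?EM)"
  proof (rule card_image_eq_if_same_fibres)
    fix P Q :: "'a set_function"
    assume PQ: "P \<in> ?EM" "Q \<in> ?EM"
    have "iso_on ?EM `` {P} = iso_on ?EM `` {Q} \<longleftrightarrow> (P, Q) \<in> iso_on ?EM"
      by (rule eq_equiv_class_iff[OF equiv_iso_on PQ])
    also have "\<dots> \<longleftrightarrow> isomorphic P Q"
      using PQ by (simp add: iso_on_def)
    also have "\<dots> \<longleftrightarrow> profile P = profile Q"
      using profile_isomorphic isomorphic_if_same_profile[OF k PQ] by blast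
    finally show "iso_on ?EM `` {P} = iso_on ?EM `` {Q} \<longleftrightarrow> profile P = profile Q" .
  qed
  ultimately show ?thesis
    using profile_image[OF assms] card_profiles[OF k] by simp
qed

theorem mainTheorem1:
  assumes "infinite (UNIV :: 'a set)"
  shows "card (excluded_minor_classes 3 :: 'a set_function set set) = 12 \<and>
         (\<forall>k > 3. card (excluded_minor_classes k :: 'a set_function set set) = k + 7) \<and>
         (\<forall>k \<ge> 3. finite (excluded_minor_classes k :: 'a set_function set set))"
proof (intro conjI allI impI)
  show "card (excluded_minor_classes 3 :: 'a set_function set set) = 12"
    using card_excluded_minor_classes[OF assms, of 3] by simp
  show "card (excluded_minor_classes k :: 'a set_function set set) = k + 7" if "k > 3" for k
    using card_excluded_minor_classes[OF assms, of k] that by simp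
  show "finite (excluded_minor_classes k :: 'a set_function set set)" if "k \<ge> 3" for k
    using card_excluded_minor_classes[OF assms that] by (intro card_ge_0_finite) simp
qed

end
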